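(* Let $K = R(\mathcal{D}^{\mathbb{N}})$ be a Bedford-McMullen sponge. Then the following two conditions are equivalent: (A) $\dim_{\mathrm H} K = \dim_{\mathrm B} K$; (B) there is a gauge function $\varphi$ such that $0 < \mathcal{H}^{\varphi}(K) < \infty$.
   Context: Let $d \ge 3$, let $m_1 \ge \cdots \ge m_d \ge 2$ be integers, $\Lambda = \operatorname{diag}(m_1,\ldots,m_d)$, $\mathbb{T}^d = \mathbb{R}^d/\mathbb{Z}^d$, and $\mathcal{A} = \prod_{j=1}^d \{0,\ldots,m_j-1\}$. Define $R \colon \mathcal{A}^{\mathbb{N}} \to \mathbb{T}^d$ by $R(x) = \sum_{k=1}^\infty \Lambda^{-k} x_k$ (mod $\mathbb{Z}^d$). A Bedford-McMullen sponge is a set of the form $K = R(\mathcal{D}^{\mathbb{N}})$ with $\emptyset \neq \mathcal{D} \subset \mathcal{A}$. $\dim_{\mathrm H}$ and $\dim_{\mathrm B}$ denote the Hausdorff and box dimensions. A gauge function is a continuous increasing function $\varphi \colon [0,\infty) \to [0,\infty)$ with $\varphi(0) = 0$; the power functions $t \mapsto t^\gamma$ are allowed for all $\gamma \ge 0$ (for $\gamma = 0$ this means $\mathcal{H}^0$, the counting measure). The Hausdorff measure is $\mathcal{H}^\varphi(E) = \lim_{\delta \to 0} \inf\{\sum_i \varphi(|E_i|) : \{E_i\}_{i \ge 1} \text{ covers } E,\ |E_i| \le \delta \text{ for all } i\}$, where $|F|$ is the diameter of $F$ in the Euclidean metric (on $\mathbb{T}^d$, the quotient metric). *)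

theory Defs
  imports "HOL-Analysis.Analysis"
begin

definition lattice_equiv :: "real ^ 'n \<Rightarrow> real ^ 'n \<Rightarrow> bool" where
  "lattice_equiv x y \<longleftrightarrow> (\<forall>j. x $ j - y $ j \<in> \<int>)"

lemma lattice_equiv_refl: "lattice_equiv x x"
  by (simp add: lattice_equiv_def)

lemma lattice_equiv_sym: "lattice_equiv x y \<Longrightarrow> lattice_equiv y x"
  unfolding lattice_equiv_def by (metis Ints_minus minus_diff_eq)

lemma lattice_equiv_trans: "lattice_equiv x y \<Longrightarrow> lattice_equiv y z \<Longrightarrow> lattice_equiv x z"
  unfolding lattice_equiv_def by (metis Ints_add diff_add_cancel add_diff_eq)

quotient_type 'n torus = "real ^ 'n" / lattice_equiv
  morphisms rep_torus to_torus
  by (intro equivpI reflpI sympI transpI)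
     (blast intro: lattice_equiv_refl lattice_equiv_sym lattice_equiv_trans)+

lemma to_torus_eq_iff: "to_torus x = to_torus y \<longleftrightarrow> lattice_equiv x y"
  by (rule torus.abs_eq_iff)

lemma to_torus_surj: "\<exists>x. to_torus x = p"
  by (metis Quotient3_torus Quotient3_abs_rep)

lemma setdist_fibres:
  "setdist {u. to_torus u = to_torus x} {v. to_torus v = to_torus y}
     = infdist x {v. to_torus v = to_torus y}" (is "setdist ?A ?B = _")
proof (rule antisym)
  have ne: "?B \<noteq> {}" by blast
  show "setdist ?A ?B \<le> infdist x ?B"
    using setdist_subset_left[of "{x}" ?A ?B] ne
    by (auto simp: infdist_eq_setdist)
  show "infdist x ?B \<le> setdist ?A ?B"
  proof (rule le_setdistI)
    show "?A \<noteq> {}" "?B \<noteq> {}" by blast+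
    fix u v assume u: "u \<in> ?A" and v: "v \<in> ?B"
    have "v + (x - u) \<in> ?B"
    proof -
      have "lattice_equiv u x" "lattice_equiv v y" using u v by (auto simp: to_torus_eq_iff)
      then have "\<And>j. (v $ j - y $ j) - (u $ j - x $ j) \<in> \<int>"
        unfolding lattice_equiv_def by (simp add: Ints_diff)
      then show ?thesis
        by (simp add: to_torus_eq_iff lattice_equiv_def algebra_simps)
    qed
    then have "infdist x ?B \<le> dist x (v + (x - u))" by (rule infdist_le)
    also have "\<dots> = dist u v" by (simp add: dist_norm algebra_simps norm_minus_commute)
    finally show "infdist x ?B \<le> dist u v" .
  qed
qed

lemma closed_fibre: "closed {v. to_torus v = to_torus (y :: real ^ 'n)}"
proof -
  have eq: "{v. to_torus v = to_torus y} = (\<Inter>j. (\<lambda>v. v $ j - y $ j) -` \<int>)"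
    by (auto simp: to_torus_eq_iff lattice_equiv_def)
  have "closed ((\<lambda>v::real^'n. v $ j - y $ j) -` \<int>)" for j
    by (intro continuous_closed_vimage closed_Ints continuous_intros)
  then show ?thesis unfolding eq by blast
qed

instantiation torus :: (finite) metric_space
begin

text \<open>Quotient metric: the infimum of the Euclidean distances between representatives.\<close>

definition dist_torus :: "'a torus \<Rightarrow> 'a torus \<Rightarrow> real" where
  "dist_torus p q = setdist {x. to_torus x = p} {y. to_torus y = q}"

definition uniformity_torus :: "('a torus \<times> 'a torus) filter" where
  "uniformity_torus = (INF e\<in>{0 <..}. principal {(x, y). dist x y < e})"

definition open_torus :: "'a torus set \<Rightarrow> bool" where
  "open_torus U \<longleftrightarrow> (\<forall>x\<in>U. \<forall>\<^sub>F (x', y) in uniformity. x' = x \<longrightarrow> y \<in> U)"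

instance
proof
  have sym: "dist a b = dist b a" for a b :: "'a torus"
    unfolding dist_torus_def by (rule setdist_sym)
  have triangle: "dist r q \<le> dist r p + dist p q" for p q r :: "'a torus"
  proof -
    obtain x y z where p: "p = to_torus x" and q: "q = to_torus y" and r: "r = to_torus z"
      using to_torus_surj by metis
    let ?P = "{v. to_torus v = to_torus x}" and ?Q = "{v. to_torus v = to_torus y}"
    have "infdist z ?Q - infdist x ?Q \<le> dist z w" if w: "w \<in> ?P" for w
    proof -
      have "infdist w ?Q = infdist x ?Q"
        using setdist_fibres[of w y] setdist_fibres[of x y] w by simp
      then show ?thesis
        using infdist_triangle[of z ?Q w] by simp
    qed
    moreover have ne: "?P \<noteq> {}" by blast
    ultimately have "infdist z ?Q - infdist x ?Q \<le> infdist z ?P"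
      unfolding infdist_notempty[OF ne] by (intro cINF_greatest[OF ne])
    then show ?thesis
      unfolding dist_torus_def p q r setdist_fibres by simp
  qed
  fix p q r :: "'a torus"
  obtain x y where xy: "p = to_torus x" "q = to_torus y"
    using to_torus_surj by metis
  show "dist p q = 0 \<longleftrightarrow> p = q"
    unfolding dist_torus_def xy setdist_fibres
    using in_closed_iff_infdist_zero[OF closed_fibre[of y], of x] by blast
  show "dist p q \<le> dist p r + dist q r"
    using triangle[of p q r] sym[of q r] by simp
qed (rule uniformity_torus_def open_torus_def)+

end

text \<open>The gauge is applied to a set rather than to its diameter, with value \<open>0\<close> on the empty
  set. For \<open>\<phi> 0 = 0\<close> this changes nothing; for the constant gauge \<open>1\<close> it makes the
  resulting Hausdorff measure the counting measure.\<close>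

definition gauge_size :: "(real \<Rightarrow> real) \<Rightarrow> 'a::metric_space set \<Rightarrow> ennreal" where
  "gauge_size \<phi> E = (if E = {} then 0 else ennreal (\<phi> (diameter E)))"

text \<open>The library's \<^const>\<open>diameter\<close> is only meaningful on bounded sets.\<close>

definition delta_covers :: "real \<Rightarrow> 'a::metric_space set \<Rightarrow> (nat \<Rightarrow> 'a set) set" where
  "delta_covers \<delta> K = {E. K \<subseteq> (\<Union>i. E i) \<and> (\<forall>i. bounded (E i) \<and> diameter (E i) \<le> \<delta>)}"

definition hausdorff_premeasure ::
    "(real \<Rightarrow> real) \<Rightarrow> real \<Rightarrow> 'a::metric_space set \<Rightarrow> ennreal" where
  "hausdorff_premeasure \<phi> \<delta> K = (INF E\<in>delta_covers \<delta> K. \<Sum>i. gauge_size \<phi> (E i))"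

definition hausdorff_measure :: "(real \<Rightarrow> real) \<Rightarrow> 'a::metric_space set \<Rightarrow> ennreal" where
  "hausdorff_measure \<phi> K = Lim (at_right 0) (\<lambda>\<delta>. hausdorff_premeasure \<phi> \<delta> K)"

lemma hausdorff_premeasure_antimono:
  "\<delta> \<le> \<epsilon> \<Longrightarrow> hausdorff_premeasure \<phi> \<epsilon> K \<le> hausdorff_premeasure \<phi> \<delta> K"
  unfolding hausdorff_premeasure_def
  by (rule INF_superset_mono) (auto simp: delta_covers_def intro: order_trans)

lemma hausdorff_premeasure_tendsto_SUP:
  "((\<lambda>\<delta>. hausdorff_premeasure \<phi> \<delta> K) \<longlongrightarrow> (SUP \<delta>\<in>{0<..}. hausdorff_premeasure \<phi> \<delta> K)) (at_right 0)"
proof (rule increasing_tendsto)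
  show "\<forall>\<^sub>F \<delta> in at_right 0. hausdorff_premeasure \<phi> \<delta> K
      \<le> (SUP \<delta>\<in>{0<..}. hausdorff_premeasure \<phi> \<delta> K)"
    by (auto simp: eventually_at_right_field intro!: exI[of _ 1] SUP_upper)
  fix c assume "c < (SUP \<delta>\<in>{0<..}. hausdorff_premeasure \<phi> \<delta> K)"
  then obtain \<epsilon> where "\<epsilon> > 0" "c < hausdorff_premeasure \<phi> \<epsilon> K"
    by (auto simp: less_SUP_iff)
  then show "\<forall>\<^sub>F \<delta> in at_right 0. c < hausdorff_premeasure \<phi> \<delta> K"
    using hausdorff_premeasure_antimono[of _ \<epsilon> \<phi> K]
    by (auto simp: eventually_at_right_field intro!: exI[of _ \<epsilon>] elim: less_le_trans)
qed

lemma hausdorff_measure_tendsto: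
  "((\<lambda>\<delta>. hausdorff_premeasure \<phi> \<delta> K) \<longlongrightarrow> hausdorff_measure \<phi> K) (at_right 0)"
  using hausdorff_premeasure_tendsto_SUP[of \<phi> K]
  by (simp add: hausdorff_measure_def tendsto_Lim)

lemma hausdorff_measure_eq_SUP:
  "hausdorff_measure \<phi> K = (SUP \<delta>\<in>{0<..}. hausdorff_premeasure \<phi> \<delta> K)"
  by (rule tendsto_unique[OF _ hausdorff_measure_tendsto hausdorff_premeasure_tendsto_SUP]) simp

text \<open>The case split avoids \<open>0 powr 0 = 0\<close>.\<close>

definition power_gauge :: "real \<Rightarrow> real \<Rightarrow> real" where
  "power_gauge \<gamma> t = (if \<gamma> = 0 then 1 else t powr \<gamma>)"

text \<open>Gauge functions only matter on \<open>[0,\<infinity>)\<close>. The power functions are listed separately because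
  the exponent \<open>0\<close> violates \<open>\<phi> 0 = 0\<close>. Increasing is meant in the weak sense.\<close>

definition gauge_function :: "(real \<Rightarrow> real) \<Rightarrow> bool" where
  "gauge_function \<phi> \<longleftrightarrow>
     (continuous_on {0..} \<phi> \<and> mono_on {0..} \<phi> \<and> \<phi> 0 = 0) \<or>
     (\<exists>\<gamma>\<ge>0. \<forall>t\<ge>0. \<phi> t = power_gauge \<gamma> t)"

definition hausdorff_dim :: "'a::metric_space set \<Rightarrow> ereal" where
  "hausdorff_dim K = Inf {ereal \<gamma> | \<gamma>. \<gamma> \<ge> 0 \<and> hausdorff_measure (power_gauge \<gamma>) K = 0}"

text \<open>Meaningful for totally bounded sets.\<close>

definition covering_number :: "real \<Rightarrow> 'a::metric_space set \<Rightarrow> nat" where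
  "covering_number \<delta> K =
     Inf {card C | C. finite C \<and> K \<subseteq> \<Union>C \<and> (\<forall>E\<in>C. bounded E \<and> diameter E \<le> \<delta>)}"

text \<open>Meaningful for sets whose lower and upper box dimensions agree, as they do for sponges.\<close>

definition box_dim :: "'a::metric_space set \<Rightarrow> ereal" where
  "box_dim K = Lim (at_right 0) (\<lambda>\<delta>. ereal (ln (real (covering_number \<delta> K)) / ln (1 / \<delta>)))"

definition digit_alphabet :: "('n \<Rightarrow> nat) \<Rightarrow> ('n \<Rightarrow> nat) set" where
  "digit_alphabet m = {a. \<forall>j. a j < m j}"

text \<open>Digit sequences are indexed from \<open>0\<close>, so that \<open>x k\<close> is the digit with weight
  \<open>\<Lambda>\<close> to the power \<open>-(k + 1)\<close>, where \<open>\<Lambda>\<close> is the diagonal matrix with entries \<open>m j\<close>.\<close>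

definition coding_map :: "('n \<Rightarrow> nat) \<Rightarrow> (nat \<Rightarrow> 'n \<Rightarrow> nat) \<Rightarrow> 'n::finite torus" where
  "coding_map m x = to_torus (\<Sum>k. \<chi> j. real (x k j) / real (m j) ^ Suc k)"

definition sponge :: "('n \<Rightarrow> nat) \<Rightarrow> ('n \<Rightarrow> nat) set \<Rightarrow> 'n::finite torus set" where
  "sponge m D = coding_map m ` {x. \<forall>k. x k \<in> D}"

end

theory Submission
  imports Defs
begin

text \<open>
  \<^bold>\<open>Setting.\<close> Since \<open>\<Lambda>\<close> scales the coordinates differently, cylinders are not roughly cubes. A set
  of points of \<open>K\<close> of diameter about \<open>2\<^sup>-\<^sup>n\<close> is obtained by fixing, in coordinate \<open>j\<close>, the first
  \<open>depth n j \<approx> n ln 2 / ln m\<^sub>j\<close> digits; this is an \<^emph>\<open>approximate cube\<close> of level \<open>n\<close>. Every set of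
  diameter \<open>\<le> A 2\<^sup>-\<^sup>n\<close> meets a bounded number of them, so Hausdorff measures and covering numbers
  may be computed with covers by approximate cubes, that is, symbolically on \<open>\<D>\<^sup>\<nat>\<close>. By compactness
  finite covers suffice, and all arguments below are finite counting arguments.

  Both (A) and (B) are equivalent to \<^emph>\<open>uniform fibres\<close>: for every set \<open>J\<close> of coordinates of the form
  \<open>{j. t \<le> theta j}\<close> all nonempty fibres of the projection of \<open>\<D>\<close> to the coordinates in \<open>J\<close> have the
  same cardinality.

  \<^bold>\<open>Uniform fibres imply (A) and (B).\<close> The number of cubes of level \<open>n\<close> is \<open>2\<^bsup>n \<gamma> + O(1)\<^esup>\<close>, where \<open>\<gamma>\<close> is
  the box dimension. With uniform fibres the uniform Bernoulli measure \<open>\<mu>\<close> gives all of them the same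
  mass, so the mass distribution principle yields \<open>0 < \<H>\<^sup>\<gamma>(K) < \<infinity>\<close>.

  \<^bold>\<open>Without uniform fibres (A) fails.\<close> For most cubes of level \<open>n\<close> the digits have, in each range of
  positions where the set of visible coordinates is constant, the frequencies of the uniform
  distribution on the \<^emph>\<open>projected\<close> digits; the exceptions number at most a multiple of \<open>2\<^bsup>n (\<gamma> - c)\<^esup>\<close>. No point lies
  in typical cubes of all large levels: typicality on the first range, where all coordinates are
  visible, prescribes the uniform distribution on \<open>\<D>\<close> for all long prefixes, hence also in the later
  ranges, and its projection is not uniform. So the exceptional cubes cover \<open>K\<close>
  (\<open>atypical_infinitely_often\<close>), and the Hausdorff dimension is smaller than \<open>\<gamma>\<close>.

  \<^bold>\<open>Without uniform fibres (B) fails.\<close> Suppose that \<open>0 < \<H>\<^sup>\<phi>(K) < \<infinity>\<close>. All cylinders of the same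
  length carry the same measure, so \<open>\<H>\<^sup>\<phi>\<close> behaves like a multiple of \<open>\<mu>\<close>. Hence, on the
  one hand, cubes \<open>Q\<close> of level \<open>n \<ge> M\<close> with \<open>\<mu>(Q) > M \<phi>(2\<^sup>-\<^sup>n)\<close> cover only a set of small
  \<open>\<mu>\<close>-measure (\<open>rare_large_mass\<close>). On the other hand, by the mass distribution principle half of the
  points lie in cubes of arbitrarily high level with \<open>\<mu>(Q) > c \<phi>(2\<^sup>-\<^sup>n)\<close>. A perturbation contradicts
  this: let the \<open>k\<close>-th digit have the density \<open>1 + \<epsilon>\<^sub>k u\<close> instead of \<open>1\<close>, with \<open>\<epsilon>\<^sub>k \<approx> k\<^bsup>\<beta> - 1\<^esup>\<close> and
  \<open>0 < \<beta> < 1/2\<close>. Since \<open>\<Sum> \<epsilon>\<^sub>k\<^sup>2 < \<infinity>\<close>, events of small \<open>\<mu>\<close>-measure stay unlikely. But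
  \<open>ln \<mu>(Q\<^sub>n)\<close> is a sum over ranges of positions of logarithms of fibre cardinalities, which the
  perturbation shifts by \<open>\<kappa> n\<^sup>\<beta> + O(1)\<close>. Nonuniformity allows a choice of \<open>\<beta>\<close> and \<open>u\<close> with \<open>\<kappa> > 0\<close>,
  because the powers \<open>t\<^sup>\<beta>\<close> of distinct \<open>t\<close> are linearly independent functions of \<open>\<beta>\<close> (\<open>ex_drift\<close>).
  Coupling the two sequences of digits turns masses above \<open>c \<phi>\<close> into masses above \<open>M \<phi>\<close>
  with probability bounded below.
\<close>

section \<open>Inequalities for powers and exponentials\<close>

lemma exp_le_quadratic:
  fixes y :: real
  assumes "\<bar>y\<bar> \<le> 1"
  shows "exp y \<le> 1 + y + y\<^sup>2"
proof (cases "0 \<le> y")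
  case True
  then show ?thesis using exp_bound[of y] assms by simp
next
  case False
  define x where "x = - y"
  have x: "0 \<le> x" using False by (simp add: x_def)
  have "1 \<le> (1 - x + x\<^sup>2) * (1 + x + x\<^sup>2 / 2)"
  proof -
    have "(1 - x + x\<^sup>2) * (1 + x + x\<^sup>2 / 2) = 1 + (x\<^sup>2 + x ^ 3 + x ^ 4) / 2"
      by (simp add: power2_eq_square power3_eq_cube power4_eq_xxxx field_simps)
    then show ?thesis using x by simp
  qed
  also have "\<dots> \<le> (1 - x + x\<^sup>2) * exp x"
  proof (rule mult_left_mono[OF exp_lower_Taylor_quadratic[OF x]])
    have "1 - x + x\<^sup>2 = (x - 1/2)\<^sup>2 + 3/4" by (simp add: power2_eq_square algebra_simps)
    then show "0 \<le> 1 - x + x\<^sup>2" by simp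
  qed
  finally have "exp (- x) \<le> 1 - x + x\<^sup>2" by (simp add: exp_minus field_simps)
  then show ?thesis by (simp add: x_def)
qed

text \<open>The functions \<open>\<beta> \<mapsto> t\<^sup>\<beta>\<close> are linearly independent on every interval: along an arithmetic
  progression of exponents the hypothesis says that the weights \<open>w\<close> at the distinct points
  \<open>y t = t\<^sup>b\<close> annihilate all monomials of degree \<open>1\<close> up to \<open>card T\<close>, and a polynomial in these
  monomials isolates \<open>t0\<close>.\<close>

lemma powr_sum_zero_imp_zero:
  fixes T :: "real set" and w :: "real \<Rightarrow> real"
  assumes fin: "finite T" and pos: "\<And>t. t \<in> T \<Longrightarrow> 0 < t"
    and zero: "\<And>\<beta>. 0 < \<beta> \<Longrightarrow> \<beta> < 1/2 \<Longrightarrow> (\<Sum>t\<in>T. t powr \<beta> * w t) = 0"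
    and t0: "t0 \<in> T"
  shows "w t0 = 0"
proof -
  (* All exponents i * b with i \<le> card T stay below 1/2. *)
  define b where "b = 1 / (2 * (real (card T) + 1))"
  have b: "0 < b" by (simp add: b_def)
  define y where "y t = t powr b" for t :: real
  have ypos: "0 < y t" if "t \<in> T" for t using pos[OF that] by (simp add: y_def)
  have yinj: "y s \<noteq> y t" if "s \<in> T" "t \<in> T" "s \<noteq> t" for s t
  proof -
    have "s < t \<or> t < s" using that(3) by linarith
    then have "y s < y t \<or> y t < y s"
      using powr_less_mono2[OF b, of s t] powr_less_mono2[OF b, of t s]
        less_imp_le[OF pos[OF that(1)]] less_imp_le[OF pos[OF that(2)]] unfolding y_def by blast
    then show ?thesis by auto
  qed
  have moment: "(\<Sum>t\<in>T. y t ^ i * w t) = 0" if "1 \<le> i" "i \<le> card T" for i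
  proof -
    have "0 < real i * b" using that b by simp
    moreover have "real i * b < 1/2" using that by (simp add: b_def field_simps)
    ultimately have "(\<Sum>t\<in>T. t powr (real i * b) * w t) = 0" by (rule zero)
    moreover have "t powr (real i * b) = y t ^ i" if "t \<in> T" for t
    proof -
      have "t powr (real i * b) = (t powr b) powr real i" by (simp add: powr_powr mult.commute)
      also have "\<dots> = y t ^ i" using pos[OF that] by (simp add: y_def powr_realpow)
      finally show ?thesis .
    qed
    ultimately show ?thesis by simp
  qed
  (* The factor [:0, 1:] removes the constant term, for which there is no moment. *)
  define p where "p = [:0, 1:] * (\<Prod>s\<in>T - {t0}. [:- y s, 1:])"
  have "degree (\<Prod>s\<in>T - {t0}. [:- y s, 1:]) \<le> card T - 1"
    using degree_prod_sum_le[of "T - {t0}" "\<lambda>s. [:- y s, 1:]"] fin t0 by simp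
  moreover have "0 < card T" using t0 fin card_gt_0_iff by blast
  moreover have "degree p \<le> 1 + degree (\<Prod>s\<in>T - {t0}. [:- y s, 1:])"
    using degree_mult_le[of "[:0, 1:]" "\<Prod>s\<in>T - {t0}. [:- y s, 1:]"] by (simp add: p_def)
  ultimately have deg: "degree p \<le> card T" by linarith
  have "(\<Sum>t\<in>T. poly p (y t) * w t) = (\<Sum>t\<in>T. \<Sum>i\<le>degree p. coeff p i * (y t ^ i * w t))"
    by (simp add: poly_altdef sum_distrib_right mult.assoc)
  also have "\<dots> = (\<Sum>i\<le>degree p. coeff p i * (\<Sum>t\<in>T. y t ^ i * w t))"
    by (subst sum.swap) (simp add: sum_distrib_left)
  also have "\<dots> = 0"
  proof (rule sum.neutral, rule ballI)
    fix i assume "i \<in> {..degree p}"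
    then have "i \<le> card T" using deg by simp
    moreover have "coeff p 0 = 0" by (simp add: p_def)
    ultimately show "coeff p i * (\<Sum>t\<in>T. y t ^ i * w t) = 0"
      using moment[of i] by (cases "i = 0") auto
  qed
  also have "(\<Sum>t\<in>T. poly p (y t) * w t) = poly p (y t0) * w t0"
  proof -
    have "poly p (y t) = 0" if "t \<in> T - {t0}" for t
      using fin that by (auto simp: p_def poly_prod prod_zero_iff)
    then have "(\<Sum>t\<in>T - {t0}. poly p (y t) * w t) = 0" by simp
    then show ?thesis using sum.remove[OF fin t0, of "\<lambda>t. poly p (y t) * w t"] by simp
  qed
  finally have "poly p (y t0) * w t0 = 0" .
  moreover have "poly p (y t0) \<noteq> 0"
    using ypos[OF t0] yinj[OF t0] fin by (auto simp: p_def poly_prod prod_zero_iff)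
  ultimately show ?thesis by simp
qed

lemma powr_Suc_le:
  assumes "0 < \<beta>" "\<beta> < (1::real)" "0 \<le> x"
  shows "(x + 1) powr \<beta> \<le> x powr \<beta> + 1" "0 < x \<Longrightarrow> (x + 1) powr \<beta> \<le> x powr \<beta> + x powr (\<beta> - 1)"
proof -
  have split: "(x + 1) powr \<beta> = x * (x + 1) powr (\<beta> - 1) + (x + 1) powr (\<beta> - 1)"
  proof -
    have "(x + 1) powr \<beta> = (x + 1) powr 1 * (x + 1) powr (\<beta> - 1)"
      unfolding powr_add[symmetric] by simp
    then show ?thesis using assms(3) by (simp add: algebra_simps)
  qed
  have xx: "x * x powr (\<beta> - 1) = x powr \<beta>" if "0 < x"
    using that powr_add[of x 1 "\<beta> - 1"] by simp
  have dec: "(x + 1) powr (\<beta> - 1) \<le> x powr (\<beta> - 1)" if "0 < x"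
    using that assms by (intro powr_mono2') auto
  have one: "(x + 1) powr (\<beta> - 1) \<le> 1"
    using powr_mono2'[of "\<beta> - 1" 1 "x + 1"] assms by simp
  show "(x + 1) powr \<beta> \<le> x powr \<beta> + 1"
  proof (cases "x = 0")
    case False
    then have "0 < x" using assms by simp
    then have "x * (x + 1) powr (\<beta> - 1) \<le> x powr \<beta>"
      using mult_left_mono[OF dec, of x] xx by simp
    then show ?thesis using split one by simp
  qed simp
  assume "0 < x"
  then have "x * (x + 1) powr (\<beta> - 1) \<le> x powr \<beta>"
    using mult_left_mono[OF dec, of x] xx by simp
  then show "(x + 1) powr \<beta> \<le> x powr \<beta> + x powr (\<beta> - 1)" using split dec[OF \<open>0 < x\<close>] by simp
qed

text \<open>The rate \<open>\<epsilon>\<^sub>k\<close> of the perturbation at position \<open>k\<close>. Increments of \<open>k\<^sup>\<beta>\<close> are used rather than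
  \<open>\<beta> k\<^bsup>\<beta> - 1\<^esup>\<close> so that the partial sums are exactly \<open>n\<^sup>\<beta>\<close>.\<close>

definition powr_incr :: "real \<Rightarrow> nat \<Rightarrow> real" where
  "powr_incr \<beta> k = (real k + 1) powr \<beta> - real k powr \<beta>"

lemma powr_incr_bounds:
  assumes "0 < \<beta>" "\<beta> < 1"
  shows "0 \<le> powr_incr \<beta> k" "powr_incr \<beta> k \<le> 1"
  using powr_Suc_le(1)[OF assms, of "real k"] powr_mono2[of \<beta> "real k" "real k + 1"] assms
  by (simp_all add: powr_incr_def)

lemma sum_powr_incr: "0 < \<beta> \<Longrightarrow> (\<Sum>k<n. powr_incr \<beta> k) = real n powr \<beta>"
  by (induction n) (simp_all add: powr_incr_def add.commute)

text \<open>This is where \<open>\<beta> < 1/2\<close> enters: the increments are at most \<open>k\<^bsup>\<beta> - 1\<^esup>\<close>, whose squares are summable.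
  It is the condition for the perturbed product measure to be absolutely continuous with a
  square-integrable density.\<close>

lemma sum_powr_incr_square_bounded:
  assumes "0 < \<beta>" "\<beta> < 1/2"
  obtains E where "\<And>n. (\<Sum>k<n. (powr_incr \<beta> k)\<^sup>2) \<le> E"
proof -
  have "summable (\<lambda>k. real k powr (2 * \<beta> - 2))" using assms by (simp add: summable_real_powr_iff)
  then have sm: "summable (\<lambda>k. (powr_incr \<beta> k)\<^sup>2)"
  proof (rule summable_comparison_test[rotated], intro exI[of _ 1] allI impI)
    fix k :: nat assume k: "1 \<le> k"
    have "powr_incr \<beta> k \<le> real k powr (\<beta> - 1)"
      using powr_Suc_le(2)[of \<beta> "real k"] assms k by (simp add: powr_incr_def)
    then have "(powr_incr \<beta> k)\<^sup>2 \<le> (real k powr (\<beta> - 1))\<^sup>2"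
      using powr_incr_bounds[of \<beta> k] assms by (intro power_mono) auto
    also have "\<dots> = real k powr (2 * \<beta> - 2)"
      using k by (simp add: power2_eq_square flip: powr_add)
    finally show "norm ((powr_incr \<beta> k)\<^sup>2) \<le> real k powr (2 * \<beta> - 2)" by simp
  qed
  have "(\<Sum>k<n. (powr_incr \<beta> k)\<^sup>2) \<le> (\<Sum>k. (powr_incr \<beta> k)\<^sup>2)" for n
    using sm by (intro sum_le_suminf) auto
  then show ?thesis using that by blast
qed

text \<open>One term of the exponential series gives \<open>exp (c n\<^sup>\<beta>) \<ge> const * n\<^sup>2\<close>.\<close>

lemma summable_exp_neg_powr:
  assumes "0 < c" "0 < \<beta>"
  shows "summable (\<lambda>n. exp (- (c * real n powr \<beta>)))"
proof -
  define p where "p = nat \<lceil>2 / \<beta>\<rceil>"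
  have "2 / \<beta> \<le> real p" unfolding p_def by linarith
  then have p: "2 \<le> \<beta> * real p" using assms by (simp add: field_simps)
  define A where "A = fact p / c ^ p"
  have "summable (\<lambda>n. A * real n powr - 2)"
    by (intro summable_mult) (simp add: summable_real_powr_iff)
  then show ?thesis
  proof (rule summable_comparison_test[rotated], intro exI[of _ 1] allI impI)
    fix n :: nat assume n: "1 \<le> n"
    let ?x = "c * real n powr \<beta>"
    have x: "0 < ?x" using assms n by simp
    have "?x ^ p /\<^sub>R fact p \<le> (\<Sum>i. ?x ^ i /\<^sub>R fact i)"
      using sum_le_suminf[of "\<lambda>i. ?x ^ i /\<^sub>R fact i" "{p}"] summable_exp_generic[of ?x] x by simp
    then have "?x ^ p / fact p \<le> exp ?x" by (simp add: exp_def divide_inverse mult.commute)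
    moreover have "real n powr 2 \<le> (real n powr \<beta>) ^ p"
    proof -
      have "real n powr 2 \<le> real n powr (\<beta> * real p)" using n p by (intro powr_mono) auto
      also have "\<dots> = (real n powr \<beta>) powr real p" by (simp add: powr_powr)
      also have "\<dots> = (real n powr \<beta>) ^ p" using n by (simp add: powr_realpow)
      finally show ?thesis .
    qed
    then have "c ^ p * real n powr 2 \<le> ?x ^ p"
      using assms by (simp add: power_mult_distrib)
    ultimately have "c ^ p * real n powr 2 / fact p \<le> exp ?x"
      by (meson divide_right_mono fact_ge_zero order_trans)
    then have "inverse (exp ?x) \<le> inverse (c ^ p * real n powr 2 / fact p)"
      using assms n by (intro le_imp_inverse_le) auto
    then show "norm (exp (- ?x)) \<le> A * real n powr - 2"
      by (simp add: exp_minus A_def powr_minus field_simps)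
  qed
qed

lemma sum_UN_le:
  fixes f :: "'a \<Rightarrow> real"
  assumes "finite I" "\<And>i. i \<in> I \<Longrightarrow> finite (B i)" "\<And>i x. i \<in> I \<Longrightarrow> x \<in> B i \<Longrightarrow> 0 \<le> f x"
  shows "sum f (\<Union>i\<in>I. B i) \<le> (\<Sum>i\<in>I. sum f (B i))"
  using assms
proof (induction I rule: finite_induct)
  case (insert i I)
  have "0 \<le> sum f (B i \<inter> (\<Union>i\<in>I. B i))" using insert.prems by (intro sum_nonneg) auto
  moreover have "finite (\<Union>i\<in>I. B i)" "finite (B i)" using insert by auto
  ultimately have "sum f (B i \<union> (\<Union>i\<in>I. B i)) \<le> sum f (B i) + sum f (\<Union>i\<in>I. B i)"
    using sum.union_inter[of "B i" "\<Union>i\<in>I. B i" f] by linarith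
  moreover have "sum f (\<Union>i\<in>I. B i) \<le> (\<Sum>i\<in>I. sum f (B i))"
    using insert.IH insert.prems by blast
  ultimately show ?case using insert.hyps by simp
qed simp

lemma sum_tail_le_suminf:
  fixes q :: "nat \<Rightarrow> real"
  assumes "summable q" "\<And>n. 0 \<le> q n" "finite S" "\<And>n. n \<in> S \<Longrightarrow> N \<le> n"
  shows "sum q S \<le> (\<Sum>i. q (i + N))"
proof -
  have inj: "inj_on (\<lambda>n. n - N) S" using assms(4) by (intro inj_onI) (metis le_add_diff_inverse)
  have "sum q S = (\<Sum>i\<in>(\<lambda>n. n - N) ` S. q (i + N))"
    using assms(4) by (simp add: sum.reindex[OF inj])
  also have "\<dots> \<le> (\<Sum>i. q (i + N))"
    using assms by (intro sum_le_suminf) auto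
  finally show ?thesis .
qed

section \<open>Approximate cubes\<close>

locale sponge_data =
  fixes m :: "'n::finite \<Rightarrow> nat" and D :: "('n \<Rightarrow> nat) set"
  assumes m_ge_2: "2 \<le> m j"
    and D_nonempty: "D \<noteq> {}"
    and D_subset: "D \<subseteq> digit_alphabet m"
begin

text \<open>A side of length \<open>2\<^sup>-\<^sup>n\<close> in coordinate \<open>j\<close> corresponds to about \<open>n * theta j\<close> digits to base \<open>m j\<close>.\<close>

definition theta :: "'n \<Rightarrow> real" where
  "theta j = ln 2 / ln (real (m j))"

definition depth :: "nat \<Rightarrow> 'n \<Rightarrow> nat" where
  "depth n j = nat \<lfloor>real n * theta j\<rfloor>"

text \<open>The coordinates in which the digit at position \<open>k\<close> is determined by a cube of level \<open>n\<close>. For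
  fixed \<open>n\<close> these sets decrease with \<open>k\<close> and have the form \<open>{j. t \<le> theta j}\<close>.\<close>

definition vis :: "nat \<Rightarrow> nat \<Rightarrow> 'n set" where
  "vis n k = {j. k < depth n j}"

definition dproj :: "'n set \<Rightarrow> ('n \<Rightarrow> nat) \<Rightarrow> 'n \<Rightarrow> nat" where
  "dproj J a = (\<lambda>j. if j \<in> J then a j else 0)"

text \<open>A canonical code of the approximate cube of level \<open>n\<close> around \<open>x\<close>, which is the set of all \<open>y\<close>
  with the same word. Invisible digits are overwritten by \<open>0\<close>, so that a word is itself a sequence
  in its cube (though not necessarily one with digits in \<open>D\<close>).\<close>

definition word :: "nat \<Rightarrow> (nat \<Rightarrow> 'n \<Rightarrow> nat) \<Rightarrow> nat \<Rightarrow> 'n \<Rightarrow> nat" where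
  "word n x = (\<lambda>k. dproj (vis n k) (x k))"

definition seqs :: "(nat \<Rightarrow> 'n \<Rightarrow> nat) set" where
  "seqs = {x. \<forall>k. x k \<in> D}"

lemma theta_pos: "0 < theta j" and theta_le_1: "theta j \<le> 1"
proof -
  have "2 \<le> real (m j)" using m_ge_2[of j] by simp
  then show "0 < theta j" "theta j \<le> 1"
    by (auto simp: theta_def divide_simps)
qed

lemma theta_ln: "theta j * ln (real (m j)) = ln 2"
proof -
  have "2 \<le> real (m j)" using m_ge_2[of j] by simp
  then show ?thesis by (simp add: theta_def)
qed

lemma less_depth_iff: "k < depth n j \<longleftrightarrow> real k + 1 \<le> real n * theta j"
proof -
  have "0 \<le> real n * theta j" using theta_pos[of j] by simp
  then show ?thesis unfolding depth_def by linarith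
qed

lemma depth_le: "depth n j \<le> n"
proof -
  have "real n * theta j \<le> real n"
    using theta_le_1[of j] mult_left_le[of "theta j" "real n"] by simp
  moreover have "0 \<le> real n * theta j" using theta_pos[of j] by simp
  ultimately show ?thesis unfolding depth_def by linarith
qed

lemma depth_real_bounds:
  "real (depth n j) \<le> real n * theta j" "real n * theta j < real (depth n j) + 1"
proof -
  have "0 \<le> real n * theta j" using theta_pos[of j] by simp
  then show "real (depth n j) \<le> real n * theta j" "real n * theta j < real (depth n j) + 1"
    unfolding depth_def by linarith+
qed

lemma power_depth_bounds:
  "real (m j) ^ depth n j \<le> 2 ^ n" "2 ^ n \<le> real (m j) ^ Suc (depth n j)"
proof -
  have m: "2 \<le> real (m j)" using m_ge_2[of j] by simp
  then have l: "0 < ln (real (m j))" by simp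
  have eq: "real n * theta j * ln (real (m j)) = real n * ln 2"
    using theta_ln[of j] by (simp add: mult.assoc)
  have "real (depth n j) * ln (real (m j)) \<le> real n * ln 2"
    using mult_right_mono[OF depth_real_bounds(1)[of n j], of "ln (real (m j))"] l
    unfolding eq by simp
  then have "ln (real (m j) ^ depth n j) \<le> ln (2 ^ n)"
    using m by (simp add: ln_realpow)
  then show "real (m j) ^ depth n j \<le> 2 ^ n"
    using m by (subst (asm) ln_le_cancel_iff) auto
  have "real n * ln 2 \<le> (real (depth n j) + 1) * ln (real (m j))"
    using mult_right_mono[OF less_imp_le[OF depth_real_bounds(2)[of n j]], of "ln (real (m j))"] l
    unfolding eq by simp
  then have "real n * ln 2 \<le> real (Suc (depth n j)) * ln (real (m j))"
    by (simp add: add.commute)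
  then have "ln (2 ^ n) \<le> ln (real (m j) ^ Suc (depth n j))"
    using m by (subst (1 2) ln_realpow) auto
  then show "2 ^ n \<le> real (m j) ^ Suc (depth n j)"
    using m by (subst (asm) ln_le_cancel_iff) auto
qed

lemma depth_mono: "n \<le> n' \<Longrightarrow> depth n j \<le> depth n' j"
  unfolding depth_def using theta_pos[of j]
  by (intro nat_mono floor_mono mult_right_mono) (simp_all add: less_imp_le)

lemma vis_empty: "n \<le> k \<Longrightarrow> vis n k = {}"
  using depth_le[of n] by (auto simp: vis_def not_less intro: le_trans)

lemma ex_vis_UNIV: "\<exists>N. \<forall>n\<ge>N. \<forall>k<K. vis n k = UNIV"
proof -
  have "\<exists>N. \<forall>n\<ge>N. K \<le> depth n j" for j
  proof -
    obtain N where N: "real K + 1 \<le> real N * theta j"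
      using reals_Archimedean3[OF theta_pos[of j]] by (meson less_imp_le)
    then have "K < depth N j" by (simp only: less_depth_iff)
    then have "K \<le> depth n j" if "n \<ge> N" for n
      using depth_mono[OF that, of j] by linarith
    then show ?thesis by blast
  qed
  then have "\<forall>j. \<exists>N. \<forall>n\<ge>N. K \<le> depth n j" by blast
  then obtain N where N: "\<forall>j. \<forall>n\<ge>N j. K \<le> depth n j"
    using choice[of "\<lambda>j N. \<forall>n\<ge>N. K \<le> depth n j"] by blast
  have "vis n k = UNIV" if "n \<ge> Max (range N)" "k < K" for n k
  proof -
    have "N j \<le> Max (range N)" for j by simp
    then have "K \<le> depth n j" for j using N that(1) le_trans by blast
    then show ?thesis using that(2) by (auto simp: vis_def intro: less_le_trans)
  qed
  then show ?thesis by blast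
qed

lemma dproj_UNIV [simp]: "dproj UNIV a = a"
  and dproj_empty [simp]: "dproj {} a = (\<lambda>_. 0)"
  and dproj_dproj: "dproj J (dproj J' a) = dproj (J \<inter> J') a"
  by (auto simp: dproj_def)

lemma dproj_eq_iff: "dproj J a = dproj J b \<longleftrightarrow> (\<forall>j\<in>J. a j = b j)"
  by (auto simp: dproj_def fun_eq_iff)

lemma word_eq_iff: "word n x = word n y \<longleftrightarrow> (\<forall>j. \<forall>k<depth n j. x k j = y k j)"
  by (simp add: word_def fun_eq_iff[where 'b = "'n \<Rightarrow> nat"] dproj_eq_iff vis_def) blast

lemma word_eq_mono: "word n' x = word n' y \<Longrightarrow> n \<le> n' \<Longrightarrow> word n x = word n y"
  unfolding word_eq_iff using depth_mono[of n n'] by (auto dest: less_le_trans)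

lemma word_word [simp]: "word n (word n x) = word n x"
  by (simp add: word_def dproj_dproj)

lemma finite_D: "finite D"
proof -
  have "digit_alphabet m = PiE UNIV (\<lambda>j. {..<m j})"
    by (auto simp: digit_alphabet_def PiE_def)
  then have "finite (digit_alphabet m)" by (simp add: finite_PiE)
  then show ?thesis using D_subset finite_subset by blast
qed

lemma card_D_pos: "0 < card D"
  using finite_D D_nonempty by (simp add: card_gt_0_iff)

lemma seqs_nonempty: "seqs \<noteq> {}"
  using D_nonempty by (auto simp: seqs_def)

lemma seqs_less: "x \<in> seqs \<Longrightarrow> x k j < m j"
  using D_subset by (auto simp: seqs_def digit_alphabet_def)

lemma finite_words: "finite (word n ` seqs)"
proof -
  let ?W = "PiE {..<n} (\<lambda>k. dproj (vis n k) ` D)"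
  have "word n ` seqs \<subseteq> (\<lambda>w k. if k < n then w k else (\<lambda>_. 0)) ` ?W"
  proof
    fix w assume "w \<in> word n ` seqs"
    then obtain x where x: "x \<in> seqs" "w = word n x" by blast
    show "w \<in> (\<lambda>w k. if k < n then w k else (\<lambda>_. 0)) ` ?W"
    proof (rule image_eqI)
      have "w k = (\<lambda>_. 0)" if "\<not> k < n" for k
        using vis_empty[of n k] that by (simp add: x word_def)
      then show "w = (\<lambda>k. if k < n then restrict w {..<n} k else (\<lambda>_. 0))"
        by (intro ext) simp
      show "restrict w {..<n} \<in> ?W"
        using x by (auto simp: word_def seqs_def)
    qed
  qed
  moreover have "finite ?W" using finite_D by (intro finite_PiE) auto
  ultimately show ?thesis by (meson finite_subset finite_imageI)
qed

section \<open>Approximate cubes and the metric of the torus\<close>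

lemma dist_to_torus_le: "dist (to_torus x) (to_torus y) \<le> dist x y"
  unfolding dist_torus_def by (rule setdist_le_dist) auto

lemma dist_to_torus_attained:
  obtains v where "to_torus v = to_torus y" "dist x v = dist (to_torus x) (to_torus (y :: real ^ 'n))"
proof -
  let ?B = "{v. to_torus v = to_torus y}"
  obtain v where "v \<in> ?B" "infdist x ?B = dist x v"
    using infdist_attains_inf[OF closed_fibre[of y], of x] by blast
  then show ?thesis using that[of v] by (simp add: dist_torus_def setdist_fibres)
qed

definition coord :: "'n \<Rightarrow> (nat \<Rightarrow> 'n \<Rightarrow> nat) \<Rightarrow> real" where
  "coord j x = (\<Sum>k. real (x k j) / real (m j) ^ Suc k)"

text \<open>The integer with base-\<open>b\<close> digits \<open>f 0, \<dots>, f (L - 1)\<close>, most significant first.\<close>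

primrec enc :: "nat \<Rightarrow> (nat \<Rightarrow> nat) \<Rightarrow> nat \<Rightarrow> nat" where
  "enc b f 0 = 0"
| "enc b f (Suc L) = enc b f L * b + f L"

lemma enc_less: "(\<And>k. f k < b) \<Longrightarrow> enc b f L < b ^ L"
proof (induction L)
  case (Suc L)
  have "enc b f L * b + f L < enc b f L * b + b" using Suc.prems by simp
  also have "\<dots> = (enc b f L + 1) * b" by simp
  also have "\<dots> \<le> b ^ L * b" using Suc by (intro mult_right_mono) (auto simp: Suc_le_eq)
  finally show ?case by (simp add: mult.commute)
qed simp

lemma enc_inject:
  "(\<And>k. f k < b) \<Longrightarrow> (\<And>k. g k < b) \<Longrightarrow> enc b f L = enc b g L \<Longrightarrow> k < L \<Longrightarrow> f k = g k"
proof (induction L)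
  case (Suc L)
  have eq: "enc b f L * b + f L = enc b g L * b + g L" using Suc.prems by simp
  have "f L = (enc b f L * b + f L) mod b" using Suc.prems(1)[of L] by simp
  also have "\<dots> = g L" unfolding eq using Suc.prems(2)[of L] by simp
  finally have 1: "f L = g L" .
  then have "enc b f L = enc b g L" using eq Suc.prems(1)[of L] by simp
  then have "f k = g k" if "k < L" using Suc.IH Suc.prems(1,2) that by blast
  then show ?case using 1 Suc.prems(4) by (cases "k = L") auto
qed simp

lemma summable_digits:
  assumes "2 \<le> b" "\<And>k. f k < b"
  shows "summable (\<lambda>k. real (f k) / real b ^ Suc k)"
proof (rule summable_comparison_test)
  show "summable (\<lambda>k. (1 / real b) ^ k)" using assms(1) by (intro summable_geometric) auto
  show "\<exists>N. \<forall>k\<ge>N. norm (real (f k) / real b ^ Suc k) \<le> (1 / real b) ^ k"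
    using assms(2) assms(1) by (auto simp: power_divide divide_simps less_imp_le intro!: exI[of _ 0])
qed

lemma suminf_digits_bounds:
  assumes "2 \<le> b" "\<And>k. f k < b"
  shows "0 \<le> (\<Sum>k. real (f k) / real b ^ Suc k)" "(\<Sum>k. real (f k) / real b ^ Suc k) \<le> 1"
proof -
  show "0 \<le> (\<Sum>k. real (f k) / real b ^ Suc k)"
    using summable_digits[of b f, OF assms] by (intro suminf_nonneg) auto
  have "(\<lambda>k. (1 / real b) ^ k) sums (1 / (1 - 1 / real b))"
    using assms(1) by (intro geometric_sums) auto
  from sums_mult[OF this, of "(real b - 1) / real b"]
  have s: "(\<lambda>k. (real b - 1) / real b ^ Suc k) sums 1"
    using assms(1) by (simp add: power_divide divide_simps)
  have "(\<Sum>k. real (f k) / real b ^ Suc k) \<le> (\<Sum>k. (real b - 1) / real b ^ Suc k)"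
  proof (rule suminf_le)
    fix k
    have "real (f k) \<le> real b - 1" using assms(2)[of k] by linarith
    then show "real (f k) / real b ^ Suc k \<le> (real b - 1) / real b ^ Suc k"
      by (intro divide_right_mono) auto
  qed (use s summable_digits[of b f, OF assms] in \<open>auto simp: sums_iff\<close>)
  then show "(\<Sum>k. real (f k) / real b ^ Suc k) \<le> 1" using s by (simp add: sums_iff)
qed

text \<open>Multiplication by \<open>b\<^sup>L\<close> shifts the expansion, so its integer part is the code of the first \<open>L\<close>
  digits; the remaining expansion lies in \<open>[0, 1]\<close>.\<close>

lemma suminf_digits_enc:
  assumes "2 \<le> b" "\<And>k. f k < b"
  shows "real b ^ L * (\<Sum>k. real (f k) / real b ^ Suc k)
    = real (enc b f L) + (\<Sum>k. real (f (k + L)) / real b ^ Suc k)"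
proof (induction L)
  case (Suc L)
  let ?g = "\<lambda>k. real (f (k + L)) / real b ^ Suc k"
  have b: "real b \<noteq> 0" using assms(1) by simp
  have sm: "summable ?g" using summable_digits[of b "\<lambda>k. f (k + L)"] assms by simp
  have sm': "summable (\<lambda>k. real (f (k + Suc L)) / real b ^ Suc k)"
    using summable_digits[of b "\<lambda>k. f (k + Suc L)"] assms by simp
  have "real b * suminf ?g = real b * (?g 0 + (\<Sum>k. ?g (Suc k)))"
    using suminf_split_head[OF sm] by simp
  moreover have "(\<Sum>k. ?g (Suc k)) = (\<Sum>k. real (f (k + Suc L)) / real b ^ Suc k / real b)"
    by (simp add: mult.commute)
  then have "(\<Sum>k. ?g (Suc k)) = (\<Sum>k. real (f (k + Suc L)) / real b ^ Suc k) / real b"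
    by (simp only: suminf_divide[OF sm'])
  ultimately have *: "real b * suminf ?g
      = real (f L) + (\<Sum>k. real (f (k + Suc L)) / real b ^ Suc k)"
  proof -
    have "real b * (p / real b + q / real b) = p + q" for p q :: real
      using b by (simp add: distrib_left)
    then show ?thesis
      using \<open>real b * suminf ?g = real b * (?g 0 + (\<Sum>k. ?g (Suc k)))\<close>
      unfolding \<open>(\<Sum>k. ?g (Suc k)) = (\<Sum>k. real (f (k + Suc L)) / real b ^ Suc k) / real b\<close> by simp
  qed
  have "real b ^ Suc L * (\<Sum>k. real (f k) / real b ^ Suc k)
      = real b * (real b ^ L * (\<Sum>k. real (f k) / real b ^ Suc k))" by simp
  also have "\<dots> = real b * real (enc b f L) + real b * suminf ?g"
    unfolding Suc.IH by (simp add: algebra_simps)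
  finally show ?case unfolding * by simp
qed simp

lemma coord_bounds:
  assumes "x \<in> seqs"
  shows "real (enc (m j) (\<lambda>k. x k j) L) \<le> real (m j) ^ L * coord j x"
    "real (m j) ^ L * coord j x \<le> real (enc (m j) (\<lambda>k. x k j) L) + 1"
  using suminf_digits_enc[of "m j" "\<lambda>k. x k j" L] suminf_digits_bounds[of "m j" "\<lambda>k. x (k + L) j"]
    seqs_less[OF assms] m_ge_2[of j] by (simp_all add: coord_def)

lemma coding_map_coord:
  assumes "x \<in> seqs"
  shows "coding_map m x = to_torus (\<chi> j. coord j x)"
proof -
  have "(\<lambda>k. real (x k j) / real (m j) ^ Suc k) sums coord j x" for j
    unfolding coord_def using summable_digits[of "m j" "\<lambda>k. x k j"] m_ge_2 seqs_less[OF assms]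
    by (simp add: summable_sums)
  then have "(\<lambda>k. \<chi> j. real (x k j) / real (m j) ^ Suc k) sums (\<chi> j. coord j x)"
    unfolding sums_def by (intro vec_tendstoI) (simp add: )
  then show ?thesis by (simp add: coding_map_def sums_iff)
qed

text \<open>A cube of level \<open>n\<close> has an image of diameter at most \<open>cube_size / 2 ^ n\<close>.\<close>

definition cube_size :: real where
  "cube_size = (\<Sum>j\<in>UNIV. real (m j))"

lemma cube_size_pos: "0 < cube_size"
  unfolding cube_size_def using m_ge_2 by (intro sum_pos) (auto simp: less_le_trans[of 0 2])

lemma dist_coding_map_le:
  assumes "x \<in> seqs" "y \<in> seqs" "word n x = word n y"
  shows "dist (coding_map m x) (coding_map m y) \<le> cube_size / 2 ^ n"
proof -
  have *: "\<bar>coord j x - coord j y\<bar> \<le> real (m j) / 2 ^ n" for j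
  proof -
    let ?L = "depth n j" and ?M = "real (m j) ^ depth n j"
    have e: "enc (m j) (\<lambda>k. x k j) L = enc (m j) (\<lambda>k. y k j) L" if "L \<le> ?L" for L
      using that assms(3) by (induction L) (auto simp: word_eq_iff)
    have M: "0 < ?M" using m_ge_2[of j] by simp
    have "?M * \<bar>coord j x - coord j y\<bar> = \<bar>?M * coord j x - ?M * coord j y\<bar>"
      using M by (metis abs_mult abs_of_pos right_diff_distrib)
    also have "\<dots> \<le> 1"
      using coord_bounds[OF assms(1), of j ?L] coord_bounds[OF assms(2), of j ?L] e[of ?L] by simp
    finally have "?M * \<bar>coord j x - coord j y\<bar> \<le> 1" .
    then have "real (m j) * ?M * \<bar>coord j x - coord j y\<bar> \<le> real (m j)"
      using mult_left_mono[of "?M * \<bar>coord j x - coord j y\<bar>" 1 "real (m j)"] by (simp add: mult.assoc)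
    moreover have "2 ^ n * \<bar>coord j x - coord j y\<bar> \<le> real (m j) * ?M * \<bar>coord j x - coord j y\<bar>"
      using power_depth_bounds(2)[of n j] by (intro mult_right_mono) auto
    ultimately show ?thesis by (simp add: field_simps)
  qed
  have "dist (coding_map m x) (coding_map m y) \<le> dist (\<chi> j. coord j x) (\<chi> j. coord j y)"
    using assms by (simp add: coding_map_coord dist_to_torus_le)
  also have "\<dots> \<le> (\<Sum>j\<in>UNIV. \<bar>((\<chi> j. coord j x) - (\<chi> j. coord j y)) $ j\<bar>)"
    unfolding dist_norm by (rule norm_le_l1_cart)
  also have "\<dots> \<le> (\<Sum>j\<in>UNIV. real (m j) / 2 ^ n)"
    using * by (intro sum_mono) simp
  finally show ?thesis by (simp add: cube_size_def sum_divide_distrib)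
qed

definition overlap_bound :: "real \<Rightarrow> nat" where
  "overlap_bound A = card {- \<lfloor>A + 1\<rfloor> .. \<lfloor>A + 1\<rfloor>} ^ CARD('n)"

text \<open>In coordinate \<open>j\<close> the first \<open>depth n j\<close> digits are an integer modulo \<open>m j ^ depth n j \<le> 2 ^ n\<close>.
  For two points of \<open>E\<close> these integers differ, modulo that number, by an integer of absolute value
  at most \<open>A + 1\<close>: the distance scales to at most \<open>A\<close>, and truncation contributes at most \<open>1\<close>. So a
  fixed point of \<open>E\<close> and a bounded vector of differences determine the cube.\<close>

lemma card_words_meeting_le:
  assumes E: "bounded E" "diameter E \<le> A / 2 ^ n"
  shows "card (word n ` {x \<in> seqs. coding_map m x \<in> E}) \<le> overlap_bound A"
proof (cases "{x \<in> seqs. coding_map m x \<in> E} = {}")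
  case True
  show ?thesis unfolding True by simp
next
  case False
  then obtain y where y: "y \<in> seqs" "coding_map m y \<in> E" by blast
  define B where "B = {- \<lfloor>A + 1\<rfloor> .. \<lfloor>A + 1\<rfloor>}"
  define I where "I x j = int (enc (m j) (\<lambda>k. x k j) (depth n j))" for x j
  have I_range: "0 \<le> I x j \<and> I x j < int (m j ^ depth n j)" if "x \<in> seqs" for x j
    using enc_less[of "\<lambda>k. x k j" "m j" "depth n j"] seqs_less[OF that]
    unfolding I_def of_nat_less_iff by simp
  have "\<exists>e. \<forall>j. e j \<in> B \<and> I x j = (I y j + e j) mod int (m j ^ depth n j)"
    if x: "x \<in> seqs" "coding_map m x \<in> E" for x
  proof (rule choice, rule allI)
    fix j
    let ?M = "real (m j) ^ depth n j"
    obtain v where v: "to_torus v = to_torus (\<chi> j. coord j y)"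
      "dist (\<chi> j. coord j x) v = dist (to_torus (\<chi> j. coord j x)) (to_torus (\<chi> j. coord j y))"
      using dist_to_torus_attained by blast
    have "dist (\<chi> j. coord j x) v \<le> A / 2 ^ n"
      using diameter_bounded_bound[OF E(1) x(2) y(2)] E(2) x(1) y(1) v(2)
      by (simp add: coding_map_coord)
    then have d: "\<bar>coord j x - v $ j\<bar> \<le> A / 2 ^ n"
      using component_le_norm_cart[of "(\<chi> j. coord j x) - v" j] by (simp add: dist_norm)
    obtain z where z: "v $ j = coord j y + of_int z"
    proof -
      have "v $ j - coord j y \<in> \<int>"
        using v(1) by (simp add: to_torus_eq_iff lattice_equiv_def)
      then obtain z where "v $ j - coord j y = of_int z" by (auto elim: Ints_cases)
      then show ?thesis using that[of z] by simp
    qed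
    have M: "0 \<le> ?M" "?M \<le> 2 ^ n" using power_depth_bounds(1) by auto
    have A: "0 \<le> A / 2 ^ n" using d by linarith
    have "?M * \<bar>coord j x - v $ j\<bar> \<le> 2 ^ n * (A / 2 ^ n)"
      using M d A by (intro mult_mono) auto
    then have "\<bar>?M * coord j x - ?M * coord j y - ?M * of_int z\<bar> \<le> A"
    proof -
      have "?M * coord j x - ?M * coord j y - ?M * of_int z = ?M * (coord j x - v $ j)"
        using z by (simp add: algebra_simps)
      then show ?thesis using \<open>?M * \<bar>coord j x - v $ j\<bar> \<le> 2 ^ n * (A / 2 ^ n)\<close> M(1)
        by (simp only: abs_mult abs_of_nonneg) simp
    qed
    moreover have "real_of_int (I x j) \<le> ?M * coord j x" "?M * coord j x \<le> real_of_int (I x j) + 1"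
      "real_of_int (I y j) \<le> ?M * coord j y" "?M * coord j y \<le> real_of_int (I y j) + 1"
      using coord_bounds[OF x(1)] coord_bounds[OF y(1)] by (simp_all add: I_def)
    moreover define e where "e = I x j - I y j - int (m j ^ depth n j) * z"
    moreover have "real_of_int e = real_of_int (I x j) - real_of_int (I y j) - ?M * of_int z"
      by (simp add: e_def)
    ultimately have "\<bar>real_of_int e\<bar> \<le> A + 1" by linarith
    then have "e \<in> B" unfolding B_def by (simp add: le_floor_iff) linarith
    moreover have "I x j = (I y j + e) mod int (m j ^ depth n j)"
    proof -
      have "(I y j + e) mod int (m j ^ depth n j) = I x j mod int (m j ^ depth n j)"
        unfolding mod_eq_dvd_iff by (simp add: e_def)
      then show ?thesis using I_range[OF x(1), of j] by simp
    qed
    ultimately show "\<exists>e. e \<in> B \<and> I x j = (I y j + e) mod int (m j ^ depth n j)" by blast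
  qed
  then obtain e where e: "\<And>x j. x \<in> seqs \<Longrightarrow> coding_map m x \<in> E \<Longrightarrow>
      e x j \<in> B \<and> I x j = (I y j + e x j) mod int (m j ^ depth n j)"
    by metis
  let ?X = "{x \<in> seqs. coding_map m x \<in> E}"
  have same: "word n x = word n x'" if "x \<in> ?X" "x' \<in> ?X" "e x = e x'" for x x'
    unfolding word_eq_iff
  proof (intro allI impI)
    fix j k assume k: "k < depth n j"
    have "I x j = I x' j" using e[of x j] e[of x' j] that by simp
    then show "x k j = x' k j"
      using enc_inject[of "\<lambda>k. x k j" "m j" "\<lambda>k. x' k j" "depth n j" k] seqs_less that k
      by (auto simp: I_def)
  qed
  define r where "r w = (SOME x. x \<in> ?X \<and> word n x = w)" for w
  have r: "r w \<in> ?X \<and> word n (r w) = w" if "w \<in> word n ` ?X" for w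
    unfolding r_def using that by (intro someI_ex[of "\<lambda>x. x \<in> ?X \<and> word n x = w"]) auto
  have "card (word n ` ?X) \<le> card (PiE (UNIV::'n set) (\<lambda>_. B))"
  proof (rule card_inj_on_le)
    show "inj_on (\<lambda>w. e (r w)) (word n ` ?X)"
    proof (rule inj_onI)
      fix w w' assume w: "w \<in> word n ` ?X" "w' \<in> word n ` ?X" "e (r w) = e (r w')"
      have "word n (r w) = word n (r w')"
        using same[of "r w" "r w'"] r[OF w(1)] r[OF w(2)] w(3) by blast
      then show "w = w'" using r[OF w(1)] r[OF w(2)] by simp
    qed
    show "(\<lambda>w. e (r w)) ` (word n ` ?X) \<subseteq> PiE UNIV (\<lambda>_. B)"
    proof (rule image_subsetI)
      fix w assume "w \<in> word n ` ?X"
      then have "r w \<in> seqs" "coding_map m (r w) \<in> E" using r by blast+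
      then show "e (r w) \<in> PiE UNIV (\<lambda>_. B)" using e by (simp add: PiE_def)
    qed
    show "finite (PiE (UNIV::'n set) (\<lambda>_. B))" by (intro finite_PiE) (auto simp: B_def)
  qed
  then show ?thesis by (simp add: card_PiE overlap_bound_def B_def)
qed

section \<open>Covers by approximate cubes\<close>

text \<open>A pair \<open>(n, w)\<close> stands for the cube of level \<open>n\<close> with word \<open>w\<close>. When \<open>g n\<close> is the gauge of
  \<open>cube_size / 2 ^ n\<close>, the infimum of all \<open>s\<close> with \<open>coverable g N seqs s\<close> is comparable to the
  Hausdorff measure of the sponge in the limit \<open>N \<rightarrow> \<infinity>\<close>.\<close>

definition coverable :: "(nat \<Rightarrow> real) \<Rightarrow> nat \<Rightarrow> (nat \<Rightarrow> 'n \<Rightarrow> nat) set \<Rightarrow> real \<Rightarrow> bool" where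
  "coverable g N F s \<longleftrightarrow> (\<exists>C. finite C \<and> (\<forall>p\<in>C. N \<le> fst p) \<and>
     (\<forall>x\<in>F. \<exists>n. (n, word n x) \<in> C) \<and> (\<Sum>p\<in>C. g (fst p)) \<le> s)"

text \<open>By Tychonoff's theorem \<open>seqs\<close> is compact, and approximate cubes are open.\<close>

lemma finite_subcover:
  assumes cov: "\<And>x. x \<in> seqs \<Longrightarrow> \<exists>n. (n, word n x) \<in> C"
  obtains C' where "finite C'" "C' \<subseteq> C" "\<And>x. x \<in> seqs \<Longrightarrow> \<exists>n. (n, word n x) \<in> C'"
proof -
  define X where "X = product_topology (\<lambda>_::nat. discrete_topology D) UNIV"
  have top: "topspace X = seqs"
    by (auto simp: X_def seqs_def PiE_def)
  have comp: "compact_space X"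
    by (simp add: X_def compact_space_product_topology compact_space_discrete_topology finite_D)
  define U where "U p = {x \<in> seqs. word (fst p) x = snd p}" for p
  have U_open: "openin X (U (n, w))" for n w
  proof (cases "U (n, w) = {}")
    case False
    then obtain z where z: "word n z = w" by (auto simp: U_def)
    let ?S = "\<lambda>k. {b \<in> D. dproj (vis n k) b = w k}"
    have eq: "U (n, w) = PiE UNIV ?S"
      by (auto simp: U_def seqs_def PiE_def word_def fun_eq_iff[of "\<lambda>k. dproj (vis n k) _"])
    have "?S k = D" if "n \<le> k" for k
      using that vis_empty[of n k] by (auto simp: z[symmetric] word_def)
    then have "{k. ?S k \<noteq> D} \<subseteq> {..<n}" by (auto simp: not_less[symmetric])
    then have "finite {k. ?S k \<noteq> D}" by (rule finite_subset) simp
    then show ?thesis unfolding X_def eq by (subst openin_PiE_gen) auto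
  qed simp
  have "\<forall>V\<in>U ` C. openin X V" using U_open by auto
  moreover have "\<Union> (U ` C) = topspace X"
    unfolding top using cov by (fastforce simp: U_def)
  ultimately obtain G where G: "finite G" "G \<subseteq> U ` C" "\<Union> G = topspace X"
    using comp unfolding compact_space by meson
  then obtain C' where C': "C' \<subseteq> C" "finite C'" "G = U ` C'"
    by (meson finite_subset_image)
  have "\<exists>n. (n, word n x) \<in> C'" if "x \<in> seqs" for x
  proof -
    have "x \<in> \<Union> (U ` C')" using that G(3) C'(3) top by blast
    then obtain p where "p \<in> C'" "word (fst p) x = snd p" by (auto simp: U_def)
    then show ?thesis by (metis prod.collapse)
  qed
  then show ?thesis using that C' by blast
qed

definition cube_gauge :: "(real \<Rightarrow> real) \<Rightarrow> nat \<Rightarrow> real" where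
  "cube_gauge \<phi> n = \<phi> (cube_size / 2 ^ n)"

lemma cube_size_tendsto_0: "(\<lambda>n. cube_size / 2 ^ n) \<longlonglongrightarrow> 0"
  using tendsto_mult[OF tendsto_const LIMSEQ_power_zero[of "1/2 :: real"], of cube_size]
  by (simp add: power_divide)

lemma cube_size_small:
  assumes "0 < \<delta>"
  obtains n where "N \<le> n" "cube_size / 2 ^ n \<le> \<delta>"
proof -
  have "\<forall>\<^sub>F n in sequentially. cube_size / 2 ^ n < \<delta>"
    using order_tendstoD(2)[OF cube_size_tendsto_0 assms] .
  then obtain n0 where "\<And>n. n \<ge> n0 \<Longrightarrow> cube_size / 2 ^ n < \<delta>"
    by (auto simp: eventually_sequentially)
  then show ?thesis using that[of "max N n0"] by (simp add: less_imp_le)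
qed

lemma image_cube_bounds:
  shows "bounded (coding_map m ` {x \<in> seqs. word n x = w})"
    and "diameter (coding_map m ` {x \<in> seqs. word n x = w}) \<le> cube_size / 2 ^ n"
proof -
  let ?S = "coding_map m ` {x \<in> seqs. word n x = w}"
  have *: "dist p q \<le> cube_size / 2 ^ n" if "p \<in> ?S" "q \<in> ?S" for p q
    using that by (auto intro: dist_coding_map_le)
  then show "bounded ?S" unfolding bounded_two_points by blast
  show "diameter ?S \<le> cube_size / 2 ^ n"
  proof (cases "?S = {}")
    case False
    then show ?thesis unfolding diameter_def using *
      by (auto intro!: cSUP_least)
  next
    case True
    show ?thesis unfolding True using cube_size_pos by simp
  qed
qed

lemma sponge_eq: "sponge m D = coding_map m ` seqs"
  by (simp add: sponge_def seqs_def)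

text \<open>A cover by cubes projects to a cover of the sponge, by sets of diameter at most
  \<open>cube_size / 2 ^ n\<close>.\<close>

lemma hausdorff_measure_le_of_coverable:
  assumes mono: "mono_on {0..} \<phi>" and nonneg: "0 \<le> \<phi> 0"
    and cov: "\<And>N. coverable (cube_gauge \<phi>) N seqs s"
  shows "hausdorff_measure \<phi> (sponge m D) \<le> ennreal s"
  unfolding hausdorff_measure_eq_SUP
proof (rule SUP_least)
  fix \<delta> :: real assume "\<delta> \<in> {0<..}"
  then obtain N where N: "cube_size / 2 ^ N \<le> \<delta>" using cube_size_small[of \<delta> 0] by auto
  obtain C where C: "finite C" "\<forall>p\<in>C. N \<le> fst p" "\<forall>x\<in>seqs. \<exists>n. (n, word n x) \<in> C"
      "(\<Sum>p\<in>C. cube_gauge \<phi> (fst p)) \<le> s"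
    using cov[of N] unfolding coverable_def by blast
  obtain e where e: "bij_betw e {0..<card C} C" using ex_bij_betw_nat_finite[OF C(1)] by blast
  define Q where "Q p = coding_map m ` {x \<in> seqs. word (fst p) x = snd p}" for p
  define E where "E i = (if i < card C then Q (e i) else {})" for i
  have phi: "0 \<le> \<phi> t" if "0 \<le> t" for t
    using mono_onD[OF mono, of 0 t] that nonneg by simp
  have small: "cube_size / 2 ^ n \<le> \<delta>" if "N \<le> n" for n
    using N divide_left_mono[of "2 ^ N" "2 ^ n" cube_size] cube_size_pos that
    by (auto simp: power_increasing intro: order_trans)
  have Ei: "bounded (E i) \<and> diameter (E i) \<le> \<delta>" for i
  proof (cases "i < card C")
    case True
    then have "e i \<in> C" using e by (auto simp: bij_betw_def)
    then have "cube_size / 2 ^ fst (e i) \<le> \<delta>" using C(2) small by blast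
    then show ?thesis
      using image_cube_bounds[of "fst (e i)" "snd (e i)"] True by (simp add: E_def Q_def)
  qed (use \<open>\<delta> \<in> {0<..}\<close> in \<open>simp add: E_def\<close>)
  have "sponge m D \<subseteq> (\<Union>i. E i)"
  proof
    fix y assume "y \<in> sponge m D"
    then obtain x n where x: "x \<in> seqs" "y = coding_map m x" "(n, word n x) \<in> C"
      using C(3) by (auto simp: sponge_eq)
    then obtain i where "i < card C" "e i = (n, word n x)"
      using e by (force simp: bij_betw_def)
    then have "y \<in> E i" using x by (auto simp: E_def Q_def)
    then show "y \<in> (\<Union>i. E i)" by blast
  qed
  then have "E \<in> delta_covers \<delta> (sponge m D)" using Ei by (simp add: delta_covers_def)
  then have "hausdorff_premeasure \<phi> \<delta> (sponge m D) \<le> (\<Sum>i. gauge_size \<phi> (E i))"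
    unfolding hausdorff_premeasure_def by (rule INF_lower)
  also have "\<dots> = (\<Sum>i<card C. gauge_size \<phi> (E i))"
    by (rule suminf_finite) (auto simp: E_def gauge_size_def)
  also have "\<dots> \<le> (\<Sum>i<card C. ennreal (cube_gauge \<phi> (fst (e i))))"
  proof (rule sum_mono)
    fix i assume "i \<in> {..<card C}"
    then have "E i = Q (e i)" by (simp add: E_def)
    moreover have "\<phi> (diameter (Q (e i))) \<le> cube_gauge \<phi> (fst (e i))"
      unfolding cube_gauge_def Q_def
      using image_cube_bounds[of "fst (e i)" "snd (e i)"] cube_size_pos
      by (intro mono_onD[OF mono]) (auto simp: diameter_ge_0)
    ultimately show "gauge_size \<phi> (E i) \<le> ennreal (cube_gauge \<phi> (fst (e i)))"
      by (simp add: gauge_size_def ennreal_leI)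
  qed
  also have "\<dots> = ennreal (\<Sum>i<card C. cube_gauge \<phi> (fst (e i)))"
    using phi cube_size_pos by (intro sum_ennreal) (simp add: cube_gauge_def)
  also have "(\<Sum>i<card C. cube_gauge \<phi> (fst (e i))) = (\<Sum>p\<in>C. cube_gauge \<phi> (fst p))"
    using sum.reindex_bij_betw[OF e, of "\<lambda>p. cube_gauge \<phi> (fst p)"] by (simp add: lessThan_atLeast0)
  also have "ennreal \<dots> \<le> ennreal s" using C(4) by (rule ennreal_leI)
  finally show "hausdorff_premeasure \<phi> \<delta> (sponge m D) \<le> ennreal s" .
qed

lemma ex_dyadic_level:
  assumes "0 < t" "t \<le> cube_size / 2 ^ N"
  obtains n where "N \<le> n" "cube_size / 2 ^ n \<le> t" "t \<le> 2 * cube_size / 2 ^ n"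
proof -
  let ?P = "\<lambda>n. N \<le> n \<and> cube_size / 2 ^ n \<le> t"
  define n where "n = (LEAST n. ?P n)"
  have "\<exists>n. ?P n" using cube_size_small[of t N] assms(1) by metis
  then have "?P n" unfolding n_def by (rule LeastI_ex)
  then have n: "N \<le> n" "cube_size / 2 ^ n \<le> t" by auto
  have "t \<le> 2 * cube_size / 2 ^ n"
  proof (cases "n = N")
    case True
    have "cube_size / 2 ^ N \<le> 2 * cube_size / 2 ^ N"
      using cube_size_pos by (intro divide_right_mono) auto
    then show ?thesis using assms(2) True by simp
  next
    case False
    then obtain k where k: "n = Suc k" "N \<le> k" using n(1) by (cases n) auto
    then have "\<not> ?P k" using not_less_Least[of k ?P] by (simp add: n_def)
    then show ?thesis using k by simp
  qed
  then show ?thesis using that n by blast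
qed

text \<open>The level of the cubes that replace a set of diameter \<open>t\<close> is chosen such that the cubes cost no
  more than the set, up to \<open>\<eta>\<close>. The tolerance serves the case \<open>t = 0\<close>: a point is replaced by
  cubes of positive size, which by continuity cost hardly more than the point.\<close>

lemma ex_level_for_diameter:
  assumes mono: "mono_on {0..} \<phi>" and cont: "continuous_on {0..} \<phi>"
    and t: "0 \<le> t" "t \<le> cube_size / 2 ^ N" and "0 < \<eta>"
  obtains n where "N \<le> n" "t \<le> 2 * cube_size / 2 ^ n" "cube_gauge \<phi> n \<le> \<phi> t + \<eta>"
proof (cases "t = 0")
  case True
  have "(\<lambda>n. \<phi> (cube_size / 2 ^ n)) \<longlonglongrightarrow> \<phi> 0"
    using cube_size_pos
    by (intro continuous_on_tendsto_compose[OF cont cube_size_tendsto_0]) auto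
  then have "\<forall>\<^sub>F n in sequentially. \<phi> (cube_size / 2 ^ n) < \<phi> 0 + \<eta>"
    using \<open>0 < \<eta>\<close> by (intro order_tendstoD(2)) auto
  then obtain n0 where "\<And>n. n \<ge> n0 \<Longrightarrow> \<phi> (cube_size / 2 ^ n) < \<phi> 0 + \<eta>"
    by (auto simp: eventually_sequentially)
  then have "\<phi> (cube_size / 2 ^ max N n0) < \<phi> 0 + \<eta>" by simp
  then show ?thesis using that[of "max N n0"] True cube_size_pos by (simp add: cube_gauge_def)
next
  case False
  then have "0 < t" using t(1) by simp
  then obtain n where n: "N \<le> n" "cube_size / 2 ^ n \<le> t" "t \<le> 2 * cube_size / 2 ^ n"
    using ex_dyadic_level t(2) by blast
  have "cube_gauge \<phi> n \<le> \<phi> t"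
    unfolding cube_gauge_def using n t cube_size_pos by (intro mono_onD[OF mono]) auto
  then show ?thesis using that n \<open>0 < \<eta>\<close> by fastforce
qed

text \<open>Each set of the cover is replaced by the boundedly many cubes of comparable size that it meets,
  and compactness makes the resulting cover finite. The cubes are chosen no larger than the set, so
  that monotonicity of \<open>\<phi>\<close> bounds their cost for an arbitrary gauge.\<close>

lemma coverable_of_hausdorff_premeasure:
  assumes mono: "mono_on {0..} \<phi>" and cont: "continuous_on {0..} \<phi>" and nonneg: "0 \<le> \<phi> 0"
    and H: "hausdorff_premeasure \<phi> (cube_size / 2 ^ N) (sponge m D) < ennreal s" and "0 < \<eta>"
  shows "coverable (cube_gauge \<phi>) N seqs (real (overlap_bound (2 * cube_size)) * (s + \<eta>))"
proof -
  obtain E where E: "E \<in> delta_covers (cube_size / 2 ^ N) (sponge m D)"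
    "(\<Sum>i. gauge_size \<phi> (E i)) < ennreal s"
    using H unfolding hausdorff_premeasure_def INF_less_iff by blast
  have bd: "bounded (E i)" "diameter (E i) \<le> cube_size / 2 ^ N" for i
    using E(1) by (auto simp: delta_covers_def)
  define t where "t i = diameter (E i)" for i
  have t0: "0 \<le> t i" for i using diameter_ge_0[OF bd(1)] by (simp add: t_def)
  have phi: "0 \<le> \<phi> t" if "0 \<le> t" for t
    using mono_onD[OF mono, of 0 t] that nonneg by simp
  (* The tolerances are summable with sum \<eta>. *)
  have "\<exists>n. N \<le> n \<and> t i \<le> 2 * cube_size / 2 ^ n \<and> cube_gauge \<phi> n \<le> \<phi> (t i) + \<eta> * (1/2) ^ Suc i" for i
    using ex_level_for_diameter[OF mono cont t0[of i], of N "\<eta> * (1/2) ^ Suc i"] bd(2)[of i] \<open>0 < \<eta>\<close>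
    by (metis t_def mult_pos_pos zero_less_power half_gt_zero_iff zero_less_one)
  then obtain l where l: "\<And>i. N \<le> l i" "\<And>i. t i \<le> 2 * cube_size / 2 ^ l i"
     "\<And>i. cube_gauge \<phi> (l i) \<le> \<phi> (t i) + \<eta> * (1/2) ^ Suc i"
    by metis
  define W where "W i = word (l i) ` {x \<in> seqs. coding_map m x \<in> E i}" for i
  define C where "C = (\<Union>i. {l i} \<times> W i)"
  have "\<exists>n. (n, word n x) \<in> C" if "x \<in> seqs" for x
  proof -
    have "coding_map m x \<in> (\<Union>i. E i)" using that E(1) by (auto simp: delta_covers_def sponge_eq)
    then show ?thesis using that by (auto simp: C_def W_def)
  qed
  then obtain C' where C': "finite C'" "C' \<subseteq> C" "\<And>x. x \<in> seqs \<Longrightarrow> \<exists>n. (n, word n x) \<in> C'"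
    using finite_subcover[of C] by blast
  have "\<forall>p\<in>C'. \<exists>i. p \<in> {l i} \<times> W i" using C'(2) by (auto simp: C_def)
  then obtain i where i: "\<And>p. p \<in> C' \<Longrightarrow> p \<in> {l (i p)} \<times> W (i p)" by metis
  let ?o = "real (overlap_bound (2 * cube_size))"
  let ?c = "\<lambda>k. if E k = {} then 0 else \<phi> (t k)"
  have "(\<Sum>p\<in>C'. cube_gauge \<phi> (fst p)) = (\<Sum>k\<in>i ` C'. \<Sum>p | p \<in> C' \<and> i p = k. cube_gauge \<phi> (fst p))"
    by (rule sum.image_gen[OF C'(1)])
  also have "\<dots> \<le> (\<Sum>k\<in>i ` C'. ?o * (?c k + \<eta> * (1/2) ^ Suc k))"
  proof (rule sum_mono)
    fix k assume "k \<in> i ` C'"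
    then obtain p where "p \<in> C'" "i p = k" by blast
    then have ne: "E k \<noteq> {}" using i[of p] by (auto simp: W_def)
    have sub: "{p \<in> C'. i p = k} \<subseteq> {l k} \<times> W k" using i by blast
    have fin: "finite (W k)"
      by (rule finite_subset[OF _ finite_words[of "l k"]]) (auto simp: W_def)
    have "card {p \<in> C'. i p = k} \<le> card (W k)"
      using card_mono[OF _ sub] fin by (simp add: card_cartesian_product)
    also have "\<dots> \<le> overlap_bound (2 * cube_size)"
      unfolding W_def using l(2)[of k] bd(1) by (intro card_words_meeting_le) (auto simp: t_def)
    finally have card: "real (card {p \<in> C'. i p = k}) \<le> ?o" by simp
    have "(\<Sum>p | p \<in> C' \<and> i p = k. cube_gauge \<phi> (fst p)) = (\<Sum>p | p \<in> C' \<and> i p = k. cube_gauge \<phi> (l k))"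
      using sub by (intro sum.cong) auto
    also have "\<dots> = real (card {p \<in> C'. i p = k}) * cube_gauge \<phi> (l k)" by simp
    also have "\<dots> \<le> ?o * (\<phi> (t k) + \<eta> * (1/2) ^ Suc k)"
      using card l(3)[of k] phi[of "cube_size / 2 ^ l k"] cube_size_pos
      by (intro mult_mono) (auto simp: cube_gauge_def)
    finally show "(\<Sum>p | p \<in> C' \<and> i p = k. cube_gauge \<phi> (fst p)) \<le> ?o * (?c k + \<eta> * (1/2) ^ Suc k)"
      using ne by simp
  qed
  also have "\<dots> = ?o * ((\<Sum>k\<in>i ` C'. ?c k) + \<eta> * (\<Sum>k\<in>i ` C'. (1/2) ^ Suc k))"
    by (simp only: sum_distrib_left[symmetric] sum.distrib)
  also have "\<dots> \<le> ?o * (s + \<eta> * 1)"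
  proof (intro mult_left_mono add_mono)
    have fin: "finite (i ` C')" using C'(1) by simp
    have "ennreal (\<Sum>k\<in>i ` C'. ?c k) = (\<Sum>k\<in>i ` C'. gauge_size \<phi> (E k))"
    proof -
      have "(\<Sum>k\<in>i ` C'. gauge_size \<phi> (E k)) = (\<Sum>k\<in>i ` C'. ennreal (?c k))"
        by (intro sum.cong) (auto simp: gauge_size_def t_def)
      also have "\<dots> = ennreal (\<Sum>k\<in>i ` C'. ?c k)"
        using phi t0 by (intro sum_ennreal) auto
      finally show ?thesis by simp
    qed
    also have "\<dots> \<le> (\<Sum>i. gauge_size \<phi> (E i))" by (rule sum_le_suminf) (auto simp: fin)
    finally have "ennreal (\<Sum>k\<in>i ` C'. ?c k) < ennreal s" using E(2) by simp
    then show "(\<Sum>k\<in>i ` C'. ?c k) \<le> s"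
      using phi t0 by (subst (asm) ennreal_less_iff) (auto intro: sum_nonneg)
    have "(\<Sum>k\<in>i ` C'. (1/2::real) ^ Suc k) \<le> (\<Sum>k. (1/2) ^ Suc k)"
      using power_half_series by (intro sum_le_suminf fin) (auto simp: sums_iff)
    then show "(\<Sum>k\<in>i ` C'. (1/2::real) ^ Suc k) \<le> 1"
      using power_half_series by (simp only: sums_iff)
  qed (use \<open>0 < \<eta>\<close> in auto)
  finally have "(\<Sum>p\<in>C'. cube_gauge \<phi> (fst p)) \<le> ?o * (s + \<eta>)" by simp
  moreover have "\<forall>p\<in>C'. N \<le> fst p"
    using i l(1) by (metis SigmaE fst_conv singletonD)
  ultimately show ?thesis
    unfolding coverable_def using C' by blast
qed

lemma overlap_bound_pos: "0 \<le> A \<Longrightarrow> 0 < overlap_bound A"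
proof -
  assume "0 \<le> A"
  then have "0 < 3 + 2 * \<lfloor>A\<rfloor>" using zero_le_floor[of A] by linarith
  then show ?thesis by (simp add: overlap_bound_def)
qed

lemma gauge_function_regular:
  assumes "gauge_function \<phi>"
  shows "mono_on {0..} \<phi>" "continuous_on {0..} \<phi>" "0 \<le> \<phi> 0"
proof -
  have "mono_on {0..} \<phi> \<and> continuous_on {0..} \<phi> \<and> 0 \<le> \<phi> 0"
    using assms unfolding gauge_function_def
  proof (elim disjE exE conjE)
    fix \<gamma> :: real assume g: "0 \<le> \<gamma>" and eq: "\<forall>t\<ge>0. \<phi> t = power_gauge \<gamma> t"
    show ?thesis
    proof (intro conjI)
      show "mono_on {0..} \<phi>"
        using g by (intro mono_onI) (auto simp: eq power_gauge_def intro: powr_mono2)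
      have "continuous_on {0..} (power_gauge \<gamma>)"
        using g unfolding power_gauge_def
        by (cases "\<gamma> = 0")
          (simp_all add: continuous_on_powr'[OF continuous_on_id continuous_on_const])
      then show "continuous_on {0..} \<phi>"
        by (rule continuous_on_eq) (simp add: eq)
      show "0 \<le> \<phi> 0" by (simp add: eq power_gauge_def)
    qed
  qed auto
  then show "mono_on {0..} \<phi>" "continuous_on {0..} \<phi>" "0 \<le> \<phi> 0" by auto
qed

lemma power_gauge_gauge: "0 \<le> \<gamma> \<Longrightarrow> gauge_function (power_gauge \<gamma>)"
  by (auto simp: gauge_function_def)

lemma hausdorff_measure_finite_imp_coverable:
  assumes \<phi>: "gauge_function \<phi>" and fin: "hausdorff_measure \<phi> (sponge m D) < \<infinity>"
  obtains S where "\<And>N. coverable (cube_gauge \<phi>) N seqs S"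
proof -
  note reg = gauge_function_regular[OF \<phi>]
  obtain s where s: "0 \<le> s" "hausdorff_measure \<phi> (sponge m D) = ennreal s"
    using fin by (cases "hausdorff_measure \<phi> (sponge m D)") auto
  have "coverable (cube_gauge \<phi>) N seqs (real (overlap_bound (2 * cube_size)) * ((s + 1) + 1))" for N
  proof (rule coverable_of_hausdorff_premeasure[OF reg])
    have "hausdorff_premeasure \<phi> (cube_size / 2 ^ N) (sponge m D) \<le> hausdorff_measure \<phi> (sponge m D)"
      unfolding hausdorff_measure_eq_SUP using cube_size_pos by (intro SUP_upper) auto
    also have "\<dots> < ennreal (s + 1)" using s by (simp add: ennreal_less_iff)
    finally show "hausdorff_premeasure \<phi> (cube_size / 2 ^ N) (sponge m D) < ennreal (s + 1)" .
  qed simp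
  then show ?thesis using that by blast
qed

lemma hausdorff_measure_pos_of_not_coverable:
  assumes \<phi>: "gauge_function \<phi>" and "0 < c" and not: "\<not> coverable (cube_gauge \<phi>) N seqs c"
  shows "0 < hausdorff_measure \<phi> (sponge m D)"
proof (rule ccontr)
  note reg = gauge_function_regular[OF \<phi>]
  assume "\<not> 0 < hausdorff_measure \<phi> (sponge m D)"
  then have z: "hausdorff_measure \<phi> (sponge m D) = 0" by simp
  let ?o = "real (overlap_bound (2 * cube_size))"
  have o: "0 < ?o" using overlap_bound_pos[of "2 * cube_size"] cube_size_pos by simp
  define s where "s = c / (2 * ?o)"
  have s: "0 < s" using \<open>0 < c\<close> o by (simp add: s_def)
  have "hausdorff_premeasure \<phi> (cube_size / 2 ^ N) (sponge m D) \<le> hausdorff_measure \<phi> (sponge m D)"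
    unfolding hausdorff_measure_eq_SUP using cube_size_pos by (intro SUP_upper) auto
  then have "hausdorff_premeasure \<phi> (cube_size / 2 ^ N) (sponge m D) < ennreal s"
    unfolding z using s by simp
  from coverable_of_hausdorff_premeasure[OF reg this s]
  have "coverable (cube_gauge \<phi>) N seqs (?o * (s + s))" .
  moreover have "?o * (s + s) = c" using o by (simp add: s_def)
  ultimately show False using not by simp
qed

lemma coverable_mono:
  "coverable g N F s \<Longrightarrow> N' \<le> N \<Longrightarrow> F' \<subseteq> F \<Longrightarrow> s \<le> s' \<Longrightarrow> coverable g N' F' s'"
  unfolding coverable_def by (meson order_trans subsetD)

lemma coverable_Un:
  assumes "\<And>n. 0 \<le> g n" "coverable g N F s" "coverable g N F' s'"
  shows "coverable g N (F \<union> F') (s + s')"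
proof -
  obtain C where C: "finite C" "\<forall>p\<in>C. N \<le> fst p" "\<forall>x\<in>F. \<exists>n. (n, word n x) \<in> C"
      "(\<Sum>p\<in>C. g (fst p)) \<le> s"
    using assms(2) unfolding coverable_def by blast
  obtain C' where C': "finite C'" "\<forall>p\<in>C'. N \<le> fst p" "\<forall>x\<in>F'. \<exists>n. (n, word n x) \<in> C'"
      "(\<Sum>p\<in>C'. g (fst p)) \<le> s'"
    using assms(3) unfolding coverable_def by blast
  have "(\<Sum>p\<in>C \<union> C'. g (fst p)) \<le> (\<Sum>p\<in>C. g (fst p)) + (\<Sum>p\<in>C'. g (fst p))"
    using sum.union_inter[OF C(1) C'(1), of "\<lambda>p. g (fst p)"] sum_nonneg[of "C \<inter> C'" "\<lambda>p. g (fst p)"] assms(1)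
    by simp
  then show ?thesis unfolding coverable_def using C C'
    by (intro exI[of _ "C \<union> C'"]) (auto; blast)
qed

section \<open>Counting approximate cubes\<close>

text \<open>At level \<open>n\<close> the set of visible coordinates changes only at the positions \<open>cutoff n t\<close> with
  \<open>t\<close> in the range of \<open>theta\<close>.\<close>

definition cutoff :: "nat \<Rightarrow> real \<Rightarrow> nat" where
  "cutoff n t = nat \<lfloor>real n * t\<rfloor>"

text \<open>The change of \<open>f\<close> at the threshold \<open>t\<close>, for functions of the set of visible coordinates.\<close>

definition jump :: "('n set \<Rightarrow> real) \<Rightarrow> real \<Rightarrow> real" where
  "jump f t = f {j. t \<le> theta j} - f {j. t < theta j}"

lemma depth_eq_cutoff: "depth n j = cutoff n (theta j)"
  by (simp add: depth_def cutoff_def)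

lemma cutoff_mono: "s \<le> t \<Longrightarrow> cutoff n s \<le> cutoff n t"
  unfolding cutoff_def by (intro nat_mono floor_mono mult_left_mono) auto

lemma theta_range: "t \<in> range theta \<Longrightarrow> 0 < t \<and> t \<le> 1"
  using theta_pos theta_le_1 by auto

lemma cutoff_le: "t \<in> range theta \<Longrightarrow> cutoff n t \<le> n"
  using depth_le by (auto simp: depth_eq_cutoff)

lemma cutoff_bounds:
  assumes "0 \<le> t"
  shows "real (cutoff n t) \<le> real n * t" "real n * t < real (cutoff n t) + 1"
proof -
  have "0 \<le> real n * t" using assms by simp
  then show "real (cutoff n t) \<le> real n * t" "real n * t < real (cutoff n t) + 1"
    unfolding cutoff_def by linarith+
qed

text \<open>Summation by parts over the distinct values of \<open>theta\<close>. It replaces the usual enumeration of the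
  coordinates by increasing \<open>m j\<close> and takes care of coinciding values.\<close>

lemma telescope_thresholds:
  assumes up: "\<And>s t. P s \<Longrightarrow> s \<le> t \<Longrightarrow> P t"
  shows "(\<Sum>t | t \<in> range theta \<and> P t. jump f t) = f {j. P (theta j)} - f {}"
  using assms
proof (induction "card {t \<in> range theta. P t}" arbitrary: P rule: less_induct)
  case less
  let ?T = "{t \<in> range theta. P t}"
  have fin: "finite ?T" by simp
  show ?case
  proof (cases "?T = {}")
    case True
    then have "{j. P (theta j)} = {}" by auto
    then show ?thesis by (simp only: True sum.empty)
  next
    case False
    define t0 where "t0 = Min ?T"
    have t0: "t0 \<in> ?T" "\<And>t. t \<in> ?T \<Longrightarrow> t0 \<le> t"
      using Min_in[OF fin False] Min_le[OF fin] by (auto simp: t0_def)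
    have eq: "?T = insert t0 {t \<in> range theta. t0 < t}"
      using t0 less.prems by (auto simp: less_le)
    have "card {t \<in> range theta. t0 < t} < card ?T"
      using fin t0(1) by (intro psubset_card_mono) (auto simp: eq)
    then have IH: "(\<Sum>t | t \<in> range theta \<and> t0 < t. jump f t) = f {j. t0 < theta j} - f {}"
      by (intro less.hyps) auto
    have "(\<Sum>t | t \<in> range theta \<and> P t. jump f t) = jump f t0 + (\<Sum>t | t \<in> range theta \<and> t0 < t. jump f t)"
      unfolding eq by (subst sum.insert) auto
    also have "\<dots> = f {j. t0 \<le> theta j} - f {}"
      unfolding IH by (simp add: jump_def)
    also have "{j. t0 \<le> theta j} = {j. P (theta j)}"
      using t0 less.prems by auto
    finally show ?thesis .
  qed
qed

lemma vis_decompose: "f (vis n k) - f {} = (\<Sum>t\<in>range theta. if k < cutoff n t then jump f t else 0)"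
proof -
  have "(\<Sum>t | t \<in> range theta \<and> k < cutoff n t. jump f t) = f {j. k < cutoff n (theta j)} - f {}"
    by (rule telescope_thresholds) (use cutoff_mono in \<open>blast intro: less_le_trans\<close>)
  then show ?thesis
    by (simp add: vis_def depth_eq_cutoff sum.If_cases Int_def)
qed

text \<open>Sums over the ranges of constant visibility become sums over initial segments of positions, whose
  lengths are proportional to \<open>n\<close> up to rounding.\<close>

lemma sum_vis_decompose:
  "(\<Sum>k<n. f k (vis n k) - f k {}) = (\<Sum>t\<in>range theta. \<Sum>k<cutoff n t. jump (f k) t)"
proof -
  have "(\<Sum>k<n. f k (vis n k) - f k {}) = (\<Sum>k<n. \<Sum>t\<in>range theta. if k < cutoff n t then jump (f k) t else 0)"
    by (intro sum.cong refl vis_decompose)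
  also have "\<dots> = (\<Sum>t\<in>range theta. \<Sum>k<n. if k < cutoff n t then jump (f k) t else 0)"
    by (rule sum.swap)
  also have "\<dots> = (\<Sum>t\<in>range theta. \<Sum>k<cutoff n t. jump (f k) t)"
  proof (rule sum.cong[OF refl])
    fix t assume "t \<in> range theta"
    then have "cutoff n t \<le> n" by (rule cutoff_le)
    then have "{..<n} \<inter> {k. k < cutoff n t} = {..<cutoff n t}" by auto
    then show "(\<Sum>k<n. if k < cutoff n t then jump (f k) t else 0) = (\<Sum>k<cutoff n t. jump (f k) t)"
      by (simp add: sum.If_cases)
  qed
  finally show ?thesis .
qed

lemma vis_form: "vis n k = {} \<or> (\<exists>t\<in>range theta. vis n k = {j. t \<le> theta j})"
proof (cases "vis n k = {}")
  case False
  define t where "t = Min (theta ` vis n k)"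
  have t: "t \<in> theta ` vis n k" "\<And>j. j \<in> vis n k \<Longrightarrow> t \<le> theta j"
    using False by (auto simp: t_def)
  then obtain i where i: "i \<in> vis n k" "t = theta i" by blast
  have "j \<in> vis n k" if "t \<le> theta j" for j
    using i cutoff_mono[of "theta i" "theta j" n] that by (auto simp: vis_def depth_eq_cutoff)
  then show ?thesis using t by blast
qed simp

definition image_card :: "'n set \<Rightarrow> nat" where
  "image_card J = card (dproj J ` D)"

lemma image_card_pos: "0 < image_card J"
  unfolding image_card_def using finite_D D_nonempty by (simp add: card_gt_0_iff)

lemma image_card_empty [simp]: "image_card {} = 1"
proof -
  have "dproj {} ` D = {\<lambda>_. 0}" using D_nonempty by auto
  then show ?thesis by (simp add: image_card_def)
qed

lemma image_card_UNIV [simp]: "image_card UNIV = card D"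
  by (simp add: image_card_def)

text \<open>The digits of a word are independent, the digit at position \<open>k\<close> ranging over a projection of \<open>D\<close>.\<close>

lemma sum_words:
  fixes F :: "nat \<Rightarrow> ('n \<Rightarrow> nat) \<Rightarrow> real"
  shows "(\<Sum>w\<in>word n ` seqs. \<Prod>k<n. F k (w k)) = (\<Prod>k<n. \<Sum>a\<in>dproj (vis n k) ` D. F k a)"
proof -
  let ?W = "PiE {..<n} (\<lambda>k. dproj (vis n k) ` D)"
  let ?ext = "\<lambda>w k. if k < n then w k else (\<lambda>_::'n. 0::nat)"
  have "(\<Prod>k<n. \<Sum>a\<in>dproj (vis n k) ` D. F k a) = (\<Sum>w\<in>?W. \<Prod>k<n. F k (w k))"
    using finite_D by (intro prod_sum_PiE) auto
  also have "\<dots> = (\<Sum>w\<in>word n ` seqs. \<Prod>k<n. F k (w k))"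
  proof (rule sum.reindex_bij_witness[where i = "\<lambda>w. restrict w {..<n}" and j = ?ext])
    fix w assume w: "w \<in> ?W"
    show "restrict (?ext w) {..<n} = w" using w by (auto simp: fun_eq_iff PiE_def extensional_def)
    have "\<forall>k. \<exists>a\<in>D. k < n \<longrightarrow> w k = dproj (vis n k) a"
      using w D_nonempty by (fastforce simp: PiE_def Pi_def)
    then obtain x where x: "\<And>k. x k \<in> D" "\<And>k. k < n \<Longrightarrow> w k = dproj (vis n k) (x k)" by metis
    have "?ext w = word n x"
    proof
      fix k
      show "?ext w k = word n x k" using x(2)[of k] vis_empty[of n k] by (cases "k < n") (auto simp: word_def)
    qed
    then show "?ext w \<in> word n ` seqs" using x(1) by (auto simp: seqs_def)
    show "(\<Prod>k<n. F k (?ext w k)) = (\<Prod>k<n. F k (w k))" by simp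
  next
    fix w assume "w \<in> word n ` seqs"
    then obtain x where x: "x \<in> seqs" "w = word n x" by blast
    show "?ext (restrict w {..<n}) = w"
    proof
      fix k
      show "?ext (restrict w {..<n}) k = w k" using x(2) vis_empty[of n k] by (cases "k < n") (auto simp: word_def)
    qed
    show "restrict w {..<n} \<in> ?W" using x by (auto simp: word_def seqs_def)
  qed
  finally show ?thesis by simp
qed

definition num_words :: "nat \<Rightarrow> real" where
  "num_words n = real (card (word n ` seqs))"

lemma num_words_eq: "num_words n = (\<Prod>k<n. real (image_card (vis n k)))"
  using sum_words[where n = n and F = "\<lambda>_ _. 1"] by (simp add: num_words_def image_card_def)

lemma num_words_ge_1: "1 \<le> num_words n"
proof -
  have "0 < card (word n ` seqs)" using finite_words seqs_nonempty by (simp add: card_gt_0_iff)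
  then show ?thesis by (simp add: num_words_def)
qed

text \<open>The exponential growth rate of the number of cubes of level \<open>n\<close>.\<close>

definition growth :: real where
  "growth = (\<Sum>t\<in>range theta. t * jump (\<lambda>J. ln (real (image_card J))) t)"

definition growth_error :: real where
  "growth_error = (\<Sum>t\<in>range theta. \<bar>jump (\<lambda>J. ln (real (image_card J))) t\<bar>)"

lemma ln_num_words: "\<bar>ln (num_words n) - real n * growth\<bar> \<le> growth_error"
proof -
  let ?j = "jump (\<lambda>J. ln (real (image_card J)))"
  have "ln (num_words n) = (\<Sum>k<n. ln (real (image_card (vis n k))))"
    unfolding num_words_eq using image_card_pos by (subst ln_prod) auto
  also have "\<dots> = (\<Sum>t\<in>range theta. real (cutoff n t) * ?j t)"
    using sum_vis_decompose[of "\<lambda>_ J. ln (real (image_card J))" n] by simp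
  finally have "ln (num_words n) - real n * growth = (\<Sum>t\<in>range theta. (real (cutoff n t) - real n * t) * ?j t)"
    by (simp add: growth_def sum_distrib_left sum_subtractf[symmetric] algebra_simps)
  also have "\<bar>\<dots>\<bar> \<le> (\<Sum>t\<in>range theta. \<bar>(real (cutoff n t) - real n * t) * ?j t\<bar>)"
    by (rule sum_abs)
  also have "\<dots> \<le> growth_error"
    unfolding growth_error_def
  proof (rule sum_mono)
    fix t assume "t \<in> range theta"
    then have "0 \<le> t" using theta_range by force
    then have "\<bar>real (cutoff n t) - real n * t\<bar> \<le> 1"
      using cutoff_bounds[of t n] by linarith
    then show "\<bar>(real (cutoff n t) - real n * t) * ?j t\<bar> \<le> \<bar>?j t\<bar>"
      unfolding abs_mult by (intro mult_left_le_one_le) auto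
  qed
  finally show ?thesis .
qed

lemma num_words_bounds:
  "num_words n \<le> exp growth_error * exp (real n * growth)"
  "exp (real n * growth) \<le> exp growth_error * num_words n"
proof -
  have p: "num_words n = exp (ln (num_words n))" using num_words_ge_1[of n] by simp
  show "num_words n \<le> exp growth_error * exp (real n * growth)"
    "exp (real n * growth) \<le> exp growth_error * num_words n"
    unfolding exp_add[symmetric] using ln_num_words[of n]
    by (subst p, simp add: exp_add[symmetric])+
qed

lemma growth_nonneg: "0 \<le> growth"
proof (rule ccontr)
  assume "\<not> 0 \<le> growth"
  then have "0 < - growth" by simp
  then obtain n where "growth_error < real n * - growth"
    using reals_Archimedean3 by blast
  moreover have "0 \<le> ln (num_words n)" using num_words_ge_1 by simp
  ultimately show False using ln_num_words[of n] by linarith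
qed

text \<open>The common value of lower and upper box dimension.\<close>

definition cube_exponent :: real where "cube_exponent = growth / ln 2"

lemma cube_exponent_nonneg: "0 \<le> cube_exponent"
  by (simp add: cube_exponent_def growth_nonneg)

lemma two_power_cube_exponent: "(2 ^ n) powr - cube_exponent = exp (- (real n * growth))" "(2 ^ n) powr cube_exponent = exp (real n * growth)"
  by (simp_all add: cube_exponent_def powr_def ln_realpow)

section \<open>The box dimension\<close>

text \<open>Cubes of diameter at most \<open>\<delta>\<close> form a cover, and conversely every set of diameter at most \<open>\<delta>\<close>
  meets only boundedly many of them.\<close>

lemma covering_number_bounds:
  assumes n: "cube_size / 2 ^ n \<le> \<delta>" "\<delta> \<le> 2 * cube_size / 2 ^ n"
  shows "real (covering_number \<delta> (sponge m D)) \<le> num_words n"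
    and "num_words n \<le> real (overlap_bound (2 * cube_size)) * real (covering_number \<delta> (sponge m D))"
proof -
  let ?S = "{card C | C. finite C \<and> sponge m D \<subseteq> \<Union>C \<and> (\<forall>E\<in>C. bounded E \<and> diameter E \<le> \<delta>)}"
  let ?Q = "\<lambda>w. coding_map m ` {x \<in> seqs. word n x = w}"
  let ?C = "?Q ` word n ` seqs"
  have "card ?C \<in> ?S"
  proof -
    have "finite ?C" using finite_words by simp
    moreover have "sponge m D \<subseteq> \<Union> ?C" by (auto simp: sponge_eq)
    moreover have "\<forall>E\<in>?C. bounded E \<and> diameter E \<le> \<delta>"
      using image_cube_bounds[of n] n(1) by (auto intro: order_trans)
    ultimately show ?thesis by blast
  qed
  then have ne: "?S \<noteq> {}" by blast
  have "covering_number \<delta> (sponge m D) \<le> card ?C"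
    unfolding covering_number_def using \<open>card ?C \<in> ?S\<close> by (intro cInf_lower) auto
  also have "card ?C \<le> card (word n ` seqs)" by (rule card_image_le[OF finite_words])
  finally show "real (covering_number \<delta> (sponge m D)) \<le> num_words n"
    by (simp add: num_words_def)
  have "covering_number \<delta> (sponge m D) \<in> ?S"
    unfolding covering_number_def using Inf_nat_def1[OF ne] .
  then obtain C where C: "finite C" "sponge m D \<subseteq> \<Union>C" "\<And>E. E \<in> C \<Longrightarrow> bounded E \<and> diameter E \<le> \<delta>"
    "covering_number \<delta> (sponge m D) = card C" by auto
  let ?W = "\<lambda>E. word n ` {x \<in> seqs. coding_map m x \<in> E}"
  have "word n ` seqs = (\<Union>E\<in>C. ?W E)"
  proof
    show "word n ` seqs \<subseteq> (\<Union>E\<in>C. ?W E)"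
    proof (rule image_subsetI)
      fix x assume "x \<in> seqs"
      then obtain E where "E \<in> C" "coding_map m x \<in> E" using C(2) by (auto simp: sponge_eq)
      then show "word n x \<in> (\<Union>E\<in>C. ?W E)" using \<open>x \<in> seqs\<close> by blast
    qed
  qed blast
  then have "card (word n ` seqs) \<le> (\<Sum>E\<in>C. card (?W E))"
    using card_UN_le[OF C(1), of ?W] by simp
  also have "\<dots> \<le> (\<Sum>E\<in>C. overlap_bound (2 * cube_size))"
    using C(3) order_trans[OF _ n(2)] by (intro sum_mono card_words_meeting_le) blast+
  finally show "num_words n \<le> real (overlap_bound (2 * cube_size)) * real (covering_number \<delta> (sponge m D))"
    unfolding num_words_def C(4) by (simp add: mult.commute flip: of_nat_mult)
qed

lemma ln_covering_number:
  obtains B where "\<And>\<delta>. 0 < \<delta> \<Longrightarrow> \<delta> \<le> cube_size \<Longrightarrow>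
    \<bar>ln (real (covering_number \<delta> (sponge m D))) - cube_exponent * - ln \<delta>\<bar> \<le> B"
proof -
  let ?o = "real (overlap_bound (2 * cube_size))"
  have o: "1 \<le> ?o" using overlap_bound_pos[of "2 * cube_size"] cube_size_pos by simp
  define B where "B = growth_error + ln ?o + cube_exponent * (\<bar>ln cube_size\<bar> + ln 2)"
  have "\<bar>ln (real (covering_number \<delta> (sponge m D))) - cube_exponent * - ln \<delta>\<bar> \<le> B"
    if \<delta>: "0 < \<delta>" "\<delta> \<le> cube_size" for \<delta>
  proof -
    have "\<delta> \<le> cube_size / 2 ^ 0" using \<delta> by simp
    then obtain n where n: "cube_size / 2 ^ n \<le> \<delta>" "\<delta> \<le> 2 * cube_size / 2 ^ n"
      using ex_dyadic_level[OF \<delta>(1)] by blast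
    let ?c = "real (covering_number \<delta> (sponge m D))"
    note cb = covering_number_bounds[OF n]
    have "0 < ?o * ?c" using cb(2) num_words_ge_1[of n] by linarith
    then have c: "0 < ?c" using o by (simp add: zero_less_mult_iff)
    have 1: "ln ?c \<le> ln (num_words n)" using cb(1) c by simp
    have "ln (num_words n) \<le> ln (?o * ?c)" using cb(2) num_words_ge_1[of n] c by (subst ln_le_cancel_iff) auto
    then have 2: "ln (num_words n) \<le> ln ?o + ln ?c" using o c by (simp add: ln_mult)
    have "ln (cube_size / 2 ^ n) \<le> ln \<delta>" using n \<delta> cube_size_pos by (subst ln_le_cancel_iff) auto
    then have 3: "ln cube_size - real n * ln 2 \<le> ln \<delta>"
      using cube_size_pos by (simp add: ln_div ln_realpow)
    have "ln \<delta> \<le> ln (2 * cube_size / 2 ^ n)" using n \<delta> cube_size_pos by (subst ln_le_cancel_iff) auto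
    then have 4: "ln \<delta> \<le> ln 2 + ln cube_size - real n * ln 2"
      using cube_size_pos by (simp add: ln_div ln_mult ln_realpow)
    have "\<bar>real n * ln 2 + ln \<delta>\<bar> \<le> \<bar>ln cube_size\<bar> + ln 2" using 3 4 ln_gt_zero[of "2::real"] by linarith
    then have "cube_exponent * \<bar>real n * ln 2 + ln \<delta>\<bar> \<le> cube_exponent * (\<bar>ln cube_size\<bar> + ln 2)"
      by (rule mult_left_mono[OF _ cube_exponent_nonneg])
    then have 5: "\<bar>cube_exponent * (real n * ln 2 + ln \<delta>)\<bar> \<le> cube_exponent * (\<bar>ln cube_size\<bar> + ln 2)"
      using cube_exponent_nonneg by (simp add: abs_mult)
    have 6: "cube_exponent * (real n * ln 2 + ln \<delta>) = real n * growth - cube_exponent * - ln \<delta>"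
      by (simp add: cube_exponent_def algebra_simps)
    show ?thesis using 1 2 5 ln_num_words[of n] ln_ge_zero[OF o] unfolding 6 B_def by linarith
  qed
  then show ?thesis using that by blast
qed

lemma box_dim_sponge: "box_dim (sponge m D) = ereal cube_exponent"
proof -
  obtain B where B: "\<And>\<delta>. 0 < \<delta> \<Longrightarrow> \<delta> \<le> cube_size \<Longrightarrow>
    \<bar>ln (real (covering_number \<delta> (sponge m D))) - cube_exponent * - ln \<delta>\<bar> \<le> B"
    using ln_covering_number by blast
  let ?r = "\<lambda>\<delta>. ln (real (covering_number \<delta> (sponge m D))) / ln (1 / \<delta>)"
  have lim: "((\<lambda>\<delta>::real. B / - ln \<delta>) \<longlongrightarrow> 0) (at_right 0)"
    using ln_at_0 by (intro tendsto_divide_0[OF tendsto_const] filterlim_at_top_imp_at_infinity)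
      (simp add: filterlim_uminus_at_top)
  have "((\<lambda>\<delta>. ?r \<delta> - cube_exponent) \<longlongrightarrow> 0) (at_right 0)"
  proof (rule Lim_null_comparison[OF _ lim])
    have "\<bar>?r \<delta> - cube_exponent\<bar> \<le> B / - ln \<delta>" if "0 < \<delta>" "\<delta> < min cube_size 1" for \<delta>
    proof -
      have l: "0 < - ln \<delta>" using that by simp
      have "?r \<delta> - cube_exponent = (ln (real (covering_number \<delta> (sponge m D))) - cube_exponent * - ln \<delta>) / - ln \<delta>"
        using that l by (simp add: ln_div field_simps)
      also have "\<bar>\<dots>\<bar> = \<bar>ln (real (covering_number \<delta> (sponge m D))) - cube_exponent * - ln \<delta>\<bar> / - ln \<delta>"
        using l by (simp only: abs_divide abs_of_pos)
      also have "\<dots> \<le> B / - ln \<delta>"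
        using B[of \<delta>] that l by (intro divide_right_mono) auto
      finally show ?thesis .
    qed
    then show "\<forall>\<^sub>F \<delta> in at_right 0. norm (?r \<delta> - cube_exponent) \<le> B / - ln \<delta>"
      unfolding eventually_at_right_field real_norm_def
      using cube_size_pos by (intro exI[of _ "min cube_size 1"]) auto
  qed
  then have "(?r \<longlongrightarrow> cube_exponent) (at_right 0)" by (rule LIM_zero_cancel)
  then have "((\<lambda>\<delta>. ereal (?r \<delta>)) \<longlongrightarrow> ereal cube_exponent) (at_right 0)" by simp
  then show ?thesis unfolding box_dim_def by (intro tendsto_Lim) auto
qed

section \<open>The Hausdorff dimension is at most the box dimension\<close>

lemma cube_gauge_power: "0 \<le> \<gamma> \<Longrightarrow> cube_gauge (power_gauge \<gamma>) n = cube_size powr \<gamma> * (2 ^ n) powr - \<gamma>"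
proof -
  have "power_gauge \<gamma> (cube_size / 2 ^ n) = (cube_size / 2 ^ n) powr \<gamma>"
    using cube_size_pos by (simp add: power_gauge_def)
  also have "\<dots> = cube_size powr \<gamma> / (2 ^ n) powr \<gamma>"
    by (rule powr_divide)
  also have "\<dots> = cube_size powr \<gamma> * (2 ^ n) powr - \<gamma>"
    by (simp only: powr_minus divide_inverse)
  finally show ?thesis by (simp only: cube_gauge_def)
qed

lemma coverable_one_level:
  assumes "\<And>n. 0 \<le> g n" "N \<le> n"
  shows "coverable g N seqs (num_words n * g n)"
proof -
  have "(\<Sum>p\<in>{n} \<times> word n ` seqs. g (fst p)) = (\<Sum>p\<in>{n} \<times> word n ` seqs. g n)"
    by (rule sum.cong) auto
  also have "\<dots> = num_words n * g n"
    by (simp add: num_words_def card_cartesian_product)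
  finally have "(\<Sum>p\<in>{n} \<times> word n ` seqs. g (fst p)) = num_words n * g n" .
  then show ?thesis
    unfolding coverable_def
  proof (intro exI[of _ "{n} \<times> word n ` seqs"] conjI)
    show "finite ({n} \<times> word n ` seqs)" using finite_words[of n] by simp
    show "\<forall>p\<in>{n} \<times> word n ` seqs. N \<le> fst p" using assms(2) by auto
    show "\<forall>x\<in>seqs. \<exists>k. (k, word k x) \<in> {n} \<times> word n ` seqs" by blast
  qed simp
qed

lemma power_hausdorff_measure_zeroI:
  assumes "0 \<le> \<gamma>" "\<And>N s. 0 < s \<Longrightarrow> coverable (cube_gauge (power_gauge \<gamma>)) N seqs s"
  shows "hausdorff_measure (power_gauge \<gamma>) (sponge m D) = 0"
proof -
  note reg = gauge_function_regular[OF power_gauge_gauge[OF assms(1)]]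
  have "hausdorff_measure (power_gauge \<gamma>) (sponge m D) \<le> ennreal s" if "0 < s" for s
    by (rule hausdorff_measure_le_of_coverable[OF reg(1,3) assms(2)[OF that]])
  then have "hausdorff_measure (power_gauge \<gamma>) (sponge m D) \<le> 0 + ennreal s" if "0 < s" for s
    using that by simp
  then have "hausdorff_measure (power_gauge \<gamma>) (sponge m D) \<le> 0"
    by (rule ennreal_le_epsilon)
  then show ?thesis by simp
qed

lemma num_words_gauge_le:
  assumes "cube_exponent \<le> \<gamma>"
  shows "num_words n * cube_gauge (power_gauge \<gamma>) n
    \<le> exp growth_error * cube_size powr \<gamma> * (2 ^ n) powr - (\<gamma> - cube_exponent)"
proof -
  have "0 \<le> \<gamma>" using assms cube_exponent_nonneg by simp
  then have "num_words n * cube_gauge (power_gauge \<gamma>) n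
      \<le> (exp growth_error * exp (real n * growth)) * (cube_size powr \<gamma> * (2 ^ n) powr - \<gamma>)"
    unfolding cube_gauge_power[OF \<open>0 \<le> \<gamma>\<close>] by (intro mult_right_mono num_words_bounds) auto
  also have "\<dots> = exp growth_error * cube_size powr \<gamma> * ((2 ^ n) powr cube_exponent * (2 ^ n) powr - \<gamma>)"
    by (simp add: two_power_cube_exponent)
  also have "(2 ^ n) powr cube_exponent * (2 ^ n) powr - \<gamma> = (2 ^ n :: real) powr - (\<gamma> - cube_exponent)"
    unfolding powr_add[symmetric] by simp
  finally show ?thesis .
qed

lemma power_two_powr_tendsto_0:
  assumes "0 < (c::real)"
  shows "(\<lambda>n. (2 ^ n) powr - c) \<longlonglongrightarrow> 0"
proof -
  have "(\<lambda>n. exp (- (c * ln 2)) ^ n) \<longlonglongrightarrow> 0"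
    using assms by (intro LIMSEQ_power_zero) simp
  moreover have "(2 ^ n) powr - c = exp (- (c * ln 2)) ^ n" for n
    unfolding exp_of_nat_mult[symmetric] by (simp add: powr_def ln_realpow algebra_simps)
  ultimately show ?thesis by simp
qed

lemma hausdorff_measure_zero_above:
  assumes "cube_exponent < \<gamma>"
  shows "hausdorff_measure (power_gauge \<gamma>) (sponge m D) = 0"
proof (rule power_hausdorff_measure_zeroI)
  show "0 \<le> \<gamma>" using assms cube_exponent_nonneg by simp
  fix N and s :: real assume "0 < s"
  have "(\<lambda>n. exp growth_error * cube_size powr \<gamma> * (2 ^ n) powr - (\<gamma> - cube_exponent)) \<longlonglongrightarrow>
      exp growth_error * cube_size powr \<gamma> * 0"
    using assms by (intro tendsto_intros power_two_powr_tendsto_0) simp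
  then have "\<forall>\<^sub>F n in sequentially. exp growth_error * cube_size powr \<gamma> * (2 ^ n) powr - (\<gamma> - cube_exponent) < s"
    using \<open>0 < s\<close> by (intro order_tendstoD(2)) auto
  then have "\<forall>\<^sub>F n in sequentially. N \<le> n \<and> exp growth_error * cube_size powr \<gamma> * (2 ^ n) powr - (\<gamma> - cube_exponent) < s"
    using eventually_ge_at_top by (rule eventually_conj[rotated])
  then obtain n where n: "N \<le> n" "exp growth_error * cube_size powr \<gamma> * (2 ^ n) powr - (\<gamma> - cube_exponent) < s"
    using eventually_happens by force
  have g: "0 \<le> cube_gauge (power_gauge \<gamma>) n" for n by (simp add: cube_gauge_def power_gauge_def)
  show "coverable (cube_gauge (power_gauge \<gamma>)) N seqs s"
    using num_words_gauge_le[of \<gamma> n] n assms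
    by (intro coverable_mono[OF coverable_one_level[OF g n(1)]]) auto
qed

lemma hausdorff_measure_cube_exponent_finite: "hausdorff_measure (power_gauge cube_exponent) (sponge m D) < \<infinity>"
proof -
  note reg = gauge_function_regular[OF power_gauge_gauge[OF cube_exponent_nonneg]]
  have g: "0 \<le> cube_gauge (power_gauge cube_exponent) n" for n by (simp add: cube_gauge_def power_gauge_def)
  have "hausdorff_measure (power_gauge cube_exponent) (sponge m D) \<le> ennreal (exp growth_error * cube_size powr cube_exponent)"
  proof (rule hausdorff_measure_le_of_coverable[OF reg(1,3)])
    fix N
    show "coverable (cube_gauge (power_gauge cube_exponent)) N seqs (exp growth_error * cube_size powr cube_exponent)"
      using num_words_gauge_le[of cube_exponent N]
      by (intro coverable_mono[OF coverable_one_level[OF g order_refl]]) auto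
  qed
  also have "\<dots> < \<infinity>" by simp
  finally show ?thesis .
qed

lemma hausdorff_dim_le: "hausdorff_dim (sponge m D) \<le> ereal cube_exponent"
proof -
  have "hausdorff_dim (sponge m D) \<le> ereal (cube_exponent + e)" if "0 < e" for e
  proof -
    have "0 \<le> cube_exponent + e" "hausdorff_measure (power_gauge (cube_exponent + e)) (sponge m D) = 0"
      using that hausdorff_measure_zero_above[of "cube_exponent + e"] cube_exponent_nonneg by auto
    then show ?thesis unfolding hausdorff_dim_def by (intro Inf_lower) blast
  qed
  then have "hausdorff_dim (sponge m D) \<le> ereal cube_exponent + ereal e" if "0 < e" for e using that by simp
  then show ?thesis by (rule ereal_le_epsilon2)
qed

section \<open>The uniform measure\<close>

definition fibre_card :: "'n set \<Rightarrow> ('n \<Rightarrow> nat) \<Rightarrow> nat" where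
  "fibre_card J a = card {b \<in> D. dproj J b = dproj J a}"

text \<open>The mass of the cube of level \<open>n\<close> around \<open>x\<close> under the uniform Bernoulli measure on \<open>D\<^sup>\<nat>\<close>. The
  measure itself is represented by counting prefixes, see \<open>card_prefix_class\<close>.\<close>

definition cube_mass :: "nat \<Rightarrow> (nat \<Rightarrow> 'n \<Rightarrow> nat) \<Rightarrow> real" where
  "cube_mass n x = (\<Prod>k<n. real (fibre_card (vis n k) (x k)) / real (card D))"

definition prefixes :: "nat \<Rightarrow> (nat \<Rightarrow> 'n \<Rightarrow> nat) set" where
  "prefixes K = PiE {..<K} (\<lambda>_. D)"

lemma fibre_card_pos: "a \<in> D \<Longrightarrow> 0 < fibre_card J a"
  using finite_D by (auto simp: fibre_card_def card_gt_0_iff)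

lemma fibre_card_le: "fibre_card J a \<le> card D"
  unfolding fibre_card_def using finite_D by (intro card_mono) auto

lemma fibre_card_empty [simp]: "fibre_card {} a = card D"
  by (simp add: fibre_card_def)

lemma fibre_card_UNIV: "a \<in> D \<Longrightarrow> fibre_card UNIV a = 1"
proof -
  assume "a \<in> D"
  then have "{b \<in> D. b = a} = {a}" by auto
  then show ?thesis by (simp add: fibre_card_def)
qed

lemma fibre_card_dproj: "fibre_card J (dproj J a) = fibre_card J a"
  by (simp add: fibre_card_def dproj_dproj)

lemma cube_mass_word: "cube_mass n (word n x) = cube_mass n x"
  by (simp add: cube_mass_def word_def fibre_card_dproj)

lemma cube_mass_nonneg: "0 \<le> cube_mass n x"
  unfolding cube_mass_def by (intro prod_nonneg) auto

lemma cube_mass_pos: "(\<And>k. k < n \<Longrightarrow> x k \<in> D) \<Longrightarrow> 0 < cube_mass n x"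
  unfolding cube_mass_def using fibre_card_pos card_D_pos by (intro prod_pos) auto

lemma cube_mass_cong: "(\<And>k. k < n \<Longrightarrow> x k = y k) \<Longrightarrow> cube_mass n x = cube_mass n y"
  unfolding cube_mass_def by (intro prod.cong) auto

lemma word_cong: "(\<And>k. k < n \<Longrightarrow> x k = y k) \<Longrightarrow> word n x = word n y"
  using less_le_trans[OF _ depth_le[of n]] by (simp add: word_eq_iff)

lemma finite_prefixes: "finite (prefixes K)"
  unfolding prefixes_def using finite_D by (intro finite_PiE) auto

lemma card_prefixes: "card (prefixes K) = card D ^ K"
  unfolding prefixes_def by (simp add: card_PiE)

lemma prefixes_D: "z \<in> prefixes K \<Longrightarrow> k < K \<Longrightarrow> z k \<in> D"
  by (auto simp: prefixes_def)

lemma prefix_extend: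
  assumes "z \<in> prefixes K"
  obtains x where "x \<in> seqs" "\<And>k. k < K \<Longrightarrow> x k = z k"
proof -
  obtain d where "d \<in> D" using D_nonempty by blast
  then show ?thesis
    using prefixes_D[OF assms] by (intro that[of "\<lambda>k. if k < K then z k else d"]) (auto simp: seqs_def)
qed

lemma seqs_prefix: "x \<in> seqs \<Longrightarrow> restrict x {..<K} \<in> prefixes K"
  by (auto simp: prefixes_def seqs_def)

lemma card_prefix_class:
  assumes "n \<le> K"
  shows "real (card {z \<in> prefixes K. word n z = word n x}) = cube_mass n x * real (card D) ^ K"
proof -
  have "{z \<in> prefixes K. word n z = word n x} = PiE {..<K} (\<lambda>k. {b \<in> D. dproj (vis n k) b = dproj (vis n k) (x k)})"
  proof -
    have "word n z = word n x \<longleftrightarrow> (\<forall>k<K. dproj (vis n k) (z k) = dproj (vis n k) (x k))" for z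
    proof
      assume h: "\<forall>k<K. dproj (vis n k) (z k) = dproj (vis n k) (x k)"
      show "word n z = word n x"
      proof
        fix k show "word n z k = word n x k"
          using h vis_empty[of n k] assms by (cases "k < K") (auto simp: word_def)
      qed
    next
      assume "word n z = word n x"
      then show "\<forall>k<K. dproj (vis n k) (z k) = dproj (vis n k) (x k)"
        by (metis word_def)
    qed
    then show ?thesis by (auto simp: prefixes_def PiE_def)
  qed
  then have "real (card {z \<in> prefixes K. word n z = word n x}) = (\<Prod>k<K. real (fibre_card (vis n k) (x k)))"
    by (simp add: card_PiE fibre_card_def)
  also have "\<dots> = (\<Prod>k<K. real (fibre_card (vis n k) (x k)) / real (card D)) * real (card D) ^ K"
    using card_D_pos by (simp add: prod_dividef)
  also have "(\<Prod>k<K. real (fibre_card (vis n k) (x k)) / real (card D)) = cube_mass n x"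
    unfolding cube_mass_def using assms card_D_pos vis_empty[of n]
    by (intro prod.mono_neutral_right) auto
  finally show ?thesis .
qed

lemma card_prefix_class_le:
  assumes "n \<le> K"
  shows "real (card {z \<in> prefixes K. word n z = w}) \<le> cube_mass n w * real (card D) ^ K"
proof (cases "{z \<in> prefixes K. word n z = w} = {}")
  case True
  show ?thesis unfolding True by (simp add: cube_mass_nonneg)
next
  case False
  then obtain z where "word n z = w" by blast
  then have "word n w = w" using word_word by metis
  then show ?thesis using card_prefix_class[OF assms, of w] by simp
qed

lemma mass_cover_le:
  assumes "finite C" "\<And>p. p \<in> C \<Longrightarrow> fst p \<le> K" "Z \<subseteq> prefixes K"
    and cov: "\<And>z. z \<in> Z \<Longrightarrow> \<exists>p\<in>C. word (fst p) z = snd p"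
  shows "real (card Z) \<le> (\<Sum>p\<in>C. cube_mass (fst p) (snd p)) * real (card D) ^ K"
proof -
  let ?P = "\<lambda>p. {z \<in> prefixes K. word (fst p) z = snd p}"
  have "Z \<subseteq> (\<Union>p\<in>C. ?P p)" using cov assms(3) by blast
  then have "card Z \<le> card (\<Union>p\<in>C. ?P p)"
    using assms(1) finite_prefixes by (intro card_mono) auto
  also have "\<dots> \<le> (\<Sum>p\<in>C. card (?P p))" by (rule card_UN_le[OF assms(1)])
  finally have "real (card Z) \<le> (\<Sum>p\<in>C. real (card (?P p)))"
    by (simp flip: of_nat_sum)
  also have "\<dots> \<le> (\<Sum>p\<in>C. cube_mass (fst p) (snd p) * real (card D) ^ K)"
    using assms(2) by (intro sum_mono card_prefix_class_le) auto
  finally show ?thesis by (simp add: sum_distrib_right)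
qed

text \<open>The mass distribution principle: a prefix all of whose cubes are light lies in a cube of the cover,
  and the cubes of the cover containing such prefixes have mass at most \<open>c\<close> times their cost. As
  the cover is finite, it suffices to look at prefixes of some finite length \<open>K\<close>.\<close>

lemma mass_distribution:
  assumes cov: "coverable g N seqs s" and c: "0 \<le> c" and g: "\<And>n. 0 \<le> g n"
  obtains K where "N \<le> K"
    "real (card {z \<in> prefixes K. \<forall>n. N \<le> n \<longrightarrow> n \<le> K \<longrightarrow> cube_mass n z \<le> c * g n}) \<le> c * s * real (card D) ^ K"
proof -
  obtain C where C: "finite C" "\<forall>p\<in>C. N \<le> fst p" "\<forall>x\<in>seqs. \<exists>n. (n, word n x) \<in> C"
      "(\<Sum>p\<in>C. g (fst p)) \<le> s"
    using cov unfolding coverable_def by blast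
  define K where "K = N + Max (fst ` C)"
  have ne: "C \<noteq> {}" using C(3) seqs_nonempty by blast
  have K: "fst p \<le> K" if "p \<in> C" for p
    using that C(1) by (simp add: K_def trans_le_add2)
  define Z where "Z = {z \<in> prefixes K. \<forall>n. N \<le> n \<longrightarrow> n \<le> K \<longrightarrow> cube_mass n z \<le> c * g n}"
  define C' where "C' = {p \<in> C. \<exists>z\<in>Z. word (fst p) z = snd p}"
  have "real (card Z) \<le> (\<Sum>p\<in>C'. cube_mass (fst p) (snd p)) * real (card D) ^ K"
  proof (rule mass_cover_le)
    show "finite C'" "Z \<subseteq> prefixes K" using C(1) by (auto simp: C'_def Z_def)
    show "fst p \<le> K" if "p \<in> C'" for p using that K by (simp add: C'_def)
    fix z assume z: "z \<in> Z"
    then obtain x where x: "x \<in> seqs" "\<And>k. k < K \<Longrightarrow> x k = z k"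
      using prefix_extend[of z K] by (auto simp: Z_def)
    then obtain n where n: "(n, word n x) \<in> C" using C(3) by blast
    then have "n \<le> K" using K by force
    then have "word n x = word n z" using x(2) by (intro word_cong) auto
    then show "\<exists>p\<in>C'. word (fst p) z = snd p"
      using n z by (intro bexI[of _ "(n, word n x)"]) (auto simp: C'_def)
  qed
  also have "\<dots> \<le> (c * s) * real (card D) ^ K"
  proof (rule mult_right_mono)
    have "(\<Sum>p\<in>C'. cube_mass (fst p) (snd p)) \<le> (\<Sum>p\<in>C'. c * g (fst p))"
    proof (rule sum_mono)
      fix p assume p: "p \<in> C'"
      then obtain z where z: "z \<in> Z" "snd p = word (fst p) z" by (auto simp: C'_def)
      have "N \<le> fst p" "fst p \<le> K" using p C(2) K by (auto simp: C'_def)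
      then show "cube_mass (fst p) (snd p) \<le> c * g (fst p)"
        using z by (simp add: cube_mass_word Z_def)
    qed
    also have "\<dots> \<le> (\<Sum>p\<in>C. c * g (fst p))"
      using C(1) c g by (intro sum_mono2) (auto simp: C'_def)
    also have "\<dots> = c * (\<Sum>p\<in>C. g (fst p))" by (simp add: sum_distrib_left)
    also have "\<dots> \<le> c * s" using C(4) c by (rule mult_left_mono)
    finally show "(\<Sum>p\<in>C'. cube_mass (fst p) (snd p)) \<le> c * s" .
  qed simp
  finally show ?thesis using that[of K] by (simp add: Z_def K_def)
qed

section \<open>Uniform fibres\<close>

text \<open>The first factor is the cardinality of the fibre of \<open>a\<close> and the second the number of nonempty
  fibres, so the equation says that this fibre has the average cardinality.\<close>

definition uniform_fibres :: bool where
  "uniform_fibres \<longleftrightarrow> (\<forall>t\<in>range theta. \<forall>a\<in>D. fibre_card {j. t \<le> theta j} a * image_card {j. t \<le> theta j} = card D)"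

text \<open>Each factor of the mass is the reciprocal of the corresponding factor of the number of words.\<close>

lemma uniform_cube_mass:
  assumes u: uniform_fibres and x: "\<And>k. k < n \<Longrightarrow> x k \<in> D"
  shows "cube_mass n x = 1 / num_words n"
proof -
  have "real (fibre_card (vis n k) (x k)) / real (card D) = 1 / real (image_card (vis n k))" if "k < n" for k
  proof -
    have "fibre_card (vis n k) (x k) * image_card (vis n k) = card D"
    proof (cases "vis n k = {}")
      case False
      then obtain t where "t \<in> range theta" "vis n k = {j. t \<le> theta j}" using vis_form by blast
      then show ?thesis using u x[OF that] unfolding uniform_fibres_def by metis
    qed simp
    then have "real (card D) = real (fibre_card (vis n k) (x k)) * real (image_card (vis n k))"
      by (simp flip: of_nat_mult)
    then show ?thesis using fibre_card_pos[OF x[OF that], of "vis n k"] by simp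
  qed
  then show ?thesis by (simp add: cube_mass_def num_words_eq prod_dividef)
qed

lemma uniform_hausdorff_measure_pos:
  assumes u: uniform_fibres and \<gamma>: "0 \<le> \<gamma>" "\<gamma> \<le> cube_exponent"
  shows "0 < hausdorff_measure (power_gauge \<gamma>) (sponge m D)"
proof -
  let ?g = "cube_gauge (power_gauge \<gamma>)"
  define c where "c = exp growth_error / cube_size powr \<gamma>"
  have c: "0 < c" using cube_size_pos by (simp add: c_def)
  have g: "0 \<le> ?g n" for n by (simp add: cube_gauge_def power_gauge_def)
  have le: "1 / num_words n \<le> c * ?g n" for n
  proof -
    have "1 \<le> exp growth_error * num_words n * exp (- (real n * growth))"
      using num_words_bounds(2)[of n] by (simp add: exp_minus field_simps)
    then have "1 / num_words n \<le> exp growth_error * exp (- (real n * growth))"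
      using num_words_ge_1[of n] by (simp add: field_simps)
    also have "\<dots> = exp growth_error * (2 ^ n) powr - cube_exponent"
      by (simp only: two_power_cube_exponent)
    also have "\<dots> \<le> exp growth_error * (2 ^ n) powr - \<gamma>"
      using \<gamma> by (intro mult_left_mono powr_mono) auto
    also have "\<dots> = c * ?g n"
      using cube_size_pos by (simp add: cube_gauge_power[OF \<gamma>(1)] c_def)
    finally show ?thesis .
  qed
  have "\<not> coverable ?g 0 seqs (1 / (2 * c))"
  proof
    assume cov: "coverable ?g 0 seqs (1 / (2 * c))"
    obtain K where K: "real (card {z \<in> prefixes K. \<forall>n. 0 \<le> n \<longrightarrow> n \<le> K \<longrightarrow> cube_mass n z \<le> c * ?g n})
        \<le> c * (1 / (2 * c)) * real (card D) ^ K"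
      using mass_distribution[OF cov less_imp_le[OF c] g] by blast
    have "{z \<in> prefixes K. \<forall>n. 0 \<le> n \<longrightarrow> n \<le> K \<longrightarrow> cube_mass n z \<le> c * ?g n} = prefixes K"
    proof -
      have "cube_mass n z \<le> c * ?g n" if "z \<in> prefixes K" "n \<le> K" for n z
        using uniform_cube_mass[OF u, of n z] prefixes_D[OF that(1)] that(2) le[of n] by simp
      then show ?thesis by blast
    qed
    then have "real (card D) ^ K \<le> c * (1 / (2 * c)) * real (card D) ^ K"
      using K by (simp add: card_prefixes)
    then show False using c card_D_pos by simp
  qed
  then show ?thesis
    by (rule hausdorff_measure_pos_of_not_coverable[OF power_gauge_gauge[OF \<gamma>(1)], rotated]) (simp add: c)
qed

lemma uniform_hausdorff_dim:
  assumes uniform_fibres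
  shows "hausdorff_dim (sponge m D) = ereal cube_exponent"
proof (rule antisym[OF hausdorff_dim_le])
  show "ereal cube_exponent \<le> hausdorff_dim (sponge m D)"
    unfolding hausdorff_dim_def
  proof (rule Inf_greatest)
    fix z assume "z \<in> {ereal \<gamma> |\<gamma>. 0 \<le> \<gamma> \<and> hausdorff_measure (power_gauge \<gamma>) (sponge m D) = 0}"
    then obtain \<gamma> where \<gamma>: "z = ereal \<gamma>" "0 \<le> \<gamma>" "hausdorff_measure (power_gauge \<gamma>) (sponge m D) = 0"
      by blast
    then have "\<not> \<gamma> \<le> cube_exponent" using uniform_hausdorff_measure_pos[OF assms \<gamma>(2)] by auto
    then show "ereal cube_exponent \<le> z" using \<gamma>(1) by simp
  qed
qed

lemma sum_fibre_card: "(\<Sum>c\<in>dproj J ` D. card {b \<in> D. dproj J b = c}) = card D"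
  using sum.image_gen[OF finite_D, of "\<lambda>_. 1::nat" "dproj J"] by simp

text \<open>The average of the fibre cardinalities over the image is \<open>card D / image_card J\<close>; if they are
  not all equal, then one exceeds it.\<close>

lemma ex_large_fibre:
  assumes "\<not> uniform_fibres"
  obtains t b where "t \<in> range theta" "b \<in> D"
    "card D < fibre_card {j. t \<le> theta j} b * image_card {j. t \<le> theta j}"
proof -
  obtain t a where t: "t \<in> range theta" "a \<in> D" "fibre_card {j. t \<le> theta j} a * image_card {j. t \<le> theta j} \<noteq> card D"
    using assms by (auto simp: uniform_fibres_def)
  let ?J = "{j. t \<le> theta j}"
  have "\<exists>b\<in>D. card D < fibre_card ?J b * image_card ?J"
  proof (rule ccontr)
    assume "\<not> ?thesis"
    then have le: "\<And>b. b \<in> D \<Longrightarrow> fibre_card ?J b * image_card ?J \<le> card D" by force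
    have "(\<Sum>c\<in>dproj ?J ` D. card {b \<in> D. dproj ?J b = c} * image_card ?J) < (\<Sum>c\<in>dproj ?J ` D. card D)"
    proof (rule sum_strict_mono_ex1)
      show "finite (dproj ?J ` D)" using finite_D by simp
      show "\<forall>c\<in>dproj ?J ` D. card {b \<in> D. dproj ?J b = c} * image_card ?J \<le> card D"
        using le by (auto simp: fibre_card_def)
      have "fibre_card ?J a * image_card ?J < card D" using le[OF t(2)] t(3) by simp
      then show "\<exists>c\<in>dproj ?J ` D. card {b \<in> D. dproj ?J b = c} * image_card ?J < card D"
        using t(2) by (auto simp: fibre_card_def)
    qed
    then show False
      by (simp add: sum_distrib_right[symmetric] sum_fibre_card image_card_def)
  qed
  then show ?thesis using that t(1) by blast
qed

section \<open>Typical approximate cubes\<close>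

text \<open>The Chernoff bound for independent, bounded, centred variables, written for counting. The digits of
  a uniformly distributed word are independent, so the exponential moment factorizes.\<close>

lemma few_atypical_words:
  assumes bd: "\<And>k a. \<bar>F k a\<bar> \<le> 1"
    and mean: "\<And>k. k < n \<Longrightarrow> (\<Sum>a\<in>dproj (vis n k) ` D. F k a) = 0"
    and \<eta>: "0 \<le> \<eta>" "\<eta> \<le> 2"
  shows "real (card {w \<in> word n ` seqs. \<eta> * real n \<le> (\<Sum>k<n. F k (w k))})
    \<le> num_words n * exp (- (\<eta>\<^sup>2 / 4 * real n))"
proof -
  let ?W = "word n ` seqs"
  let ?B = "{w \<in> ?W. \<eta> * real n \<le> (\<Sum>k<n. F k (w k))}"
  (* This value minimizes the exponent s\<^sup>2 - s * \<eta>. *)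
  define s where "s = \<eta> / 2"
  have s: "0 \<le> s" "s \<le> 1" using \<eta> by (auto simp: s_def)
  have "real (card ?B) = (\<Sum>w\<in>?B. 1)" by simp
  also have "\<dots> \<le> (\<Sum>w\<in>?B. exp (s * ((\<Sum>k<n. F k (w k)) - \<eta> * real n)))"
    using s by (intro sum_mono) simp
  also have "\<dots> \<le> (\<Sum>w\<in>?W. exp (s * ((\<Sum>k<n. F k (w k)) - \<eta> * real n)))"
    using finite_words by (intro sum_mono2) auto
  also have "\<dots> = (\<Sum>w\<in>?W. exp (- (s * \<eta> * real n)) * (\<Prod>k<n. exp (s * F k (w k))))"
    by (intro sum.cong refl)
      (simp add: right_diff_distrib exp_diff exp_minus divide_inverse sum_distrib_left exp_sum mult.assoc mult.commute)
  also have "\<dots> = exp (- (s * \<eta> * real n)) * (\<Prod>k<n. \<Sum>a\<in>dproj (vis n k) ` D. exp (s * F k a))"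
    using sum_words[where F = "\<lambda>k a. exp (s * F k a)" and n = n] by (simp add: sum_distrib_left[symmetric])
  also have "\<dots> \<le> exp (- (s * \<eta> * real n)) * (\<Prod>k<n. real (image_card (vis n k)) * exp (s\<^sup>2))"
  proof (intro mult_left_mono prod_mono conjI)
    fix k assume "k \<in> {..<n}"
    let ?A = "dproj (vis n k) ` D"
    show "0 \<le> (\<Sum>a\<in>?A. exp (s * F k a))" by (simp add: sum_nonneg)
    have "(\<Sum>a\<in>?A. exp (s * F k a)) \<le> (\<Sum>a\<in>?A. 1 + s\<^sup>2 + s * F k a)"
    proof (rule sum_mono)
      fix a
      have 1: "\<bar>s * F k a\<bar> \<le> s" using bd[of k a] s by (simp add: abs_mult mult_left_le)
      have "(s * F k a)\<^sup>2 \<le> s\<^sup>2" using 1 s abs_le_square_iff[of "s * F k a" s] by simp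
      then show "exp (s * F k a) \<le> 1 + s\<^sup>2 + s * F k a"
        using exp_le_quadratic[of "s * F k a"] 1 s by linarith
    qed
    also have "\<dots> = real (image_card (vis n k)) * (1 + s\<^sup>2) + s * (\<Sum>a\<in>?A. F k a)"
      by (simp add: sum.distrib image_card_def sum_distrib_left)
    also have "\<dots> = real (image_card (vis n k)) * (1 + s\<^sup>2)" using mean[of k] \<open>k \<in> {..<n}\<close> by simp
    also have "\<dots> \<le> real (image_card (vis n k)) * exp (s\<^sup>2)"
      by (intro mult_left_mono exp_ge_add_one_self) auto
    finally show "(\<Sum>a\<in>?A. exp (s * F k a)) \<le> real (image_card (vis n k)) * exp (s\<^sup>2)" .
  qed simp
  also have "\<dots> = num_words n * exp (- (s * \<eta> * real n) + real n * s\<^sup>2)"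
    unfolding exp_add exp_of_nat_mult by (simp add: prod.distrib num_words_eq)
  also have "- (s * \<eta> * real n) + real n * s\<^sup>2 = - (\<eta>\<^sup>2 / 4 * real n)"
    by (simp add: s_def power2_eq_square field_simps)
  finally show ?thesis .
qed

definition agrees :: "'n set \<Rightarrow> ('n \<Rightarrow> nat) \<Rightarrow> ('n \<Rightarrow> nat) \<Rightarrow> real" where
  "agrees J b a = (if dproj J a = dproj J b then 1 else 0)"

lemma agrees_dproj: "J \<subseteq> J' \<Longrightarrow> agrees J b (dproj J' a) = agrees J b a"
  by (simp add: agrees_def dproj_dproj Int_absorb2)

lemma sum_agrees: "(\<Sum>a\<in>D. agrees J b a) = real (fibre_card J b)"
  using finite_D by (simp add: agrees_def fibre_card_def sum.If_cases Int_def)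

lemma sum_agrees_image_card: "b \<in> D \<Longrightarrow> (\<Sum>a\<in>dproj J ` D. agrees J b a) = 1"
proof -
  assume b: "b \<in> D"
  have "(\<Sum>a\<in>dproj J ` D. agrees J b a) = (\<Sum>a\<in>dproj J ` D. if a = dproj J b then 1 else 0)"
    by (intro sum.cong) (auto simp: agrees_def dproj_dproj)
  then show ?thesis using b finite_D by (simp add: sum.delta)
qed

lemma vis_all:
  assumes "k < cutoff n (Min (range theta))"
  shows "vis n k = UNIV"
proof -
  have "k < cutoff n (theta j)" for j
    using assms cutoff_mono[of "Min (range theta)" "theta j" n] by simp
  then show ?thesis by (auto simp: vis_def depth_eq_cutoff)
qed

lemma vis_window:
  assumes "cutoff n s \<le> k" "k < cutoff n t" and gap: "\<And>j. theta j < t \<Longrightarrow> theta j \<le> s"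
  shows "vis n k = {j. t \<le> theta j}"
proof -
  have "k < cutoff n (theta j) \<longleftrightarrow> t \<le> theta j" for j
  proof
    assume "k < cutoff n (theta j)"
    show "t \<le> theta j"
    proof (rule ccontr)
      assume "\<not> t \<le> theta j"
      then have "cutoff n (theta j) \<le> cutoff n s" using gap by (intro cutoff_mono) auto
      then show False using \<open>k < cutoff n (theta j)\<close> assms(1) by simp
    qed
  next
    assume "t \<le> theta j"
    then show "k < cutoff n (theta j)" using cutoff_mono[of t "theta j" n] assms(2) by simp
  qed
  then show ?thesis by (auto simp: vis_def depth_eq_cutoff)
qed

text \<open>Since \<open>\<tau> \<le> 1\<close>, the cutoffs do not skip any position.\<close>

lemma cutoff_onto:
  assumes "0 < \<tau>" "\<tau> \<le> 1"
  obtains n where "cutoff n \<tau> = k" "k \<le> n" "real n \<le> real k / \<tau> + 1"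
proof -
  define n where "n = nat \<lceil>real k / \<tau>\<rceil>"
  have c: "0 \<le> real k / \<tau>" using assms by simp
  then have n: "real k / \<tau> \<le> real n" "real n < real k / \<tau> + 1"
    unfolding n_def by linarith+
  then have 1: "real k \<le> real n * \<tau>" "real n * \<tau> < real k + \<tau>"
    using assms by (simp_all add: field_simps)
  then have "cutoff n \<tau> = k" unfolding cutoff_def using assms(2) by linarith
  moreover have "real k * \<tau> \<le> real k" using assms by (intro mult_left_le) auto
  then have "real k \<le> real k / \<tau>" using assms(1) by (simp add: field_simps)
  then have "k \<le> n" using n(1) by linarith
  ultimately show ?thesis using that n(2) by simp
qed

text \<open>Let \<open>b\<close> have a fibre over \<open>J\<close> of more than average size, \<open>q\<close> the proportion of the fibre in \<open>D\<close> and
  \<open>r < q\<close> the proportion of its single image in the projection. The three functionals measure the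
  excess (\<open>F 0\<close>) and the deficit (\<open>F 1\<close>) of the frequency of the fibre against \<open>q\<close> among the
  positions where all coordinates are visible, and the excess against \<open>r\<close> (\<open>F 2\<close>) in the window where
  exactly \<open>J\<close> is visible. If all three stayed below \<open>\<eta> n\<close> from some level on, then the frequency in
  every long prefix would be about \<open>q\<close>, hence also in the window, which is a difference of two
  prefixes; there it is at most about \<open>r\<close>.\<close>

lemma atypical_infinitely_often:
  assumes "\<not> uniform_fibres"
  obtains \<eta> and F :: "nat \<Rightarrow> nat \<Rightarrow> nat \<Rightarrow> ('n \<Rightarrow> nat) \<Rightarrow> real" where "0 < \<eta>" "\<eta> \<le> 2"
    "\<And>i n k a. \<bar>F i n k a\<bar> \<le> 1"
    "\<And>i n k. k < n \<Longrightarrow> (\<Sum>a\<in>dproj (vis n k) ` D. F i n k a) = 0"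
    "\<And>x N. x \<in> seqs \<Longrightarrow> \<exists>n\<ge>N. \<exists>i<3. \<eta> * real n \<le> (\<Sum>k<n. F i n k (word n x k))"
proof -
  obtain t b where tb: "t \<in> range theta" "b \<in> D" "card D < fibre_card {j. t \<le> theta j} b * image_card {j. t \<le> theta j}"
    using ex_large_fibre[OF assms] by blast
  define J where "J = {j. t \<le> theta j}"
  define T where "T = {s \<in> range theta. s < t}"
  have "T \<noteq> {}"
  proof
    assume "T = {}"
    then have "J = UNIV" by (auto simp: T_def J_def not_less[symmetric])
    then show False using tb by (simp add: J_def[symmetric] fibre_card_UNIV)
  qed
  define s where "s = Max T"
  have "finite T" by (simp add: T_def)
  then have s: "s \<in> range theta" "s < t" "\<And>j. theta j < t \<Longrightarrow> theta j \<le> s"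
    using Max_in[OF \<open>finite T\<close> \<open>T \<noteq> {}\<close>] Max_ge[OF \<open>finite T\<close>] by (auto simp: T_def s_def)
  define \<tau> where "\<tau> = Min (range theta)"
  have "\<tau> \<in> range theta" unfolding \<tau>_def by (rule Min_in) auto
  then have \<tau>: "0 < \<tau>" "\<tau> \<le> 1" using theta_range by auto
  have st: "0 < s" "t \<le> 1" "0 < t" using theta_range tb(1) s(1) by auto
  define q where "q = real (fibre_card J b) / real (card D)"
  define r where "r = 1 / real (image_card J)"
  have q: "0 \<le> q" "q \<le> 1" using fibre_card_le[of J b] card_D_pos by (auto simp: q_def)
  have "1 \<le> real (image_card J)" using image_card_pos[of J] by (simp add: Suc_le_eq)
  then have r: "0 \<le> r" "r \<le> 1" by (auto simp: r_def)
  define \<rho> where "\<rho> = q - r"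
  have "real (card D) < real (fibre_card J b) * real (image_card J)"
    using tb(3) unfolding J_def of_nat_mult[symmetric] of_nat_less_iff .
  then have \<rho>: "0 < \<rho>" using image_card_pos[of J] card_D_pos by (simp add: \<rho>_def q_def r_def field_simps)
  (* The window has about n * (t - s) positions, where the frequency exceeds r by \<rho>. The errors are
     \<eta> * n from F 2 and \<eta> * (n / \<tau> + 1) for each of the two prefixes. *)
  define \<eta> where "\<eta> = \<rho> * (t - s) / (2 * (1 + 2 / \<tau>))"
  have \<eta>: "0 < \<eta>" using \<rho> s(2) \<tau>(1) by (simp add: \<eta>_def add_pos_pos)
  have \<eta>eq: "\<eta> * (1 + 2 / \<tau>) = \<rho> * (t - s) / 2"
  proof -
    have "1 + 2 / \<tau> \<noteq> 0" using \<tau>(1) by (simp add: add_pos_pos less_imp_neq[symmetric])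
    moreover have "y / (2 * d) * d = y / 2" if "d \<noteq> 0" for y d :: real using that by simp
    ultimately show ?thesis unfolding \<eta>_def by blast
  qed
  have "\<eta> \<le> \<eta> * (1 + 2 / \<tau>)" using \<eta> \<tau>(1) by simp
  moreover have "\<rho> * (t - s) \<le> 1 * 1"
    using \<rho> q r s(2) st by (intro mult_mono) (auto simp: \<rho>_def)
  ultimately have \<eta>2: "\<eta> \<le> 2" using \<eta>eq by simp
  define f where "f = agrees J b"
  have f: "0 \<le> f a" "f a \<le> 1" for a by (auto simp: f_def agrees_def)
  define F where "F i n k a =
      (if i = 2 then (if cutoff n s \<le> k \<and> k < cutoff n t then f a - r else 0)
       else if k < cutoff n \<tau> then (if i = 0 then f a - q else q - f a) else 0)" for i n k :: nat and a
  have F0: "F 0 n k a = (if k < cutoff n \<tau> then f a - q else 0)"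
    and F1: "F (Suc 0) n k a = (if k < cutoff n \<tau> then q - f a else 0)"
    and F2: "F 2 n k a = (if cutoff n s \<le> k \<and> k < cutoff n t then f a - r else 0)" for n k a
    by (auto simp: F_def)
  have bd: "\<bar>F i n k a\<bar> \<le> 1" for i n k a
    using f[of a] q r by (auto simp: F_def abs_le_iff)
  have mean: "(\<Sum>a\<in>dproj (vis n k) ` D. F i n k a) = 0" if "k < n" for i n k
  proof (cases "i = 2")
    case True
    have "(\<Sum>a\<in>dproj J ` D. f a - r) = 0"
      using sum_agrees_image_card[OF tb(2), of J] image_card_pos[of J] by (simp add: f_def sum_subtractf r_def image_card_def)
    moreover have "vis n k = J" if "cutoff n s \<le> k" "k < cutoff n t"
      unfolding J_def by (rule vis_window[OF that s(3)])
    moreover have "F i n k a = (if cutoff n s \<le> k \<and> k < cutoff n t then f a - r else 0)" for a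
      using True by (simp add: F_def)
    ultimately show ?thesis by (cases "cutoff n s \<le> k \<and> k < cutoff n t") simp_all
  next
    case False
    have "(\<Sum>a\<in>D. f a - q) = 0"
      using card_D_pos by (simp add: f_def sum_subtractf sum_agrees q_def)
    moreover from this have "(\<Sum>a\<in>D. q - f a) = 0" by (simp add: sum_subtractf)
    moreover have "vis n k = UNIV" if "k < cutoff n \<tau>"
      using vis_all that by (simp add: \<tau>_def)
    ultimately show ?thesis
      using False by (cases "k < cutoff n \<tau>"; cases "i = 0") (simp_all add: F_def)
  qed
  have often: "\<exists>n\<ge>N. \<exists>i<3. \<eta> * real n \<le> (\<Sum>k<n. F i n k (word n x k))" if x: "x \<in> seqs" for x N
  proof (rule ccontr)
    assume "\<not> ?thesis"
    then have no: "(\<Sum>k<n. F i n k (word n x k)) < \<eta> * real n" if "N \<le> n" "i < 3" for n i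
      using that by (meson not_le)
    define S where "S k = (\<Sum>i<k. f (x i) - q)" for k
    have sumF: "(\<Sum>k<n. if k < cutoff n \<tau> then h (word n x k) else 0) = (\<Sum>k<cutoff n \<tau>. h (x k))" for n and h :: "_ \<Rightarrow> real"
    proof -
      have "cutoff n \<tau> \<le> n" using cutoff_le \<open>\<tau> \<in> range theta\<close> by blast
      then have "{..<n} \<inter> {k. k < cutoff n \<tau>} = {..<cutoff n \<tau>}" by auto
      then have "(\<Sum>k<n. if k < cutoff n \<tau> then h (word n x k) else 0) = (\<Sum>k<cutoff n \<tau>. h (word n x k))"
        by (simp add: sum.If_cases)
      also have "\<dots> = (\<Sum>k<cutoff n \<tau>. h (x k))"
        using vis_all by (intro sum.cong) (auto simp: word_def \<tau>_def)
      finally show ?thesis .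
    qed
    have S_cutoff: "\<bar>S (cutoff n \<tau>)\<bar> < \<eta> * real n" if "N \<le> n" for n
    proof -
      have "S (cutoff n \<tau>) = (\<Sum>k<n. F 0 n k (word n x k))"
        using sumF[of n "\<lambda>a. f a - q"] by (simp add: F0 S_def)
      moreover have "- S (cutoff n \<tau>) = (\<Sum>k<n. F 1 n k (word n x k))"
        using sumF[of n "\<lambda>a. q - f a"] by (simp add: F1 S_def sum_negf[symmetric])
      ultimately show ?thesis using no[OF that, of 0] no[OF that, of 1] by linarith
    qed
    have S_bd: "\<bar>S k\<bar> \<le> \<eta> * (real k / \<tau> + 1)" if "N \<le> k" for k
    proof -
      obtain n where n: "cutoff n \<tau> = k" "k \<le> n" "real n \<le> real k / \<tau> + 1"
        using cutoff_onto[OF \<tau>] by blast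
      have "\<bar>S k\<bar> \<le> \<eta> * real n" using S_cutoff[of n] n that by simp
      also have "\<dots> \<le> \<eta> * (real k / \<tau> + 1)" using n(3) \<eta> by (intro mult_left_mono) auto
      finally show ?thesis .
    qed
    (* Large enough for the lower end of the window to lie beyond N and for the linear terms to
       dominate the rounding errors \<rho> + 2 * \<eta>. *)
    obtain n where n: "real N + 1 + (\<rho> + 2 * \<eta>) * 2 / (\<rho> * (t - s)) < real n * s"
      using reals_Archimedean3[OF st(1)] by blast
    have pos: "0 \<le> (\<rho> + 2 * \<eta>) * 2 / (\<rho> * (t - s))" using \<rho> \<eta> s(2) by simp
    have cutoff_s: "N \<le> cutoff n s" using n pos cutoff_bounds(2)[of s n] st(1) by simp
    have cutoff_st: "cutoff n s \<le> cutoff n t" using s(2) by (intro cutoff_mono) auto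
    have cutoff_tn: "cutoff n t \<le> n" using cutoff_le tb(1) by blast
    have Nn: "N \<le> n" using cutoff_s cutoff_st cutoff_tn by simp
    have "(\<Sum>k<n. F 2 n k (word n x k)) = (\<Sum>k\<in>{cutoff n s..<cutoff n t}. f (x k) - r)"
    proof -
      have "{..<n} \<inter> {k. cutoff n s \<le> k \<and> k < cutoff n t} = {cutoff n s..<cutoff n t}" using cutoff_tn by auto
      then have "(\<Sum>k<n. F 2 n k (word n x k)) = (\<Sum>k\<in>{cutoff n s..<cutoff n t}. f (word n x k) - r)"
        by (simp add: F2 sum.If_cases)
      also have "\<dots> = (\<Sum>k\<in>{cutoff n s..<cutoff n t}. f (x k) - r)"
      proof (rule sum.cong[OF refl])
        fix k assume "k \<in> {cutoff n s..<cutoff n t}"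
        then have "vis n k = J" unfolding J_def by (intro vis_window[OF _ _ s(3)]) auto
        then show "f (word n x k) - r = f (x k) - r"
          by (simp add: word_def f_def agrees_dproj)
      qed
      finally show ?thesis .
    qed
    also have "\<dots> = (\<Sum>k\<in>{cutoff n s..<cutoff n t}. f (x k) - q) + \<rho> * real (cutoff n t - cutoff n s)"
      by (simp add: sum_subtractf \<rho>_def algebra_simps)
    also have "(\<Sum>k\<in>{cutoff n s..<cutoff n t}. f (x k) - q) = S (cutoff n t) - S (cutoff n s)"
      unfolding S_def lessThan_atLeast0 by (rule sum_diff_nat_ivl[symmetric]) (use cutoff_st in auto)
    finally have "S (cutoff n t) - S (cutoff n s) + \<rho> * real (cutoff n t - cutoff n s) < \<eta> * real n"
      using no[OF Nn, of 2] by simp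
    moreover have "\<bar>S k\<bar> \<le> \<eta> * (real n / \<tau> + 1)" if "N \<le> k" "k \<le> n" for k
    proof -
      have "\<eta> * (real k / \<tau> + 1) \<le> \<eta> * (real n / \<tau> + 1)"
        using \<eta> \<tau>(1) that by (intro mult_left_mono add_right_mono divide_right_mono) auto
      then show ?thesis using S_bd[OF that(1)] by linarith
    qed
    then have "\<bar>S (cutoff n t)\<bar> \<le> \<eta> * (real n / \<tau> + 1)" "\<bar>S (cutoff n s)\<bar> \<le> \<eta> * (real n / \<tau> + 1)"
      using cutoff_s cutoff_st cutoff_tn by auto
    moreover have "\<rho> * (real n * (t - s) - 1) \<le> \<rho> * real (cutoff n t - cutoff n s)"
    proof (rule mult_left_mono)
      have "real n * (t - s) = real n * t - real n * s" by (simp add: right_diff_distrib)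
      then show "real n * (t - s) - 1 \<le> real (cutoff n t - cutoff n s)"
        using cutoff_bounds(2)[of t n] cutoff_bounds(1)[of s n] st cutoff_st by (simp add: of_nat_diff)
    qed (use \<rho> in simp)
    ultimately have "\<rho> * (real n * (t - s) - 1) < \<eta> * real n + 2 * (\<eta> * (real n / \<tau> + 1))"
      by linarith
    also have "\<dots> = real n * (\<eta> * (1 + 2 / \<tau>)) + 2 * \<eta>" by (simp add: algebra_simps)
    finally have "\<rho> * (real n * (t - s) - 1) < real n * (\<rho> * (t - s) / 2) + 2 * \<eta>"
      unfolding \<eta>eq .
    moreover have "\<rho> * (real n * (t - s) - 1) = real n * (\<rho> * (t - s)) - \<rho>"
      by (simp add: algebra_simps)
    ultimately have "real n * (\<rho> * (t - s)) / 2 < \<rho> + 2 * \<eta>" by simp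
    moreover have "(\<rho> + 2 * \<eta>) * 2 / (\<rho> * (t - s)) \<le> real n"
    proof -
      have "real n * s \<le> real n * 1" using st s(2) by (intro mult_left_mono) auto
      then show ?thesis using n by simp
    qed
    then have "(\<rho> + 2 * \<eta>) * 2 \<le> real n * (\<rho> * (t - s))"
      using \<rho> s(2) by (simp add: pos_divide_le_eq)
    ultimately show False by simp
  qed
  show ?thesis using that[OF \<eta> \<eta>2 bd mean often] .
qed

lemma sum_geometric_tail_le:
  assumes "0 \<le> r" "r < 1" "finite S" "\<And>n. n \<in> S \<Longrightarrow> N \<le> n"
  shows "(\<Sum>n\<in>S. r ^ n) \<le> r ^ N / (1 - r :: real)"
proof -
  have inj: "inj_on (\<lambda>n. n - N) S" using assms(4) by (intro inj_onI) (metis le_add_diff_inverse)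
  have "(\<Sum>n\<in>S. r ^ n) = (\<Sum>n\<in>S. r ^ N * r ^ (n - N))"
    using assms(4) by (intro sum.cong refl) (simp flip: power_add)
  also have "\<dots> = r ^ N * (\<Sum>k\<in>(\<lambda>n. n - N) ` S. r ^ k)"
    by (simp add: sum.reindex[OF inj] sum_distrib_left)
  also have "\<dots> \<le> r ^ N * (\<Sum>k. r ^ k)"
    using assms by (intro mult_left_mono sum_le_suminf summable_geometric) auto
  also have "\<dots> = r ^ N / (1 - r)" using assms by (simp add: suminf_geometric)
  finally show ?thesis .
qed

text \<open>The atypical cubes cover, and there are fewer of them by a factor \<open>exp (- c n)\<close>. So the cost of the
  cover still tends to \<open>0\<close> after the exponent is lowered by \<open>c / (2 ln 2)\<close>.\<close>

lemma nonuniform_hausdorff_dim_less: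
  assumes "\<not> uniform_fibres"
  shows "hausdorff_dim (sponge m D) < ereal cube_exponent"
proof -
  obtain \<eta> F where F: "0 < \<eta>" "\<eta> \<le> 2"
    "\<And>i n k a. \<bar>F i n k a\<bar> \<le> (1::real)"
    "\<And>i n k. k < n \<Longrightarrow> (\<Sum>a\<in>dproj (vis n k) ` D. F i n k a) = 0"
    "\<And>x N. x \<in> seqs \<Longrightarrow> \<exists>n\<ge>N. \<exists>i<3::nat. \<eta> * real n \<le> (\<Sum>k<n. F i n k (word n x k))"
    by (rule atypical_infinitely_often[OF assms]) blast
  define c where "c = \<eta>\<^sup>2 / 4"
  have c: "0 < c" using F(1) by (simp add: c_def)
  define B where "B n = (\<Union>i<3. {w \<in> word n ` seqs. \<eta> * real n \<le> (\<Sum>k<n. F i n k (w k))})" for n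
  have finB: "finite (B n)" for n
    unfolding B_def using finite_words by auto
  have cardB: "real (card (B n)) \<le> 3 * exp growth_error * exp (real n * growth - c * real n)" for n
  proof -
    have "card (B n) \<le> (\<Sum>i<3. card {w \<in> word n ` seqs. \<eta> * real n \<le> (\<Sum>k<n. F i n k (w k))})"
      unfolding B_def by (rule card_UN_le) simp
    then have "real (card (B n)) \<le> (\<Sum>i<3. real (card {w \<in> word n ` seqs. \<eta> * real n \<le> (\<Sum>k<n. F i n k (w k))}))"
      unfolding of_nat_sum[symmetric] of_nat_le_iff .
    also have "\<dots> \<le> (\<Sum>i<3::nat. num_words n * exp (- (c * real n)))"
      unfolding c_def using F(1,2) by (intro sum_mono few_atypical_words F(3,4)) auto
    also have "\<dots> = 3 * (num_words n * exp (- (c * real n)))" by simp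
    also have "\<dots> \<le> 3 * ((exp growth_error * exp (real n * growth)) * exp (- (c * real n)))"
      by (intro mult_left_mono mult_right_mono num_words_bounds) auto
    also have "\<dots> = 3 * exp growth_error * exp (real n * growth - c * real n)"
      by (simp add: exp_diff exp_minus divide_inverse)
    finally show ?thesis .
  qed
  have often: "\<exists>n\<ge>N. word n x \<in> B n" if "x \<in> seqs" for x N
    using F(5)[OF that, of N] that unfolding B_def by blast
  (* Atypical cubes exist at arbitrarily high levels, so their bound exp (n * (growth - c)) cannot
     tend to 0. This keeps the exponent \<gamma> below nonnegative. *)
  have growth: "c \<le> growth"
  proof (rule ccontr)
    assume "\<not> c \<le> growth"
    then have d: "0 < c - growth" by simp
    obtain N where N: "ln 3 + growth_error < real N * (c - growth)"
      using reals_Archimedean3[OF d] by blast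
    obtain x n where "x \<in> seqs" "n \<ge> N" "word n x \<in> B n"
      using seqs_nonempty often by blast
    then have "1 \<le> card (B n)" using finB[of n] by (auto simp: Suc_le_eq card_gt_0_iff)
    then have "1 \<le> 3 * exp growth_error * exp (real n * growth - c * real n)"
      using cardB[of n] by linarith
    also have "\<dots> = exp (ln 3 + growth_error + (real n * growth - c * real n))"
      by (simp add: exp_add)
    finally have "0 \<le> ln 3 + growth_error + (real n * growth - c * real n)" by simp
    moreover have "real N * (c - growth) \<le> real n * (c - growth)"
      using \<open>n \<ge> N\<close> d by (intro mult_right_mono) auto
    ultimately show False using N by (simp add: algebra_simps)
  qed
  define \<gamma> where "\<gamma> = cube_exponent - c / (2 * ln 2)"
  have \<gamma>: "0 \<le> \<gamma>" "\<gamma> < cube_exponent"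
    using c growth by (auto simp: \<gamma>_def cube_exponent_def field_simps)
  let ?g = "cube_gauge (power_gauge \<gamma>)"
  have g: "0 \<le> ?g n" for n by (simp add: cube_gauge_def power_gauge_def)
  define A where "A = 3 * exp growth_error * cube_size powr \<gamma>"
  define r where "r = exp (- (c / 2))"
  have r: "0 \<le> r" "r < 1" using c by (auto simp: r_def)
  have A: "0 \<le> A" by (simp add: A_def)
  have cost: "real (card (B n)) * ?g n \<le> A * r ^ n" for n
  proof -
    have "(2 ^ n) powr - \<gamma> = exp (- (real n * growth) + c / 2 * real n)"
      by (simp add: powr_def ln_realpow \<gamma>_def cube_exponent_def field_simps)
    then have "real (card (B n)) * ?g n
       \<le> (3 * exp growth_error * exp (real n * growth - c * real n)) * (cube_size powr \<gamma> * exp (- (real n * growth) + c / 2 * real n))"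
      unfolding cube_gauge_power[OF \<gamma>(1)] using cardB by (intro mult_mono) auto
    also have "\<dots> = A * exp ((real n * growth - c * real n) + (- (real n * growth) + c / 2 * real n))"
      unfolding exp_add A_def by simp
    also have "(real n * growth - c * real n) + (- (real n * growth) + c / 2 * real n) = real n * (- (c / 2))"
      by (simp add: algebra_simps)
    also have "exp \<dots> = r ^ n" unfolding r_def by (rule exp_of_nat_mult)
    finally show ?thesis .
  qed
  have cov: "coverable ?g N seqs (A * (r ^ N / (1 - r)))" for N
  proof -
    define C where "C = (\<Union>n\<in>{N..}. {n} \<times> B n)"
    have "\<exists>n. (n, word n x) \<in> C" if "x \<in> seqs" for x
      using often[OF that, of N] by (auto simp: C_def)
    then obtain C' where C': "finite C'" "C' \<subseteq> C" "\<And>x. x \<in> seqs \<Longrightarrow> \<exists>n. (n, word n x) \<in> C'"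
      using finite_subcover[of C] by blast
    have "(\<Sum>p\<in>C'. ?g (fst p)) = (\<Sum>n\<in>fst ` C'. \<Sum>p | p \<in> C' \<and> fst p = n. ?g (fst p))"
      by (rule sum.image_gen[OF C'(1)])
    also have "\<dots> \<le> (\<Sum>n\<in>fst ` C'. A * r ^ n)"
    proof (rule sum_mono)
      fix n assume "n \<in> fst ` C'"
      have sub: "{p \<in> C'. fst p = n} \<subseteq> {n} \<times> B n" using C'(2) by (auto simp: C_def)
      have "(\<Sum>p | p \<in> C' \<and> fst p = n. ?g (fst p)) = real (card {p \<in> C'. fst p = n}) * ?g n" by simp
      also have "\<dots> \<le> real (card (B n)) * ?g n"
        using card_mono[OF _ sub] finB[of n] g[of n]
        by (intro mult_right_mono) (auto simp: card_cartesian_product)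
      also have "\<dots> \<le> A * r ^ n" by (rule cost)
      finally show "(\<Sum>p | p \<in> C' \<and> fst p = n. ?g (fst p)) \<le> A * r ^ n" .
    qed
    also have "\<dots> = A * (\<Sum>n\<in>fst ` C'. r ^ n)" by (simp add: sum_distrib_left)
    also have "\<dots> \<le> A * (r ^ N / (1 - r))"
      using C' r A by (intro mult_left_mono sum_geometric_tail_le) (auto simp: C_def)
    finally show ?thesis unfolding coverable_def using C'
      by (intro exI[of _ C'] conjI) (auto simp: C_def)
  qed
  have "hausdorff_measure (power_gauge \<gamma>) (sponge m D) = 0"
  proof (rule power_hausdorff_measure_zeroI[OF \<gamma>(1)])
    fix N and s :: real assume "0 < s"
    have "(\<lambda>N. A * (r ^ N / (1 - r))) \<longlonglongrightarrow> A * (0 / (1 - r))"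
      using r by (intro tendsto_intros LIMSEQ_power_zero) auto
    then have "\<forall>\<^sub>F N in sequentially. A * (r ^ N / (1 - r)) < s"
      using \<open>0 < s\<close> by (intro order_tendstoD(2)) auto
    then have "\<forall>\<^sub>F M in sequentially. N \<le> M \<and> A * (r ^ M / (1 - r)) < s"
      using eventually_ge_at_top by (rule eventually_conj[rotated])
    then obtain M where "N \<le> M" "A * (r ^ M / (1 - r)) < s"
      using eventually_happens by force
    then show "coverable ?g N seqs s"
      using coverable_mono[OF cov[of M], of N seqs s] by simp
  qed
  then have "hausdorff_dim (sponge m D) \<le> ereal \<gamma>"
    unfolding hausdorff_dim_def using \<gamma>(1) by (intro Inf_lower) blast
  also have "\<dots> < ereal cube_exponent" using \<gamma>(2) by simp
  finally show ?thesis .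
qed

section \<open>Finite positive measures are uniform\<close>

text \<open>A cover of everything by sufficiently small cubes splits into covers of the cylinders of length
  \<open>K\<close>. The cheapest of these costs at most the average, and replacing prefixes copies it to every
  other cylinder. So sets of prefixes can be covered at a cost proportional to their mass.\<close>

lemma coverable_prefix_set:
  assumes deep: "\<And>n k. N \<le> n \<Longrightarrow> k < K \<Longrightarrow> vis n k = UNIV" and g: "\<And>n. 0 \<le> g n"
    and cov: "coverable g N seqs s" and F: "F \<subseteq> prefixes K"
  shows "coverable g N {x \<in> seqs. restrict x {..<K} \<in> F} (real (card F) / real (card D) ^ K * s)"
proof -
  obtain C where C: "finite C" "\<forall>p\<in>C. N \<le> fst p" "\<forall>x\<in>seqs. \<exists>n. (n, word n x) \<in> C"
      "(\<Sum>p\<in>C. g (fst p)) \<le> s"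
    using cov unfolding coverable_def by blast
  define Cv where "Cv v = {p \<in> C. \<forall>k<K. snd p k = v k}" for v
  define c where "c v = (\<Sum>p\<in>Cv v. g (fst p))" for v
  have finCv: "finite (Cv v)" for v using C(1) by (simp add: Cv_def)
  have "(\<Sum>v\<in>prefixes K. c v) = (\<Sum>p\<in>(\<Union>v\<in>prefixes K. Cv v). g (fst p))"
    unfolding c_def
  proof (rule sum.UNION_disjoint[symmetric])
    show "\<forall>v\<in>prefixes K. \<forall>v'\<in>prefixes K. v \<noteq> v' \<longrightarrow> Cv v \<inter> Cv v' = {}"
    proof (intro ballI impI)
      fix v v' assume v: "v \<in> prefixes K" "v' \<in> prefixes K" "v \<noteq> v'"
      have False if "p \<in> Cv v" "p \<in> Cv v'" for p
      proof -
        have "v k = v' k" if "k \<in> {..<K}" for k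
          using \<open>p \<in> Cv v\<close> \<open>p \<in> Cv v'\<close> that by (auto simp: Cv_def)
        then have "v = v'" using v unfolding prefixes_def by (intro PiE_ext) auto
        then show False using v(3) by simp
      qed
      then show "Cv v \<inter> Cv v' = {}" by blast
    qed
  qed (use finite_prefixes finCv in auto)
  also have "\<dots> \<le> (\<Sum>p\<in>C. g (fst p))"
    using C(1) g by (intro sum_mono2) (auto simp: Cv_def)
  finally have sumc: "(\<Sum>v\<in>prefixes K. c v) \<le> s" using C(4) by simp
  have ne: "prefixes K \<noteq> {}" using D_nonempty by (auto simp: prefixes_def PiE_eq_empty_iff)
  have "Min (c ` prefixes K) \<in> c ` prefixes K"
    using finite_prefixes ne by (intro Min_in) auto
  then obtain v0 where v0: "v0 \<in> prefixes K" "c v0 = Min (c ` prefixes K)" by force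
  have "real (card (prefixes K)) * c v0 \<le> (\<Sum>v\<in>prefixes K. c v)"
    unfolding v0(2) using finite_prefixes by (intro sum_bounded_below) simp
  then have "c v0 * real (card D) ^ K \<le> s"
    using sumc by (simp add: card_prefixes mult.commute)
  then have cv0: "c v0 \<le> s / real (card D) ^ K"
    using card_D_pos by (simp add: pos_le_divide_eq)
  define h where "h wp = (fst (snd wp), \<lambda>k. if k < K then fst wp k else snd (snd wp) k)"
    for wp :: "(nat \<Rightarrow> 'n \<Rightarrow> nat) \<times> nat \<times> (nat \<Rightarrow> 'n \<Rightarrow> nat)"
  let ?C = "h ` (F \<times> Cv v0)"
  have finF: "finite F" using F finite_prefixes finite_subset by blast
  have fin: "finite (F \<times> Cv v0)" using finF finCv by simp
  have "(\<Sum>p\<in>?C. g (fst p)) \<le> (\<Sum>wp\<in>F \<times> Cv v0. g (fst (h wp)))"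
    using sum_image_le[OF fin, of "\<lambda>p. g (fst p)" h] g by (simp add: o_def)
  also have "\<dots> = (\<Sum>w\<in>F. \<Sum>p\<in>Cv v0. g (fst p))"
    unfolding sum.cartesian_product h_def by (simp add: case_prod_unfold)
  also have "\<dots> = real (card F) * c v0" by (simp add: c_def)
  also have "\<dots> \<le> real (card F) * (s / real (card D) ^ K)"
    using cv0 by (intro mult_left_mono) auto
  finally have cost: "(\<Sum>p\<in>?C. g (fst p)) \<le> real (card F) / real (card D) ^ K * s" by simp
  show ?thesis
    unfolding coverable_def
  proof (intro exI[of _ ?C] conjI ballI)
    show "finite ?C" using fin by simp
    show "N \<le> fst p" if "p \<in> ?C" for p using that C(2) by (auto simp: h_def Cv_def)
    show "(\<Sum>p\<in>?C. g (fst p)) \<le> real (card F) / real (card D) ^ K * s" by (rule cost)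
    fix x assume x: "x \<in> {x \<in> seqs. restrict x {..<K} \<in> F}"
    define y where "y k = (if k < K then v0 k else x k)" for k
    have "y \<in> seqs" using x prefixes_D[OF v0(1)] by (auto simp: seqs_def y_def)
    then obtain n where n: "(n, word n y) \<in> C" using C(3) by blast
    then have vis: "vis n k = UNIV" if "k < K" for k using deep C(2) that by force
    then have "(n, word n y) \<in> Cv v0" using n by (simp add: Cv_def word_def y_def)
    then have "h (restrict x {..<K}, n, word n y) \<in> ?C" using x by blast
    moreover have "h (restrict x {..<K}, n, word n y) = (n, word n x)"
    proof -
      have "(if k < K then restrict x {..<K} k else word n y k) = word n x k" for k
        using vis[of k] by (simp add: word_def y_def)
      moreover have "h (w, n, v) = (n, \<lambda>k. if k < K then w k else v k)" for w v
        by (simp only: h_def fst_conv snd_conv)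
      ultimately show ?thesis by simp
    qed
    ultimately show "\<exists>n. (n, word n x) \<in> ?C" by metis
  qed
qed

text \<open>Each point is covered by its first cube that is heavy in comparison to its cost. By minimality
  these cubes are disjoint, so their total mass is at most \<open>1\<close>.\<close>

lemma large_mass_coverable:
  assumes "0 < A" and g: "\<And>n. 0 \<le> g n"
  shows "coverable g N {x \<in> seqs. \<exists>n. N \<le> n \<and> n \<le> K \<and> A * g n < cube_mass n x} (1 / A)"
proof -
  let ?V = "{x \<in> seqs. \<exists>n. N \<le> n \<and> n \<le> K \<and> A * g n < cube_mass n x}"
  let ?P = "\<lambda>x n. N \<le> n \<and> n \<le> K \<and> A * g n < cube_mass n x"
  define l where "l x = (LEAST n. ?P x n)" for x
  have l: "?P x (l x)" if "x \<in> ?V" for x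
    using that unfolding l_def by (intro LeastI_ex[of "?P x"]) blast
  have l_le: "l x \<le> n" if "?P x n" for x n unfolding l_def using that by (rule Least_le)
  define C where "C = (\<lambda>x. (l x, word (l x) x)) ` ?V"
  have "C \<subseteq> (\<Union>n\<le>K. {n} \<times> word n ` seqs)" using l by (auto simp: C_def)
  then have finC: "finite C" by (rule finite_subset) (auto intro: finite_words)
  let ?Q = "\<lambda>p. {z \<in> prefixes K. word (fst p) z = snd p}"
  have same: "p = p'" if p: "p \<in> C" "p' \<in> C" and le: "fst p \<le> fst p'" and z: "z \<in> ?Q p" "z \<in> ?Q p'" for p p' z
  proof -
    obtain x y where xy: "x \<in> ?V" "p = (l x, word (l x) x)" "y \<in> ?V" "p' = (l y, word (l y) y)"
      using p unfolding C_def by blast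
    have zx: "word (l x) z = word (l x) x" using z(1) unfolding xy(2) by simp
    have zy: "word (l y) z = word (l y) y" using z(2) unfolding xy(4) by simp
    have lxy: "l x \<le> l y" using le unfolding xy(2,4) by simp
    have w: "word (l x) y = word (l x) x"
      using word_eq_mono[OF zy lxy] zx by metis
    then have "cube_mass (l x) y = cube_mass (l x) x"
      using cube_mass_word[of "l x" x] cube_mass_word[of "l x" y] by simp
    then have "l y \<le> l x" using l[OF xy(1)] by (intro l_le) presburger
    then have "l y = l x" using lxy by simp
    then show "p = p'" using xy(2,4) w by simp
  qed
  have "(\<Sum>p\<in>C. card (?Q p)) = card (\<Union>p\<in>C. ?Q p)"
  proof (rule card_UN_disjoint[symmetric])
    show "\<forall>p\<in>C. \<forall>p'\<in>C. p \<noteq> p' \<longrightarrow> ?Q p \<inter> ?Q p' = {}"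
    proof (intro ballI impI)
      fix p p' assume p: "p \<in> C" "p' \<in> C" "p \<noteq> p'"
      have False if "z \<in> ?Q p" "z \<in> ?Q p'" for z
        using same[OF p(1,2) _ that] same[OF p(2,1) _ that(2,1)] p(3)
          linear[of "fst p" "fst p'"] by blast
      then show "?Q p \<inter> ?Q p' = {}" by blast
    qed
  qed (use finC finite_prefixes in auto)
  also have "\<dots> \<le> card (prefixes K)" using finite_prefixes by (intro card_mono) auto
  finally have "real (\<Sum>p\<in>C. card (?Q p)) \<le> real (card D) ^ K"
    unfolding card_prefixes of_nat_power[symmetric] of_nat_le_iff .
  then have "(\<Sum>p\<in>C. real (card (?Q p))) \<le> real (card D) ^ K" by simp
  also have "(\<Sum>p\<in>C. real (card (?Q p))) = (\<Sum>p\<in>C. cube_mass (fst p) (snd p) * real (card D) ^ K)"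
  proof (rule sum.cong[OF refl])
    fix p assume "p \<in> C"
    then obtain x where x: "x \<in> ?V" "p = (l x, word (l x) x)" unfolding C_def by blast
    then show "real (card (?Q p)) = cube_mass (fst p) (snd p) * real (card D) ^ K"
      using card_prefix_class[of "l x" K x] l[OF x(1)] by (simp add: cube_mass_word)
  qed
  also have "\<dots> = (\<Sum>p\<in>C. cube_mass (fst p) (snd p)) * real (card D) ^ K" by (simp add: sum_distrib_right)
  finally have mass: "(\<Sum>p\<in>C. cube_mass (fst p) (snd p)) \<le> 1" using card_D_pos by simp
  have "A * (\<Sum>p\<in>C. g (fst p)) = (\<Sum>p\<in>C. A * g (fst p))" by (simp add: sum_distrib_left)
  also have "\<dots> \<le> (\<Sum>p\<in>C. cube_mass (fst p) (snd p))"
  proof (rule sum_mono)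
    fix p assume "p \<in> C"
    then obtain x where x: "x \<in> ?V" "p = (l x, word (l x) x)" unfolding C_def by blast
    then show "A * g (fst p) \<le> cube_mass (fst p) (snd p)" using l[OF x(1)] by (simp add: cube_mass_word)
  qed
  finally have "A * (\<Sum>p\<in>C. g (fst p)) \<le> 1" using mass by simp
  then have "(\<Sum>p\<in>C. g (fst p)) \<le> 1 / A" using \<open>0 < A\<close> by (simp add: pos_le_divide_eq mult.commute)
  then show ?thesis
    unfolding coverable_def
  proof (intro exI[of _ C] conjI ballI)
    show "N \<le> fst p" if "p \<in> C" for p
    proof -
      obtain x where x: "x \<in> ?V" "p = (l x, word (l x) x)" using \<open>p \<in> C\<close> unfolding C_def by blast
      then show ?thesis using l[OF x(1)] by simp
    qed
    show "\<exists>n. (n, word n x) \<in> C" if "x \<in> ?V" for x using that unfolding C_def by blast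
  qed (use finC in auto)
qed

text \<open>If heavy cubes filled a proportion \<open>v\<close> of the mass, then they could be covered almost for free and
  the rest at the fraction \<open>1 - v\<close> of the cost; this would beat the least cost of a cover of
  everything, which is positive and finite by assumption.\<close>

lemma rare_large_mass:
  assumes g: "\<And>n. 0 \<le> g n" and fin: "\<And>N. coverable g N seqs S"
    and pos: "0 < \<eta>" "\<not> coverable g N1 seqs \<eta>" and \<delta>: "0 < \<delta>" "\<delta> < 1"
  obtains M0 where "\<And>M K. M0 \<le> M \<Longrightarrow>
    real (card {z \<in> prefixes K. \<exists>n. M \<le> n \<and> n \<le> K \<and> real M * g n < cube_mass n z}) \<le> \<delta> * real (card D) ^ K"
proof -
  (* The infimum c of A is a symbolic Hausdorff measure of the whole space. *)
  define A where "A = {s. \<forall>N. coverable g N seqs s}"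
  define c where "c = Inf A"
  have "S \<in> A" using fin by (simp add: A_def)
  have lower: "\<eta> \<le> s" if "s \<in> A" for s
    using that pos(2) coverable_mono[of g N1 seqs s N1 seqs \<eta>] by (force simp: A_def)
  have bdd: "bdd_below A" using lower by (auto simp: bdd_below_def)
  have c: "0 < c" using cInf_greatest[of A \<eta>] lower \<open>S \<in> A\<close> pos(1) by (force simp: c_def)
  have "c < c * (1 + \<delta> / 4)" using c \<delta> by simp
  then obtain s where s: "s \<in> A" "s < c * (1 + \<delta> / 4)"
    using cInf_lessD[of A "c * (1 + \<delta> / 4)"] \<open>S \<in> A\<close> by (auto simp: c_def)
  have s0: "0 < s" using lower[OF s(1)] pos(1) by simp
  have "c * (1 - \<delta> / 4) < c" using c \<delta> by simp
  then have "c * (1 - \<delta> / 4) \<notin> A" using cInf_lower[OF _ bdd] by (force simp: c_def)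
  then obtain N0 where N0: "\<not> coverable g N0 seqs (c * (1 - \<delta> / 4))" by (auto simp: A_def)
  define M0 where "M0 = max N0 (nat \<lceil>4 / (c * \<delta>)\<rceil>)"
  have "real (card {z \<in> prefixes K. \<exists>n. M \<le> n \<and> n \<le> K \<and> real M * g n < cube_mass n z}) \<le> \<delta> * real (card D) ^ K"
    (is "real (card ?F) \<le> _") if M: "M0 \<le> M" for M K
  proof (rule ccontr)
    assume contr: "\<not> ?thesis"
    define v where "v = real (card ?F) / real (card D) ^ K"
    have v: "\<delta> < v" using contr card_D_pos by (simp add: v_def pos_less_divide_eq)
    have "4 / (c * \<delta>) \<le> real M" using M unfolding M0_def by linarith
    moreover have c\<delta>: "0 < c * \<delta>" using c \<delta> by simp
    then have "0 < 4 / (c * \<delta>)" by simp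
    ultimately have M1: "0 < real M" and "4 \<le> real M * (c * \<delta>)"
      using c\<delta> by (linarith, simp add: pos_divide_le_eq)
    then have "1 / real M \<le> c * \<delta> / 4" by (simp add: pos_divide_le_eq mult.commute)
    (* The light prefixes are covered at such a deep level that every cube lies in one cylinder. *)
    obtain N2 where N2: "\<And>n k. N2 \<le> n \<Longrightarrow> k < K \<Longrightarrow> vis n k = UNIV" using ex_vis_UNIV by blast
    have cov_s: "coverable g (max M N2) seqs s" using s(1) by (simp add: A_def)
    have "coverable g (max M N2) {x \<in> seqs. restrict x {..<K} \<in> prefixes K - ?F}
        (real (card (prefixes K - ?F)) / real (card D) ^ K * s)"
      by (rule coverable_prefix_set[OF _ g cov_s]) (use N2 in auto)
    also have "real (card (prefixes K - ?F)) / real (card D) ^ K = 1 - v"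
    proof -
      have "real (card (prefixes K - ?F)) = real (card D) ^ K - real (card ?F)"
        using finite_prefixes card_mono[of "prefixes K" ?F]
        by (subst card_Diff_subset) (auto simp: card_prefixes of_nat_diff)
      then show ?thesis using card_D_pos by (simp add: v_def diff_divide_distrib)
    qed
    finally have 1: "coverable g M {x \<in> seqs. restrict x {..<K} \<in> prefixes K - ?F} ((1 - v) * s)"
      by (rule coverable_mono[OF _ max.cobounded1 order_refl order_refl])
    have 2: "coverable g M {x \<in> seqs. \<exists>n. M \<le> n \<and> n \<le> K \<and> real M * g n < cube_mass n x} (1 / real M)"
      by (rule large_mass_coverable[OF M1 g])
    have "x \<in> {x \<in> seqs. restrict x {..<K} \<in> prefixes K - ?F}
        \<union> {x \<in> seqs. \<exists>n. M \<le> n \<and> n \<le> K \<and> real M * g n < cube_mass n x}" if "x \<in> seqs" for x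
    proof -
      have "cube_mass n (restrict x {..<K}) = cube_mass n x" if "n \<le> K" for n
        using that by (intro cube_mass_cong) simp
      then have "restrict x {..<K} \<notin> ?F" if "\<not> (\<exists>n. M \<le> n \<and> n \<le> K \<and> real M * g n < cube_mass n x)"
        using \<open>\<And>n. n \<le> K \<Longrightarrow> cube_mass n (restrict x {..<K}) = cube_mass n x\<close> that by force
      then show ?thesis using seqs_prefix[OF that] that by blast
    qed
    then have "coverable g M seqs ((1 - v) * s + 1 / real M)"
      using coverable_mono[OF coverable_Un[OF g 1 2], of M seqs] by blast
    moreover have "N0 \<le> M" using M by (simp add: M0_def)
    ultimately have "\<not> (1 - v) * s + 1 / real M \<le> c * (1 - \<delta> / 4)"
      using N0 coverable_mono[of g M seqs _ N0 seqs] by blast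
    then have "c * (1 - \<delta> / 4) < (1 - v) * s + c * \<delta> / 4"
      using \<open>1 / real M \<le> c * \<delta> / 4\<close> by linarith
    also have "(1 - v) * s \<le> (1 - \<delta>) * (c * (1 + \<delta> / 4))"
    proof -
      have "(1 - v) * s \<le> (1 - \<delta>) * s" using v s0 by (intro mult_right_mono) auto
      also have "\<dots> \<le> (1 - \<delta>) * (c * (1 + \<delta> / 4))" using s \<delta> by (intro mult_left_mono) auto
      finally show ?thesis .
    qed
    finally have "0 < - (c * \<delta> / 4 + c * \<delta>\<^sup>2 / 4)"
      by (simp add: algebra_simps power2_eq_square)
    moreover have "0 \<le> c * \<delta> / 4 + c * \<delta>\<^sup>2 / 4" using c \<delta> by simp
    ultimately show False by simp
  qed
  then show ?thesis using that by blast
qed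

section \<open>Drift directions\<close>

text \<open>The contribution of a digit \<open>a\<close> to the logarithm of the mass of a cube, when the coordinates in
  \<open>J\<close> are visible at its position.\<close>

definition log_fibre :: "'n set \<Rightarrow> ('n \<Rightarrow> nat) \<Rightarrow> real" where
  "log_fibre J a = ln (real (fibre_card J a) / real (card D))"

definition avg :: "(('n \<Rightarrow> nat) \<Rightarrow> real) \<Rightarrow> real" where
  "avg f = (\<Sum>a\<in>D. f a) / real (card D)"

definition log_fibre_jump :: "real \<Rightarrow> ('n \<Rightarrow> nat) \<Rightarrow> real" where
  "log_fibre_jump t a = jump (\<lambda>J. log_fibre J a) t"

lemma log_fibre_empty [simp]: "log_fibre {} a = 0"
  using card_D_pos by (simp add: log_fibre_def)

lemma ln_cube_mass: "(\<And>k. k < n \<Longrightarrow> x k \<in> D) \<Longrightarrow> ln (cube_mass n x) = (\<Sum>k<n. log_fibre (vis n k) (x k))"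
  unfolding cube_mass_def log_fibre_def using fibre_card_pos card_D_pos by (subst ln_prod) auto

text \<open>Perturbing the digits in the direction \<open>u\<close> at rate \<open>\<epsilon>\<^sub>k\<close> with partial sums \<open>n\<^sup>\<beta>\<close> changes the expected
  logarithm of the mass of a cube of level \<open>n\<close> by \<open>n\<^sup>\<beta>\<close> times the last sum, up to a bounded error.
  The sum is the inner product of \<open>u\<close> with \<open>v = \<Sum>\<^sub>t t\<^sup>\<beta> * log_fibre_jump t\<close>, centred, and \<open>u\<close> is
  a multiple of \<open>v\<close>. A fixed \<open>\<beta>\<close> may give \<open>v = 0\<close>, since the contributions of different thresholds
  can cancel. This cannot happen for all \<open>\<beta>\<close>, by linear independence of the powers \<open>t\<^sup>\<beta>\<close>.\<close>

lemma ex_drift: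
  assumes "\<not> uniform_fibres"
  obtains \<beta> u where "0 < \<beta>" "\<beta> < 1/2" "\<And>a. a \<in> D \<Longrightarrow> \<bar>u a\<bar> \<le> 1" "(\<Sum>a\<in>D. u a) = 0"
    "0 < (\<Sum>t\<in>range theta. t powr \<beta> * avg (\<lambda>a. u a * log_fibre_jump t a))"
proof -
  define wc where "wc t a = log_fibre_jump t a - avg (log_fibre_jump t)" for t a
  have sum_wc: "(\<Sum>a\<in>D. wc t a) = 0" for t
    using card_D_pos by (simp add: wc_def sum_subtractf avg_def)
  have "\<exists>\<beta> a. 0 < \<beta> \<and> \<beta> < 1/2 \<and> a \<in> D \<and> (\<Sum>t\<in>range theta. t powr \<beta> * wc t a) \<noteq> 0"
  proof (rule ccontr)
    assume "\<not> ?thesis"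
    then have "(\<Sum>t\<in>range theta. t powr \<beta> * wc t a) = 0" if "0 < \<beta>" "\<beta> < 1/2" "a \<in> D" for \<beta> a
      using that by blast
    then have wc0: "wc t a = 0" if "t \<in> range theta" "a \<in> D" for t a
      using powr_sum_zero_imp_zero[of "range theta" "\<lambda>t. wc t a" t] that theta_range by auto
    have const: "log_fibre {j. t \<le> theta j} a = log_fibre {j. t \<le> theta j} a'" if "a \<in> D" "a' \<in> D" for t a a'
    proof -
      have tel: "log_fibre {j. t \<le> theta j} a = (\<Sum>s | s \<in> range theta \<and> t \<le> s. log_fibre_jump s a)" for a
        using telescope_thresholds[of "\<lambda>s. t \<le> s" "\<lambda>J. log_fibre J a"] by (simp add: log_fibre_jump_def)
      have "log_fibre_jump s a = log_fibre_jump s a'" if "s \<in> range theta" for s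
        using wc0[OF that \<open>a \<in> D\<close>] wc0[OF that \<open>a' \<in> D\<close>] by (simp add: wc_def)
      then show ?thesis unfolding tel by (intro sum.cong) auto
    qed
    have "fibre_card {j. t \<le> theta j} a * image_card {j. t \<le> theta j} = card D" if a: "a \<in> D" for t a
    proof -
      let ?J = "{j. t \<le> theta j}"
      have "fibre_card ?J b = fibre_card ?J a" if "b \<in> D" for b
        using const[OF that a, of t] fibre_card_pos[OF a, of ?J] fibre_card_pos[OF that, of ?J] card_D_pos
        by (simp add: log_fibre_def)
      then have "card {b \<in> D. dproj ?J b = c} = fibre_card ?J a" if "c \<in> dproj ?J ` D" for c
        using that by (auto simp: fibre_card_def)
      then show ?thesis using sum_fibre_card[of ?J] by (simp add: image_card_def mult.commute)
    qed
    then show False using assms by (simp add: uniform_fibres_def)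
  qed
  then obtain \<beta> a0 where \<beta>: "0 < \<beta>" "\<beta> < 1/2" "a0 \<in> D" "(\<Sum>t\<in>range theta. t powr \<beta> * wc t a0) \<noteq> 0"
    by blast
  define v where "v a = (\<Sum>t\<in>range theta. t powr \<beta> * wc t a)" for a
  define R where "R = (\<Sum>a\<in>D. \<bar>v a\<bar>)"
  have le_R: "\<bar>v a\<bar> \<le> R" if "a \<in> D" for a
    unfolding R_def using finite_D that by (intro member_le_sum) auto
  have R: "0 < R" using le_R[OF \<beta>(3)] \<beta>(4) by (simp add: v_def)
  define u where "u a = v a / R" for a
  have sum_v: "(\<Sum>a\<in>D. v a) = 0"
    unfolding v_def by (subst sum.swap) (simp add: sum_distrib_left[symmetric] sum_wc)
  have sum_u: "(\<Sum>a\<in>D. u a) = 0" by (simp add: u_def sum_divide_distrib[symmetric] sum_v)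
  have "avg (\<lambda>a. u a * log_fibre_jump t a) = avg (\<lambda>a. u a * wc t a)" for t
  proof -
    have "(\<Sum>a\<in>D. u a * wc t a) = (\<Sum>a\<in>D. u a * log_fibre_jump t a) - (\<Sum>a\<in>D. u a) * avg (log_fibre_jump t)"
      by (simp add: wc_def right_diff_distrib sum_subtractf sum_distrib_right)
    then show ?thesis unfolding avg_def[of "\<lambda>a. u a * _ a"] using sum_u by simp
  qed
  then have "(\<Sum>t\<in>range theta. t powr \<beta> * avg (\<lambda>a. u a * log_fibre_jump t a))
      = (\<Sum>t\<in>range theta. \<Sum>a\<in>D. u a * (t powr \<beta> * wc t a)) / real (card D)"
    by (simp add: avg_def sum_divide_distrib sum_distrib_left mult.left_commute)
  also have "\<dots> = (\<Sum>a\<in>D. u a * v a) / real (card D)"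
    unfolding v_def by (subst sum.swap) (simp add: sum_distrib_left)
  also have "(\<Sum>a\<in>D. u a * v a) = (\<Sum>a\<in>D. (v a)\<^sup>2) / R"
    by (simp add: u_def power2_eq_square sum_divide_distrib)
  finally have eq: "(\<Sum>t\<in>range theta. t powr \<beta> * avg (\<lambda>a. u a * log_fibre_jump t a))
      = (\<Sum>a\<in>D. (v a)\<^sup>2) / R / real (card D)" .
  have "0 < (\<Sum>a\<in>D. (v a)\<^sup>2)"
    using finite_D \<beta>(3,4) by (intro sum_pos2[of _ a0]) (auto simp: v_def)
  then have "0 < (\<Sum>t\<in>range theta. t powr \<beta> * avg (\<lambda>a. u a * log_fibre_jump t a))"
    unfolding eq using R card_D_pos by simp
  then show ?thesis
    using that[OF \<beta>(1,2), of u] le_R R sum_u by (simp add: u_def)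
qed

text \<open>By \<open>sum_vis_decompose\<close> the drift at threshold \<open>t\<close> is accumulated over the first \<open>cutoff n t\<close>
  positions, which gives \<open>(cutoff n t)\<^sup>\<beta>\<close>. Replacing this by \<open>(n t)\<^sup>\<beta>\<close> costs at most \<open>1\<close>.\<close>

lemma drift_lower_bound:
  assumes \<beta>: "0 < \<beta>" "\<beta> < 1"
  shows "real n powr \<beta> * (\<Sum>t\<in>range theta. t powr \<beta> * avg (\<lambda>a. u a * log_fibre_jump t a))
      - (\<Sum>t\<in>range theta. \<bar>avg (\<lambda>a. u a * log_fibre_jump t a)\<bar>)
    \<le> (\<Sum>k<n. powr_incr \<beta> k * avg (\<lambda>a. u a * log_fibre (vis n k) a))"
proof -
  let ?w = "\<lambda>t. avg (\<lambda>a. u a * log_fibre_jump t a)"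
  define f where "f k J = powr_incr \<beta> k * avg (\<lambda>a. u a * log_fibre J a)" for k J
  have f0: "f k {} = 0" for k by (simp add: f_def avg_def)
  have jf: "jump (f k) t = powr_incr \<beta> k * ?w t" for k t
    by (simp add: jump_def f_def log_fibre_jump_def avg_def right_diff_distrib sum_subtractf diff_divide_distrib)
  have "(\<Sum>k<n. powr_incr \<beta> k * avg (\<lambda>a. u a * log_fibre (vis n k) a)) = (\<Sum>k<n. f k (vis n k) - f k {})"
    unfolding f0 by (simp add: f_def)
  also have "\<dots> = (\<Sum>t\<in>range theta. real (cutoff n t) powr \<beta> * ?w t)"
    unfolding sum_vis_decompose jf by (simp add: sum_distrib_right[symmetric] sum_powr_incr[OF \<beta>(1)])
  finally have eq: "(\<Sum>k<n. powr_incr \<beta> k * avg (\<lambda>a. u a * log_fibre (vis n k) a))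
      = (\<Sum>t\<in>range theta. real (cutoff n t) powr \<beta> * ?w t)" .
  have "(\<Sum>t\<in>range theta. (real n powr \<beta> * t powr \<beta>) * ?w t - \<bar>?w t\<bar>)
      \<le> (\<Sum>t\<in>range theta. real (cutoff n t) powr \<beta> * ?w t)"
  proof (rule sum_mono)
    fix t assume "t \<in> range theta"
    then have t: "0 \<le> t" using theta_range by force
    have nt: "real n powr \<beta> * t powr \<beta> = (real n * t) powr \<beta>" using t by (simp add: powr_mult)
    have "real (cutoff n t) powr \<beta> \<le> (real n * t) powr \<beta>"
      using cutoff_bounds(1)[OF t, of n] \<beta> by (intro powr_mono2) auto
    moreover have "(real n * t) powr \<beta> \<le> (real (cutoff n t) + 1) powr \<beta>"
      using cutoff_bounds(2)[OF t, of n] \<beta> t by (intro powr_mono2) auto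
    then have "(real n * t) powr \<beta> \<le> real (cutoff n t) powr \<beta> + 1"
      using powr_Suc_le(1)[OF \<beta>, of "real (cutoff n t)"] by simp
    ultimately have "\<bar>(real n * t) powr \<beta> - real (cutoff n t) powr \<beta>\<bar> \<le> 1" by simp
    then have "\<bar>((real n * t) powr \<beta> - real (cutoff n t) powr \<beta>) * ?w t\<bar> \<le> \<bar>?w t\<bar>"
      unfolding abs_mult by (intro mult_left_le_one_le) auto
    then show "(real n powr \<beta> * t powr \<beta>) * ?w t - \<bar>?w t\<bar> \<le> real (cutoff n t) powr \<beta> * ?w t"
      unfolding nt left_diff_distrib by linarith
  qed
  then show ?thesis
    unfolding eq by (simp add: sum_subtractf sum_distrib_left mult.assoc)
qed

section \<open>A coupling of digit sequences\<close>

text \<open>The joint law of a uniform digit \<open>a\<close> and a perturbed digit \<open>b\<close>: with probability \<open>1 - \<epsilon>\<close> they agree,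
  and otherwise \<open>b\<close> is drawn independently with density \<open>1 + u\<close>. So \<open>b\<close> has density \<open>1 + \<epsilon> u\<close>, and the
  digits differ with probability at most \<open>\<epsilon>\<close>.\<close>

definition pair_weight :: "real \<Rightarrow> (('n \<Rightarrow> nat) \<Rightarrow> real) \<Rightarrow> ('n \<Rightarrow> nat) \<Rightarrow> ('n \<Rightarrow> nat) \<Rightarrow> real" where
  "pair_weight \<epsilon> u a b = ((1 - \<epsilon>) * (if a = b then 1 else 0) + \<epsilon> * (1 + u b) / real (card D)) / real (card D)"

lemma pair_weight_nonneg: "0 \<le> \<epsilon> \<Longrightarrow> \<epsilon> \<le> 1 \<Longrightarrow> \<bar>u b\<bar> \<le> 1 \<Longrightarrow> 0 \<le> pair_weight \<epsilon> u a b"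
proof -
  assume \<epsilon>: "0 \<le> \<epsilon>" "\<epsilon> \<le> 1" and "\<bar>u b\<bar> \<le> 1"
  then have "0 \<le> 1 + u b" by linarith
  then show ?thesis
    unfolding pair_weight_def using \<epsilon> by simp
qed

lemma pair_weight_row:
  assumes "a \<in> D" "(\<Sum>b\<in>D. u b) = 0"
  shows "(\<Sum>b\<in>D. pair_weight \<epsilon> u a b) = 1 / real (card D)"
proof -
  have "(\<Sum>b\<in>D. \<epsilon> * (1 + u b) / real (card D)) = \<epsilon>"
    using card_D_pos assms(2)
    by (simp add: sum_divide_distrib[symmetric] sum_distrib_left[symmetric] sum.distrib)
  moreover have "(\<Sum>b\<in>D. (1 - \<epsilon>) * (if a = b then 1 else 0)) = 1 - \<epsilon>"
    using finite_D assms(1) by (simp add: sum_distrib_left[symmetric])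
  ultimately show ?thesis
    by (simp only: pair_weight_def sum_divide_distrib[symmetric] sum.distrib) simp
qed

lemma pair_weight_col:
  assumes "b \<in> D"
  shows "(\<Sum>a\<in>D. pair_weight \<epsilon> u a b) = (1 + \<epsilon> * u b) / real (card D)"
proof -
  have "(\<Sum>a\<in>D. \<epsilon> * (1 + u b) / real (card D)) = \<epsilon> * (1 + u b)"
    using card_D_pos by simp
  moreover have "(\<Sum>a\<in>D. (1 - \<epsilon>) * (if a = b then 1 else 0)) = 1 - \<epsilon>"
    using finite_D assms(1) by (simp add: sum_distrib_left[symmetric])
  ultimately show ?thesis
    by (simp only: pair_weight_def sum_divide_distrib[symmetric] sum.distrib) (simp add: algebra_simps)
qed

text \<open>Only the event of probability \<open>\<epsilon>\<close> contributes, so the mean and the variance of \<open>V b - V a\<close> are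
  at most of order \<open>\<epsilon>\<close>. The bound on the exponential moment inherits this factor.\<close>

lemma pair_weight_exp_le:
  assumes \<epsilon>: "0 \<le> \<epsilon>" and u: "\<And>a. a \<in> D \<Longrightarrow> \<bar>u a\<bar> \<le> 1" "(\<Sum>a\<in>D. u a) = 0"
    and V: "\<And>a b. a \<in> D \<Longrightarrow> b \<in> D \<Longrightarrow> \<bar>V b - V a\<bar> \<le> B" and s: "0 \<le> s" "s * B \<le> 1"
  shows "(\<Sum>a\<in>D. \<Sum>b\<in>D. pair_weight \<epsilon> u a b * exp (- (s * (V b - V a))))
    \<le> exp (\<epsilon> * ((s * B)\<^sup>2 - s * avg (\<lambda>a. u a * V a)))"
proof -
  let ?c = "real (card D)"
  have c: "0 < ?c" using card_D_pos by simp
  let ?h = "\<lambda>a b. exp (- (s * (V b - V a)))"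
  have "(\<Sum>a\<in>D. \<Sum>b\<in>D. pair_weight \<epsilon> u a b * ?h a b)
      = (\<Sum>a\<in>D. \<Sum>b\<in>D. (1 - \<epsilon>) / ?c * (if a = b then 1 else 0) + \<epsilon> / ?c\<^sup>2 * ((1 + u b) * ?h a b))"
    by (intro sum.cong refl) (auto simp: pair_weight_def power2_eq_square add_divide_distrib distrib_right)
  also have "\<dots> = (1 - \<epsilon>) + \<epsilon> / ?c\<^sup>2 * (\<Sum>a\<in>D. \<Sum>b\<in>D. (1 + u b) * ?h a b)"
  proof -
    have "(\<Sum>a\<in>D. \<Sum>b\<in>D. p * (if a = b then 1 else 0) + q * H a b) = p * ?c + q * (\<Sum>a\<in>D. \<Sum>b\<in>D. H a b)"
      for p q :: real and H
      using finite_D by (simp add: sum.distrib sum_distrib_left[symmetric])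
    then have "(\<Sum>a\<in>D. \<Sum>b\<in>D. (1 - \<epsilon>) / ?c * (if a = b then 1 else 0) + \<epsilon> / ?c\<^sup>2 * ((1 + u b) * ?h a b))
        = (1 - \<epsilon>) / ?c * ?c + \<epsilon> / ?c\<^sup>2 * (\<Sum>a\<in>D. \<Sum>b\<in>D. (1 + u b) * ?h a b)" .
    also have "(1 - \<epsilon>) / ?c * ?c = 1 - \<epsilon>" using c by simp
    finally show ?thesis .
  qed
  also have "\<dots> \<le> (1 - \<epsilon>) + \<epsilon> / ?c\<^sup>2 * (\<Sum>a\<in>D. \<Sum>b\<in>D. (1 + u b) * (1 + (s * B)\<^sup>2 - s * (V b - V a)))"
  proof (intro add_left_mono mult_left_mono sum_mono)
    fix a b assume ab: "a \<in> D" "b \<in> D"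
    have 1: "\<bar>- (s * (V b - V a))\<bar> \<le> s * B"
      using V[OF ab] s(1) by (simp add: abs_mult mult_left_mono)
    have "(- (s * (V b - V a)))\<^sup>2 \<le> (s * B)\<^sup>2" using abs_le_square_iff[of "- (s * (V b - V a))" "s * B"] 1 by linarith
    then show "?h a b \<le> 1 + (s * B)\<^sup>2 - s * (V b - V a)"
      using exp_le_quadratic[of "- (s * (V b - V a))"] 1 s(2) by linarith
    show "0 \<le> 1 + u b" using u(1)[OF ab(2)] by linarith
  qed (use \<epsilon> in auto)
  also have "(\<Sum>a\<in>D. \<Sum>b\<in>D. (1 + u b) * (1 + (s * B)\<^sup>2 - s * (V b - V a)))
      = ?c\<^sup>2 * (1 + (s * B)\<^sup>2 - s * avg (\<lambda>a. u a * V a))"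
  proof -
    define Q where "Q = 1 + (s * B)\<^sup>2"
    have "(\<Sum>b\<in>D. (1 + u b) * (Q - s * (V b - V a))) = ?c * Q - s * (\<Sum>b\<in>D. V b) - s * (\<Sum>b\<in>D. u b * V b) + s * V a * ?c" for a
    proof -
      have "(\<Sum>b\<in>D. (1 + u b) * (Q - s * (V b - V a)))
          = (\<Sum>b\<in>D. (Q + s * V a) + (Q + s * V a) * u b - s * V b - s * (u b * V b))"
        by (intro sum.cong refl) (simp add: algebra_simps)
      also have "\<dots> = ?c * (Q + s * V a) + (Q + s * V a) * (\<Sum>b\<in>D. u b) - s * (\<Sum>b\<in>D. V b) - s * (\<Sum>b\<in>D. u b * V b)"
        by (simp add: sum.distrib sum_subtractf sum_distrib_left)
      finally show ?thesis using u(2) by (simp add: algebra_simps)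
    qed
    then have "(\<Sum>a\<in>D. \<Sum>b\<in>D. (1 + u b) * (Q - s * (V b - V a)))
        = (\<Sum>a\<in>D. (?c * Q - s * (\<Sum>b\<in>D. V b) - s * (\<Sum>b\<in>D. u b * V b)) + s * ?c * V a)"
      by (intro sum.cong refl) (simp add: algebra_simps)
    also have "\<dots> = ?c * (?c * Q - s * (\<Sum>b\<in>D. V b) - s * (\<Sum>b\<in>D. u b * V b)) + s * ?c * (\<Sum>a\<in>D. V a)"
      by (simp add: sum.distrib sum_distrib_left)
    also have "\<dots> = ?c\<^sup>2 * (Q - s * ((\<Sum>b\<in>D. u b * V b) / ?c))"
      using c by (simp add: power2_eq_square field_simps)
    finally show ?thesis by (simp only: Q_def avg_def)
  qed
  also have "(1 - \<epsilon>) + \<epsilon> / ?c\<^sup>2 * (?c\<^sup>2 * (1 + (s * B)\<^sup>2 - s * avg (\<lambda>a. u a * V a)))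
      = 1 + \<epsilon> * ((s * B)\<^sup>2 - s * avg (\<lambda>a. u a * V a))"
    using c by (simp add: algebra_simps)
  also have "\<dots> \<le> exp (\<epsilon> * ((s * B)\<^sup>2 - s * avg (\<lambda>a. u a * V a)))"
    by (rule exp_ge_add_one_self)
  finally show ?thesis .
qed

lemma sum_prefixes:
  fixes h :: "nat \<Rightarrow> ('n \<Rightarrow> nat) \<Rightarrow> real"
  shows "(\<Sum>x\<in>prefixes K. \<Prod>k<K. h k (x k)) = (\<Prod>k<K. \<Sum>a\<in>D. h k a)"
  unfolding prefixes_def by (rule prod_sum_PiE[symmetric]) (use finite_D in auto)

lemma sum_prefixes2:
  fixes h :: "nat \<Rightarrow> ('n \<Rightarrow> nat) \<Rightarrow> ('n \<Rightarrow> nat) \<Rightarrow> real"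
  shows "(\<Sum>x\<in>prefixes K. \<Sum>y\<in>prefixes K. \<Prod>k<K. h k (x k) (y k)) = (\<Prod>k<K. \<Sum>a\<in>D. \<Sum>b\<in>D. h k a b)"
proof -
  have "(\<Sum>y\<in>prefixes K. \<Prod>k<K. h k (x k) (y k)) = (\<Prod>k<K. \<Sum>b\<in>D. h k (x k) b)" for x
    by (rule sum_prefixes[where h = "\<lambda>k. h k (x k)"])
  then show ?thesis using sum_prefixes[where h = "\<lambda>k a. \<Sum>b\<in>D. h k a b" and K = K] by simp
qed

definition coupling_weight :: "real \<Rightarrow> (('n \<Rightarrow> nat) \<Rightarrow> real) \<Rightarrow> nat \<Rightarrow> (nat \<Rightarrow> 'n \<Rightarrow> nat) \<Rightarrow> (nat \<Rightarrow> 'n \<Rightarrow> nat) \<Rightarrow> real" where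
  "coupling_weight \<beta> u K x y = (\<Prod>k<K. pair_weight (powr_incr \<beta> k) u (x k) (y k))"

context
  fixes \<beta> :: real and u :: "('n \<Rightarrow> nat) \<Rightarrow> real"
  assumes \<beta>: "0 < \<beta>" "\<beta> < 1/2"
    and u_le: "\<And>a. a \<in> D \<Longrightarrow> \<bar>u a\<bar> \<le> 1" and u_sum: "(\<Sum>a\<in>D. u a) = 0"
begin

lemma coupling_weight_nonneg:
  assumes "y \<in> prefixes K"
  shows "0 \<le> coupling_weight \<beta> u K x y"
  unfolding coupling_weight_def
proof (rule prod_nonneg)
  fix k assume "k \<in> {..<K}"
  then have "y k \<in> D" using prefixes_D[OF assms] by simp
  then show "0 \<le> pair_weight (powr_incr \<beta> k) u (x k) (y k)"
    using \<beta> by (intro pair_weight_nonneg powr_incr_bounds u_le) auto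
qed

lemma coupling_weight_row:
  assumes "x \<in> prefixes K"
  shows "(\<Sum>y\<in>prefixes K. coupling_weight \<beta> u K x y) = 1 / real (card D) ^ K"
proof -
  have "(\<Sum>y\<in>prefixes K. coupling_weight \<beta> u K x y) = (\<Prod>k<K. \<Sum>b\<in>D. pair_weight (powr_incr \<beta> k) u (x k) b)"
    unfolding coupling_weight_def by (rule sum_prefixes)
  also have "\<dots> = (\<Prod>k<K. 1 / real (card D))"
    using prefixes_D[OF assms] u_sum by (intro prod.cong refl pair_weight_row) auto
  finally show ?thesis by (simp add: power_divide)
qed

text \<open>The second sequence has a density with respect to the uniform measure whose square has the integral
  \<open>\<Prod>\<^sub>k (1 + \<epsilon>\<^sub>k\<^sup>2 avg(u\<^sup>2)) \<le> exp (\<Sum>\<^sub>k \<epsilon>\<^sub>k\<^sup>2)\<close>, and the Cauchy-Schwarz inequality applies.\<close>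

lemma coupling_weight_col_square:
  assumes F: "F \<subseteq> prefixes K" and E: "(\<Sum>k<K. (powr_incr \<beta> k)\<^sup>2) \<le> E"
  shows "(\<Sum>x\<in>prefixes K. \<Sum>y\<in>F. coupling_weight \<beta> u K x y)\<^sup>2 \<le> real (card F) / real (card D) ^ K * exp E"
proof -
  let ?c = "real (card D)"
  have c: "0 < ?c" using card_D_pos by simp
  define d where "d y = (\<Prod>k<K. (1 + powr_incr \<beta> k * u (y k)) / ?c)" for y
  have finF: "finite F" using F finite_prefixes finite_subset by blast
  have "(\<Sum>x\<in>prefixes K. \<Sum>y\<in>F. coupling_weight \<beta> u K x y) = (\<Sum>y\<in>F. d y)"
  proof (subst sum.swap, rule sum.cong[OF refl])
    fix y assume "y \<in> F"
    then have y: "y k \<in> D" if "k < K" for k using F that prefixes_D by blast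
    have "(\<Sum>x\<in>prefixes K. coupling_weight \<beta> u K x y) = (\<Prod>k<K. \<Sum>a\<in>D. pair_weight (powr_incr \<beta> k) u a (y k))"
      unfolding coupling_weight_def by (rule sum_prefixes)
    then show "(\<Sum>x\<in>prefixes K. coupling_weight \<beta> u K x y) = d y"
      unfolding d_def using y by (simp add: pair_weight_col)
  qed
  also have "\<dots>\<^sup>2 \<le> (\<Sum>y\<in>F. 1\<^sup>2) * (\<Sum>y\<in>F. (d y)\<^sup>2)"
    using Cauchy_Schwarz_ineq_sum[of "\<lambda>_. 1" d F] by simp
  also have "\<dots> \<le> real (card F) * (\<Sum>y\<in>prefixes K. (d y)\<^sup>2)"
    using finite_prefixes F by (simp add: mult_left_mono sum_mono2)
  also have "(\<Sum>y\<in>prefixes K. (d y)\<^sup>2) = (\<Prod>k<K. \<Sum>b\<in>D. ((1 + powr_incr \<beta> k * u b) / ?c)\<^sup>2)"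
    unfolding d_def prod_power_distrib by (rule sum_prefixes)
  also have "\<dots> \<le> (\<Prod>k<K. exp ((powr_incr \<beta> k)\<^sup>2) / ?c)"
  proof (intro prod_mono conjI sum_nonneg)
    fix k
    have "(\<Sum>b\<in>D. ((1 + powr_incr \<beta> k * u b) / ?c)\<^sup>2)
        = (\<Sum>b\<in>D. 1 + 2 * powr_incr \<beta> k * u b + (powr_incr \<beta> k)\<^sup>2 * (u b)\<^sup>2) / ?c\<^sup>2"
      by (simp add: power_divide sum_divide_distrib[symmetric] power2_sum power_mult_distrib mult.assoc add_ac)
    also have "\<dots> = (?c + (powr_incr \<beta> k)\<^sup>2 * (\<Sum>b\<in>D. (u b)\<^sup>2)) / ?c\<^sup>2"
      by (simp add: sum.distrib sum_distrib_left[symmetric] u_sum)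
    also have "\<dots> \<le> (?c + (powr_incr \<beta> k)\<^sup>2 * ?c) / ?c\<^sup>2"
    proof -
      have "(u b)\<^sup>2 \<le> 1" if "b \<in> D" for b using u_le[OF that] by (simp add: abs_square_le_1)
      then have "(\<Sum>b\<in>D. (u b)\<^sup>2) \<le> (\<Sum>b\<in>D. 1)" by (intro sum_mono) auto
      then show ?thesis by (intro divide_right_mono add_left_mono mult_left_mono) auto
    qed
    also have "\<dots> = (1 + (powr_incr \<beta> k)\<^sup>2) / ?c" using c by (simp add: power2_eq_square field_simps)
    also have "\<dots> \<le> exp ((powr_incr \<beta> k)\<^sup>2) / ?c" by (intro divide_right_mono exp_ge_add_one_self) auto
    finally show "(\<Sum>b\<in>D. ((1 + powr_incr \<beta> k * u b) / ?c)\<^sup>2) \<le> exp ((powr_incr \<beta> k)\<^sup>2) / ?c" .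
  qed auto
  also have "\<dots> = exp (\<Sum>k<K. (powr_incr \<beta> k)\<^sup>2) / ?c ^ K"
    by (simp add: prod_dividef exp_sum)
  also have "\<dots> \<le> exp E / ?c ^ K" using E by (intro divide_right_mono) auto
  finally show ?thesis by (simp add: mult_left_mono)
qed

text \<open>Chernoff's bound for the gain in the logarithm of the mass of the cube of level \<open>n\<close>. For
  \<open>u\<close> from \<open>ex_drift\<close> the expected gain and the variance are both of order \<open>n\<^sup>\<beta>\<close>. A gain below a
  quarter of its mean then has probability at most \<open>exp (- const * n\<^sup>\<beta>)\<close>, up to a constant factor,
  and these bounds are summable over \<open>n\<close>.\<close>

lemma coupling_weight_small_gain:
  assumes "n \<le> K" and B: "\<And>k a b. a \<in> D \<Longrightarrow> b \<in> D \<Longrightarrow> \<bar>log_fibre (vis n k) b - log_fibre (vis n k) a\<bar> \<le> B"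
    and s: "0 \<le> s" "s * B \<le> 1" and T: "0 \<le> B"
  shows "(\<Sum>x\<in>prefixes K. \<Sum>y\<in>{y \<in> prefixes K. (\<Sum>k<K. log_fibre (vis n k) (y k) - log_fibre (vis n k) (x k)) \<le> T}. coupling_weight \<beta> u K x y)
    \<le> exp (s * T + (s * B)\<^sup>2 * real n powr \<beta> - s * (\<Sum>k<n. powr_incr \<beta> k * avg (\<lambda>a. u a * log_fibre (vis n k) a)))"
proof -
  let ?X = "prefixes K" and ?V = "\<lambda>k. log_fibre (vis n k)"
  let ?Y = "\<lambda>x. {y \<in> prefixes K. (\<Sum>k<K. ?V k (y k) - ?V k (x k)) \<le> T}"
  let ?e = "\<lambda>x y. exp (s * T) * (\<Prod>k<K. exp (- (s * (?V k (y k) - ?V k (x k)))))"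
  have e: "?e x y = exp (s * (T - (\<Sum>k<K. ?V k (y k) - ?V k (x k))))" for x y
  proof -
    have "(\<Prod>k<K. exp (- (s * (?V k (y k) - ?V k (x k))))) = exp (\<Sum>k<K. - (s * (?V k (y k) - ?V k (x k))))"
      by (rule exp_sum[symmetric]) simp
    also have "(\<Sum>k<K. - (s * (?V k (y k) - ?V k (x k)))) = - s * (\<Sum>k<K. ?V k (y k) - ?V k (x k))"
      by (simp add: sum_distrib_left sum_negf)
    finally show ?thesis by (simp add: exp_add[symmetric] right_diff_distrib)
  qed
  have "(\<Sum>x\<in>?X. \<Sum>y\<in>?Y x. coupling_weight \<beta> u K x y) \<le> (\<Sum>x\<in>?X. \<Sum>y\<in>?X. ?e x y * coupling_weight \<beta> u K x y)"
  proof (rule sum_mono)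
    fix x
    have "(\<Sum>y\<in>?Y x. coupling_weight \<beta> u K x y) \<le> (\<Sum>y\<in>?Y x. ?e x y * coupling_weight \<beta> u K x y)"
    proof (rule sum_mono)
      fix y assume y: "y \<in> ?Y x"
      then have "0 \<le> s * (T - (\<Sum>k<K. ?V k (y k) - ?V k (x k)))"
        using s(1) by (intro mult_nonneg_nonneg) auto
      then have "1 \<le> ?e x y" unfolding e by simp
      then show "coupling_weight \<beta> u K x y \<le> ?e x y * coupling_weight \<beta> u K x y"
        using y coupling_weight_nonneg[of y K x] mult_right_mono[of 1 "?e x y" "coupling_weight \<beta> u K x y"] by simp
    qed
    also have "\<dots> \<le> (\<Sum>y\<in>?X. ?e x y * coupling_weight \<beta> u K x y)"
    proof (rule sum_mono2[OF finite_prefixes])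
      show "?Y x \<subseteq> ?X" by blast
      show "0 \<le> ?e x y * coupling_weight \<beta> u K x y" if "y \<in> ?X - ?Y x" for y
        using that unfolding e by (intro mult_nonneg_nonneg coupling_weight_nonneg) auto
    qed
    finally show "(\<Sum>y\<in>?Y x. coupling_weight \<beta> u K x y) \<le> (\<Sum>y\<in>?X. ?e x y * coupling_weight \<beta> u K x y)" .
  qed
  also have "\<dots> = exp (s * T) * (\<Sum>x\<in>?X. \<Sum>y\<in>?X. \<Prod>k<K. pair_weight (powr_incr \<beta> k) u (x k) (y k) * exp (- (s * (?V k (y k) - ?V k (x k)))))"
    by (simp add: sum_distrib_left coupling_weight_def prod.distrib mult_ac)
  also have "\<dots> = exp (s * T) * (\<Prod>k<K. \<Sum>a\<in>D. \<Sum>b\<in>D. pair_weight (powr_incr \<beta> k) u a b * exp (- (s * (?V k b - ?V k a))))"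
    by (subst sum_prefixes2) simp
  also have "\<dots> \<le> exp (s * T) * (\<Prod>k<K. exp (powr_incr \<beta> k * ((s * (if k < n then B else 0))\<^sup>2 - s * avg (\<lambda>a. u a * ?V k a))))"
  proof (intro mult_left_mono prod_mono conjI)
    fix k
    show "(\<Sum>a\<in>D. \<Sum>b\<in>D. pair_weight (powr_incr \<beta> k) u a b * exp (- (s * (?V k b - ?V k a))))
        \<le> exp (powr_incr \<beta> k * ((s * (if k < n then B else 0))\<^sup>2 - s * avg (\<lambda>a. u a * ?V k a)))"
    proof (rule pair_weight_exp_le)
      show "\<bar>?V k b - ?V k a\<bar> \<le> (if k < n then B else 0)" if "a \<in> D" "b \<in> D" for a b
        using B[OF that] vis_empty[of n k] by simp
    qed (use \<beta> powr_incr_bounds[of \<beta> k] u_le u_sum s in auto)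
    show "0 \<le> (\<Sum>a\<in>D. \<Sum>b\<in>D. pair_weight (powr_incr \<beta> k) u a b * exp (- (s * (?V k b - ?V k a))))"
      using \<beta> by (intro sum_nonneg mult_nonneg_nonneg pair_weight_nonneg powr_incr_bounds u_le) auto
  qed simp
  also have "\<dots> = exp (s * T + (\<Sum>k<K. powr_incr \<beta> k * ((s * (if k < n then B else 0))\<^sup>2 - s * avg (\<lambda>a. u a * ?V k a))))"
    by (simp add: exp_add exp_sum)
  also have "(\<Sum>k<K. powr_incr \<beta> k * ((s * (if k < n then B else 0))\<^sup>2 - s * avg (\<lambda>a. u a * ?V k a)))
      = (\<Sum>k<n. powr_incr \<beta> k * ((s * B)\<^sup>2 - s * avg (\<lambda>a. u a * ?V k a)))"
  proof (rule sum.mono_neutral_cong_right)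
    show "\<forall>k\<in>{..<K} - {..<n}. powr_incr \<beta> k * ((s * (if k < n then B else 0))\<^sup>2 - s * avg (\<lambda>a. u a * ?V k a)) = 0"
      using vis_empty[of n] by (auto simp: avg_def)
  qed (use \<open>n \<le> K\<close> in auto)
  also have "\<dots> = (s * B)\<^sup>2 * (\<Sum>k<n. powr_incr \<beta> k) - s * (\<Sum>k<n. powr_incr \<beta> k * avg (\<lambda>a. u a * ?V k a))"
    unfolding right_diff_distrib sum_subtractf sum_distrib_right[symmetric] by (simp add: sum_distrib_left mult_ac)
  finally show ?thesis by (simp add: sum_powr_incr[OF \<beta>(1)] algebra_simps)
qed

end

section \<open>Sponges without uniform fibres\<close>

text \<open>Under the coupling, the first sequence has a cube of mass above \<open>c * g n\<close> for some level
  \<open>n \<in> {N..K}\<close> with probability at least \<open>1/2\<close>. Except with probability \<open>1/8\<close>, the mass of the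
  corresponding cube of the second sequence is larger by a factor that exceeds \<open>M / c\<close>. But the second
  sequence has cubes of mass above \<open>M * g n\<close> only with probability at most \<open>1/4\<close>.\<close>

lemma nonuniform_no_finite_positive_cost:
  assumes nonuniform: "\<not> uniform_fibres" and g: "\<And>n. 0 \<le> g n"
    and fin: "\<And>N. coverable g N seqs S" and pos: "0 < \<eta>" "\<not> coverable g N1 seqs \<eta>"
  shows False
proof -
  obtain \<beta> u where bu: "0 < \<beta>" "\<beta> < 1/2" "\<And>a. a \<in> D \<Longrightarrow> \<bar>u a\<bar> \<le> 1" "(\<Sum>a\<in>D. u a) = 0"
    "0 < (\<Sum>t\<in>range theta. t powr \<beta> * avg (\<lambda>a. u a * log_fibre_jump t a))"
    using ex_drift[OF nonuniform] by blast
  note \<beta> = bu(1,2) and u = bu(3,4)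
  define \<kappa> where "\<kappa> = (\<Sum>t\<in>range theta. t powr \<beta> * avg (\<lambda>a. u a * log_fibre_jump t a))"
  have \<kappa>: "0 < \<kappa>" using bu(5) by (simp add: \<kappa>_def)
  define A where "A = (\<Sum>t\<in>range theta. \<bar>avg (\<lambda>a. u a * log_fibre_jump t a)\<bar>)"
  (* The summand 1 only ensures that B is positive. *)
  define B where "B = ln (real (card D)) + 1"
  have cD: "1 \<le> real (card D)" using card_D_pos by (simp add: Suc_le_eq)
  have B: "0 < B" using ln_ge_zero[OF cD] by (simp add: B_def)
  have log_fibre_diff: "\<bar>log_fibre J b - log_fibre J a\<bar> \<le> B" if "a \<in> D" "b \<in> D" for J a b
  proof -
    have "- ln (real (card D)) \<le> log_fibre J a \<and> log_fibre J a \<le> 0" if "a \<in> D" for a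
    proof -
      have "1 \<le> real (fibre_card J a)" using fibre_card_pos[OF that, of J] by (simp add: Suc_le_eq)
      then have "0 \<le> ln (real (fibre_card J a))" "ln (real (fibre_card J a)) \<le> ln (real (card D))"
        using fibre_card_le[of J a] by auto
      moreover have "log_fibre J a = ln (real (fibre_card J a)) - ln (real (card D))"
        using \<open>1 \<le> real (fibre_card J a)\<close> cD by (simp add: log_fibre_def ln_div)
      ultimately show ?thesis by simp
    qed
    from this[OF that(1)] this[OF that(2)] show ?thesis by (simp add: B_def abs_le_iff)
  qed
  (* With this choice the variance term is at most a quarter of the drift, and the requested gain,
     which is a quarter of the drift too, leaves half of the drift in the exponent. *)
  define s where "s = min (1 / B) (\<kappa> / (4 * B\<^sup>2))"
  have s: "0 < s" "s * B \<le> 1" "s * B\<^sup>2 \<le> \<kappa> / 4"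
  proof -
    show "0 < s" using B \<kappa> by (simp add: s_def)
    have "s * B \<le> 1 / B * B" unfolding s_def using B by (intro mult_right_mono) auto
    then show "s * B \<le> 1" using B by simp
    have "s * B\<^sup>2 \<le> \<kappa> / (4 * B\<^sup>2) * B\<^sup>2" unfolding s_def by (intro mult_right_mono) auto
    then show "s * B\<^sup>2 \<le> \<kappa> / 4" using B by simp
  qed
  let ?bad = "\<lambda>K n x. {y \<in> prefixes K. (\<Sum>k<K. log_fibre (vis n k) (y k) - log_fibre (vis n k) (x k)) \<le> \<kappa> / 4 * real n powr \<beta>}"
  have bad: "(\<Sum>x\<in>prefixes K. \<Sum>y\<in>?bad K n x. coupling_weight \<beta> u K x y) \<le> exp (s * A) * exp (- (s * \<kappa> / 2 * real n powr \<beta>))"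
    if "n \<le> K" for n K
  proof -
    have "(\<Sum>x\<in>prefixes K. \<Sum>y\<in>?bad K n x. coupling_weight \<beta> u K x y)
      \<le> exp (s * (\<kappa> / 4 * real n powr \<beta>) + (s * B)\<^sup>2 * real n powr \<beta>
            - s * (\<Sum>k<n. powr_incr \<beta> k * avg (\<lambda>a. u a * log_fibre (vis n k) a)))"
      using s B by (intro coupling_weight_small_gain \<beta> u that log_fibre_diff) auto
    also have "\<dots> \<le> exp (s * A + - (s * \<kappa> / 2 * real n powr \<beta>))"
    proof -
      have "(s * B)\<^sup>2 * real n powr \<beta> = s * (s * B\<^sup>2) * real n powr \<beta>"
        by (simp add: power2_eq_square)
      also have "\<dots> \<le> s * (\<kappa> / 4) * real n powr \<beta>"
        using s by (intro mult_right_mono mult_left_mono) auto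
      finally have 1: "(s * B)\<^sup>2 * real n powr \<beta> \<le> s * \<kappa> / 4 * real n powr \<beta>" by simp
      have "s * (real n powr \<beta> * \<kappa> - A) \<le> s * (\<Sum>k<n. powr_incr \<beta> k * avg (\<lambda>a. u a * log_fibre (vis n k) a))"
        using drift_lower_bound[of \<beta> n u] \<beta> s(1) by (intro mult_left_mono) (auto simp: \<kappa>_def A_def)
      then have 2: "s * \<kappa> * real n powr \<beta> - s * A \<le> s * (\<Sum>k<n. powr_incr \<beta> k * avg (\<lambda>a. u a * log_fibre (vis n k) a))"
        by (simp add: algebra_simps)
      have "s * (\<kappa> / 4 * real n powr \<beta>) + s * \<kappa> / 4 * real n powr \<beta> - (s * \<kappa> * real n powr \<beta> - s * A)
          = s * A + - (s * \<kappa> / 2 * real n powr \<beta>)"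
        by (simp add: algebra_simps)
      then show ?thesis using 1 2 by simp
    qed
    finally show ?thesis by (simp only: exp_add)
  qed
  define q where "q n = exp (s * A) * exp (- (s * \<kappa> / 2 * real n powr \<beta>))" for n
  have q_sum: "summable q"
    unfolding q_def using s(1) \<kappa> \<beta> by (intro summable_mult summable_exp_neg_powr) auto
  obtain E where E: "\<And>n. (\<Sum>k<n. (powr_incr \<beta> k)\<^sup>2) \<le> E"
    using sum_powr_incr_square_bounded[OF \<beta>] by blast
  define \<delta> where "\<delta> = min (1/2) (exp (- E) / 16)"
  have \<delta>: "0 < \<delta>" "\<delta> < 1" "\<delta> * exp E \<le> (1/4)\<^sup>2"
  proof -
    have "\<delta> * exp E \<le> exp (- E) / 16 * exp E" unfolding \<delta>_def by (intro mult_right_mono) auto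
    also have "\<dots> = (1/4)\<^sup>2" by (simp add: exp_minus power2_eq_square)
    finally show "\<delta> * exp E \<le> (1/4)\<^sup>2" .
  qed (auto simp: \<delta>_def)
  obtain M where M: "\<And>K. real (card {z \<in> prefixes K. \<exists>n. M \<le> n \<and> n \<le> K \<and> real M * g n < cube_mass n z})
      \<le> \<delta> * real (card D) ^ K"
  proof -
    obtain M0 where "\<And>M K. M0 \<le> M \<Longrightarrow>
        real (card {z \<in> prefixes K. \<exists>n. M \<le> n \<and> n \<le> K \<and> real M * g n < cube_mass n z}) \<le> \<delta> * real (card D) ^ K"
      using rare_large_mass[OF g fin pos \<delta>(1,2)] by blast
    from that[OF this[OF order_refl]] show ?thesis .
  qed
  have S: "0 < S"
  proof (rule ccontr)
    assume "\<not> 0 < S"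
    then have "S \<le> \<eta>" using pos(1) by simp
    then show False using coverable_mono[OF fin[of N1] order_refl order_refl] pos(2) by blast
  qed
  have "\<forall>\<^sub>F N in sequentially. \<forall>K. (\<Sum>n=N..K. q n) \<le> 1/8"
  proof -
    have "\<forall>\<^sub>F N in sequentially. norm (\<Sum>i. q (i + N)) < 1/8"
      using suminf_exist_split[of "1/8" q] q_sum by (auto simp: eventually_sequentially)
    then show ?thesis
    proof (rule eventually_mono)
      fix N assume N: "norm (\<Sum>i. q (i + N)) < 1/8"
      show "\<forall>K. (\<Sum>n=N..K. q n) \<le> 1/8"
      proof
        fix K
        have "(\<Sum>n=N..K. q n) \<le> (\<Sum>i. q (i + N))"
          by (rule sum_tail_le_suminf[OF q_sum]) (auto simp: q_def)
        then show "(\<Sum>n=N..K. q n) \<le> 1/8" using N by simp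
      qed
    qed
  qed
  moreover have "\<forall>\<^sub>F N in sequentially. ln (2 * S * (real M + 1)) \<le> \<kappa> / 4 * real N powr \<beta>"
  proof -
    define L where "L = max 0 (ln (2 * S * (real M + 1)) / (\<kappa> / 4))"
    have "L \<le> real N powr \<beta>" if "nat \<lceil>L powr (1 / \<beta>)\<rceil> \<le> N" for N
    proof -
      have "(L powr (1 / \<beta>)) powr \<beta> \<le> real N powr \<beta>"
        using that \<beta> by (intro powr_mono2) (simp_all add: nat_le_iff ceiling_le_iff)
      then show ?thesis using \<beta> by (simp add: powr_powr L_def)
    qed
    moreover have "ln (2 * S * (real M + 1)) / (\<kappa> / 4) \<le> L" by (simp add: L_def)
    ultimately have large: "ln (2 * S * (real M + 1)) / (\<kappa> / 4) \<le> real N powr \<beta>"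
      if "nat \<lceil>L powr (1 / \<beta>)\<rceil> \<le> N" for N
      using that order_trans by blast
    have "ln (2 * S * (real M + 1)) \<le> \<kappa> / 4 * real N powr \<beta>"
      if "nat \<lceil>L powr (1 / \<beta>)\<rceil> \<le> N" for N
    proof -
      have k: "0 < \<kappa> / 4" using \<kappa> by simp
      from pos_divide_le_eq[OF k, THEN iffD1, OF large[OF that]]
      show ?thesis by (simp only: mult.commute)
    qed
    then show ?thesis unfolding eventually_sequentially by blast
  qed
  ultimately have "\<forall>\<^sub>F N in sequentially. (\<forall>K. (\<Sum>n=N..K. q n) \<le> 1/8)
      \<and> ln (2 * S * (real M + 1)) \<le> \<kappa> / 4 * real N powr \<beta> \<and> M \<le> N"
    using eventually_ge_at_top[of M] by (intro eventually_conj)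
  then obtain N where N: "\<And>K. (\<Sum>n=N..K. q n) \<le> 1/8" "ln (2 * S * (real M + 1)) \<le> \<kappa> / 4 * real N powr \<beta>" "M \<le> N"
    using eventually_happens by force
  (* Light cubes then carry at most the mass c * S = 1/2. *)
  define c where "c = 1 / (2 * S)"
  have c: "0 < c" using S by (simp add: c_def)
  obtain K where K: "N \<le> K"
    "real (card {z \<in> prefixes K. \<forall>n. N \<le> n \<longrightarrow> n \<le> K \<longrightarrow> cube_mass n z \<le> c * g n}) \<le> c * S * real (card D) ^ K"
    using mass_distribution[OF fin[of N] less_imp_le[OF c] g] by blast
  let ?X = "prefixes K" and ?cK = "real (card D) ^ K"
  have cK: "0 < ?cK" using card_D_pos by simp
  define U where "U = {z \<in> ?X. \<not> (\<forall>n. N \<le> n \<longrightarrow> n \<le> K \<longrightarrow> cube_mass n z \<le> c * g n)}"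
  define F where "F = {z \<in> ?X. \<exists>n. M \<le> n \<and> n \<le> K \<and> real M * g n < cube_mass n z}"
  have UF: "U \<subseteq> ?X" "F \<subseteq> ?X" by (auto simp: U_def F_def)
  have fin': "finite U" "finite F" using UF finite_prefixes finite_subset by blast+
  have "?X = U \<union> {z \<in> ?X. \<forall>n. N \<le> n \<longrightarrow> n \<le> K \<longrightarrow> cube_mass n z \<le> c * g n}" by (auto simp: U_def)
  from arg_cong[OF this, of card]
  have "card ?X \<le> card U + card {z \<in> ?X. \<forall>n. N \<le> n \<longrightarrow> n \<le> K \<longrightarrow> cube_mass n z \<le> c * g n}"
    by (simp only: card_Un_le)
  then have "real (card ?X) \<le> real (card U) + real (card {z \<in> ?X. \<forall>n. N \<le> n \<longrightarrow> n \<le> K \<longrightarrow> cube_mass n z \<le> c * g n})"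
    by linarith
  moreover have "real (card ?X) = ?cK" by (simp add: card_prefixes)
  moreover have "c * S * ?cK = 1/2 * ?cK" using S by (simp add: c_def)
  ultimately have "1/2 * ?cK \<le> real (card U)" using K(2) by linarith
  then have U_half: "1/2 \<le> real (card U) / ?cK" using cK by (simp only: pos_le_divide_eq)
  have gain: "y \<in> F \<or> (\<exists>n\<in>{N..K}. y \<in> ?bad K n x)" if x: "x \<in> U" and y: "y \<in> ?X" for x y
  proof (rule ccontr)
    assume no: "\<not> ?thesis"
    have xX: "x \<in> ?X" using x UF by blast
    obtain n where n: "N \<le> n" "n \<le> K" "c * g n < cube_mass n x" using x unfolding U_def not_le[symmetric] by blast
    have mp: "0 < cube_mass n x" "0 < cube_mass n y"
      using n(2) by (intro cube_mass_pos prefixes_D[OF xX] prefixes_D[OF y]; simp)+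
    have sums: "(\<Sum>k<K. log_fibre (vis n k) (z k)) = ln (cube_mass n z)" if "z \<in> ?X" for z
    proof -
      have "(\<Sum>k<K. log_fibre (vis n k) (z k)) = (\<Sum>k<n. log_fibre (vis n k) (z k))"
        using n vis_empty[of n] by (intro sum.mono_neutral_right) auto
      also have "\<dots> = ln (cube_mass n z)" using n prefixes_D[OF that] by (intro ln_cube_mass[symmetric]) auto
      finally show ?thesis .
    qed
    have "y \<notin> ?bad K n x" using no n(1,2) by (meson atLeastAtMost_iff)
    then have "\<kappa> / 4 * real n powr \<beta> < ln (cube_mass n y) - ln (cube_mass n x)"
      using y by (simp add: sum_subtractf sums[OF y] sums[OF xX])
    moreover have "\<kappa> / 4 * real N powr \<beta> \<le> \<kappa> / 4 * real n powr \<beta>"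
      using n \<kappa> \<beta> by (intro mult_left_mono powr_mono2) auto
    ultimately have "ln (2 * S * (real M + 1)) < ln (cube_mass n y) - ln (cube_mass n x)" using N(2) by linarith
    then have "ln (2 * S * (real M + 1)) + ln (cube_mass n x) < ln (cube_mass n y)" by simp
    then have "ln (2 * S * (real M + 1) * cube_mass n x) < ln (cube_mass n y)"
      using S mp by (subst ln_mult) auto
    then have "2 * S * (real M + 1) * cube_mass n x < cube_mass n y"
      using S mp by (subst (asm) ln_less_cancel_iff) auto
    moreover have "2 * S * (real M + 1) * (c * g n) \<le> 2 * S * (real M + 1) * cube_mass n x"
      using n(3) S by (intro mult_left_mono) auto
    moreover have "2 * S * (real M + 1) * (c * g n) = (real M + 1) * g n"
      using S by (simp add: c_def)
    moreover have "real M * g n \<le> (real M + 1) * g n" using g[of n] by (simp add: distrib_right)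
    ultimately have "real M * g n < cube_mass n y" by linarith
    then have "y \<in> F" using y n(2) le_trans[OF N(3) n(1)] unfolding F_def by blast
    then show False using no by blast
  qed
  have "1/2 \<le> (\<Sum>x\<in>U. \<Sum>y\<in>?X. coupling_weight \<beta> u K x y)"
  proof -
    have "(\<Sum>x\<in>U. \<Sum>y\<in>?X. coupling_weight \<beta> u K x y) = (\<Sum>x\<in>U. 1 / ?cK)"
      using UF by (intro sum.cong refl coupling_weight_row \<beta> u) auto
    then show ?thesis using U_half by simp
  qed
  also have "\<dots> \<le> (\<Sum>x\<in>?X. (\<Sum>y\<in>F. coupling_weight \<beta> u K x y) + (\<Sum>n=N..K. \<Sum>y\<in>?bad K n x. coupling_weight \<beta> u K x y))"
  proof -
    have nn: "0 \<le> coupling_weight \<beta> u K x y" if "y \<in> ?X" for x y using coupling_weight_nonneg[OF \<beta> u that] .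
    have "(\<Sum>x\<in>U. \<Sum>y\<in>?X. coupling_weight \<beta> u K x y) \<le> (\<Sum>x\<in>U. (\<Sum>y\<in>F. coupling_weight \<beta> u K x y) + (\<Sum>n=N..K. \<Sum>y\<in>?bad K n x. coupling_weight \<beta> u K x y))"
    proof (rule sum_mono)
      fix x assume x: "x \<in> U"
      have finb: "finite (?bad K n x)" for n using finite_prefixes by simp
      have "(\<Sum>y\<in>?X. coupling_weight \<beta> u K x y) \<le> (\<Sum>y\<in>F \<union> (\<Union>n\<in>{N..K}. ?bad K n x). coupling_weight \<beta> u K x y)"
      proof (rule sum_mono2)
        show "finite (F \<union> (\<Union>n\<in>{N..K}. ?bad K n x))" using fin'(2) finb by blast
        show "?X \<subseteq> F \<union> (\<Union>n\<in>{N..K}. ?bad K n x)" using gain[OF x] by blast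
        show "0 \<le> coupling_weight \<beta> u K x y" if "y \<in> F \<union> (\<Union>n\<in>{N..K}. ?bad K n x) - ?X" for y
          using that UF(2) nn by blast
      qed
      also have "\<dots> \<le> (\<Sum>y\<in>F. coupling_weight \<beta> u K x y) + (\<Sum>y\<in>(\<Union>n\<in>{N..K}. ?bad K n x). coupling_weight \<beta> u K x y)"
      proof -
        have "0 \<le> (\<Sum>y\<in>F \<inter> (\<Union>n\<in>{N..K}. ?bad K n x). coupling_weight \<beta> u K x y)"
          using UF(2) nn by (intro sum_nonneg) auto
        moreover have "finite (\<Union>n\<in>{N..K}. ?bad K n x)" using finb by blast
        ultimately show ?thesis
          using sum.union_inter[OF fin'(2), of "\<Union>n\<in>{N..K}. ?bad K n x" "coupling_weight \<beta> u K x"] by linarith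
      qed
      also have "(\<Sum>y\<in>(\<Union>n\<in>{N..K}. ?bad K n x). coupling_weight \<beta> u K x y) \<le> (\<Sum>n=N..K. \<Sum>y\<in>?bad K n x. coupling_weight \<beta> u K x y)"
        using finb nn by (intro sum_UN_le) auto
      finally show "(\<Sum>y\<in>?X. coupling_weight \<beta> u K x y) \<le> (\<Sum>y\<in>F. coupling_weight \<beta> u K x y) + (\<Sum>n=N..K. \<Sum>y\<in>?bad K n x. coupling_weight \<beta> u K x y)"
        by simp
    qed
    also have "\<dots> \<le> (\<Sum>x\<in>?X. (\<Sum>y\<in>F. coupling_weight \<beta> u K x y) + (\<Sum>n=N..K. \<Sum>y\<in>?bad K n x. coupling_weight \<beta> u K x y))"
      using UF nn finite_prefixes by (intro sum_mono2 add_nonneg_nonneg sum_nonneg) auto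
    finally show ?thesis .
  qed
  also have "\<dots> = (\<Sum>x\<in>?X. \<Sum>y\<in>F. coupling_weight \<beta> u K x y) + (\<Sum>n=N..K. \<Sum>x\<in>?X. \<Sum>y\<in>?bad K n x. coupling_weight \<beta> u K x y)"
    unfolding sum.distrib by (subst (2) sum.swap) (rule refl)
  also have "\<dots> \<le> 1/4 + 1/8"
  proof (rule add_mono)
    have "(\<Sum>x\<in>?X. \<Sum>y\<in>F. coupling_weight \<beta> u K x y)\<^sup>2 \<le> real (card F) / ?cK * exp E"
      by (rule coupling_weight_col_square[OF \<beta> u UF(2) E])
    also have "\<dots> \<le> \<delta> * exp E"
      using M[of K] cK by (intro mult_right_mono) (auto simp: F_def pos_divide_le_eq)
    also have "\<dots> \<le> (1/4)\<^sup>2" by (rule \<delta>(3))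
    finally show "(\<Sum>x\<in>?X. \<Sum>y\<in>F. coupling_weight \<beta> u K x y) \<le> 1/4" by (rule power2_le_imp_le) simp
    have "(\<Sum>n=N..K. \<Sum>x\<in>?X. \<Sum>y\<in>?bad K n x. coupling_weight \<beta> u K x y) \<le> (\<Sum>n=N..K. q n)"
      unfolding q_def by (intro sum_mono bad) auto
    then show "(\<Sum>n=N..K. \<Sum>x\<in>?X. \<Sum>y\<in>?bad K n x. coupling_weight \<beta> u K x y) \<le> 1/8" using N(1)[of K] by simp
  qed
  finally show False by simp
qed

lemma nonuniform_no_gauge:
  assumes "\<not> uniform_fibres" "gauge_function \<phi>"
    and pos: "0 < hausdorff_measure \<phi> (sponge m D)" and fin: "hausdorff_measure \<phi> (sponge m D) < \<infinity>"
  shows False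
proof -
  note reg = gauge_function_regular[OF assms(2)]
  have g: "0 \<le> cube_gauge \<phi> n" for n
    using mono_onD[OF reg(1), of 0 "cube_size / 2 ^ n"] reg(3) cube_size_pos by (simp add: cube_gauge_def)
  obtain S where S: "\<And>N. coverable (cube_gauge \<phi>) N seqs S"
    using hausdorff_measure_finite_imp_coverable[OF assms(2) fin] by blast
  obtain \<eta> :: ennreal where "0 < \<eta>" "\<eta> < hausdorff_measure \<phi> (sponge m D)" using dense[OF pos] by blast
  then obtain e where e: "0 < e" "ennreal e < hausdorff_measure \<phi> (sponge m D)"
    by (cases \<eta>) auto
  have "\<exists>N. \<not> coverable (cube_gauge \<phi>) N seqs e"
    using hausdorff_measure_le_of_coverable[OF reg(1,3), of e] e(2) by (meson not_le)
  then show False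
    using nonuniform_no_finite_positive_cost[OF assms(1) g S e(1)] by blast
qed

end

theorem theorem1p2:
  fixes m :: "'n::{finite, linorder} \<Rightarrow> nat" and D :: "('n \<Rightarrow> nat) set"
  assumes "CARD('n) \<ge> 3"
    and "antimono m"
    and "\<And>j. m j \<ge> 2"
    and "D \<noteq> {}"
    and "D \<subseteq> digit_alphabet m"
  shows "hausdorff_dim (sponge m D) = box_dim (sponge m D) \<longleftrightarrow>
    (\<exists>\<phi>. gauge_function \<phi> \<and> 0 < hausdorff_measure \<phi> (sponge m D)
                          \<and> hausdorff_measure \<phi> (sponge m D) < \<infinity>)"
proof -
  interpret sponge_data m D using assms(3-5) by unfold_locales
  show ?thesis
  proof (cases uniform_fibres)
    case True
    have "gauge_function (power_gauge cube_exponent)" by (rule power_gauge_gauge[OF cube_exponent_nonneg])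
    then show ?thesis
      using uniform_hausdorff_dim[OF True] box_dim_sponge
        uniform_hausdorff_measure_pos[OF True cube_exponent_nonneg order_refl] hausdorff_measure_cube_exponent_finite
      by auto
  next
    case False
    then show ?thesis
      using nonuniform_hausdorff_dim_less[OF False] box_dim_sponge nonuniform_no_gauge[OF False] by auto
  qed
qed

end
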